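(* The $A(SU_q(2))$-Hopf-Galois extension $A(S^4_q)\subset A(S^7_q)$, with respect to the right coaction $\delta_R:A(S^7_q)\to A(S^7_q)\otimes A(SU_q(2))$, is not cleft.
   Context: Fix $q\in\mathbb{R}$, $q\neq 0$; algebras are unital and over $\mathbb{C}$. For $i\in\{1,2,3,4\}$ put $i'=5-i$, $(\varepsilon_1,\varepsilon_2,\varepsilon_3,\varepsilon_4)=(1,1,-1,-1)$, $(\rho_1,\rho_2,\rho_3,\rho_4)=(2,1,-1,-2)$. Let $e_i^{\,j}\in M_4(\mathbb{C})$ be the matrix unit with $1$ in row $i$, column $j$, and let $$R=q\sum_{i}e_i^{\,i}\otimes e_i^{\,i}+\sum_{i\neq j,j'}e_i^{\,i}\otimes e_j^{\,j}+q^{-1}\sum_i e_{i'}^{\,i'}\otimes e_i^{\,i}+(q-q^{-1})\sum_{i>j}e_i^{\,j}\otimes e_j^{\,i}-(q-q^{-1})\sum_{i>j}q^{\rho_i-\rho_j}\varepsilon_i\varepsilon_j\,e_i^{\,j}\otimes e_{i'}^{\,j'},$$ with $i,j$ ranging over $1,\dots,4$. Let $C$ be the matrix $C_i^{\,j}=q^{\rho_j}\varepsilon_i\delta_{ij'}$. $A(Sp_q(2))$ is the algebra generated by the entries $T_i^{\,j}$ (row $i$, column $j$, $1\le i,j\le 4$) of a matrix $T$ with relations $R\,T_1T_2=T_2T_1R$ (where $T_1=T\otimes 1$, $T_2=1\otimes T$), and $TCT^tC^{-1}=CT^tC^{-1}T=1$. It is a Hopf $*$-algebra with $\Delta(T_i^{\,j})=\sum_kT_i^{\,k}\otimes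 T_k^{\,j}$, $\varepsilon(T_i^{\,j})=\delta_{ij}$, $S(T)=CT^tC^{-1}$, i.e. $S(T)_i^{\,j}=-q^{\rho_{i'}+\rho_j}\varepsilon_i\varepsilon_{j'}T_{j'}^{\,i'}$, and antilinear anti-involution (denoted by a bar) $\overline{T}=S(T)^t$, i.e. $\overline{T_i^{\,j}}=S(T)_j^{\,i}$. $A(S^7_q)$ is the subalgebra of $A(Sp_q(2))$ generated by $x_i=T_i^{\,4}$ and $\bar x^i=\overline{x_i}=S(T)_4^{\,i}=q^{2+\rho_i}\varepsilon_{i'}T_{i'}^{\,1}$, $i=1,\dots,4$. $A(S^4_q)$ is the subalgebra of $A(S^7_q)$ generated by the entries of $p=vv^*$ ($v^*$ the conjugate transpose), where $$v=\begin{pmatrix} q^{-3}x_1 & q^{-2}x_2\\ -q^{-1}\bar x^2 & q^{-1}\bar x^1\\ q^{-1}x_3 & -x_4\\ -\bar x^4 & -\bar x^3\end{pmatrix}.$$ $A(SU_q(2))$ is the Hopf $*$-algebra generated by $\alpha,\gamma,\bar\alpha=\alpha^*,\bar\gamma=\gamma^*$ with relations $\alpha\gamma=q\gamma\alpha$, $\alpha\bar\gamma=q\bar\gamma\alpha$, $\gamma\bar\gamma=\bar\gamma\gamma$, $\alpha\bar\alpha+q^2\bar\gamma\gamma=1$, $\bar\alpha\alpha+\bar\gamma\gamma=1$ (and their conjugates), with Hopf structure such that the matrix $u=\begin{pmatrix}\alpha&-q\bar\gamma\\ \gamma&\bar\alpha\end{pmatrix}$ satisfies $\Delta(u_{ij})=\sum_ku_{ik}\otimes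 u_{kj}$, $\varepsilon(u_{ij})=\delta_{ij}$, $S(u_{ij})=(u_{ji})^*$. The right coaction $\delta_R:A(S^7_q)\to A(S^7_q)\otimes A(SU_q(2))$ is the $*$-algebra homomorphism with $\delta_R(v_{ij})=\sum_kv_{ik}\otimes u_{kj}$; explicitly $\delta_R(x_1)=x_1\otimes\alpha+q\,x_2\otimes\gamma$, $\delta_R(x_2)=-x_1\otimes\bar\gamma+x_2\otimes\bar\alpha$, $\delta_R(x_3)=x_3\otimes\alpha-q\,x_4\otimes\gamma$, $\delta_R(x_4)=x_3\otimes\bar\gamma+x_4\otimes\bar\alpha$, and $\delta_R(\bar x^i)=\overline{\delta_R(x_i)}$. Its algebra of coinvariants is $A(S^4_q)$. Hopf-Galois extension: for a Hopf algebra $H$ and a right $H$-comodule algebra $P$ with coaction $p\mapsto p_{(0)}\otimes p_{(1)}$ and coinvariant subalgebra $B$, the extension $B\subseteq P$ is $H$-Hopf-Galois if $P\otimes_BP\to P\otimes H$, $p'\otimes_Bp\mapsto p'p_{(0)}\otimes p_{(1)}$, is bijective. It is cleft if there exists a convolution-invertible right $H$-comodule map $H\to P$ ($H$ coacting on itself by the coproduct). *)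

theory Defs
  imports Complex_Main "HOL-Algebra.QuotRing" "HOL-Algebra.Module" "HOL-Library.Poly_Mapping"
begin

section \<open>Complex algebras\<close>

text \<open>
  A unital, not necessarily commutative complex algebra is a record of type \<open>'a calg\<close>.
  (The locale \<open>algebra\<close> of HOL-Algebra covers commutative algebras only.)
\<close>

type_synonym 'a calg = "(complex, 'a) module"

definition complex_numbers :: "complex calg" where
  "complex_numbers =
     \<lparr>carrier = UNIV, mult = (*), one = 1, zero = 0, add = (+), smult = (*)\<rparr>"

definition linear_maps ::
    "(complex, 'a, 'y) module_scheme \<Rightarrow> (complex, 'b, 'z) module_scheme \<Rightarrow> ('a \<Rightarrow> 'b) set" where
  "linear_maps V W = {f \<in> carrier V \<rightarrow> carrier W.
     (\<forall>x\<in>carrier V. \<forall>y\<in>carrier V. f (x \<oplus>\<^bsub>V\<^esub> y) = f x \<oplus>\<^bsub>W\<^esub> f y) \<and>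
     (\<forall>c. \<forall>x\<in>carrier V. f (c \<odot>\<^bsub>V\<^esub> x) = c \<odot>\<^bsub>W\<^esub> f x)}"

definition algebra_homs ::
    "(complex, 'a, 'y) module_scheme \<Rightarrow> (complex, 'b, 'z) module_scheme \<Rightarrow> ('a \<Rightarrow> 'b) set" where
  "algebra_homs A B = ring_hom A B \<inter> linear_maps A B"

text \<open>
  The opposite algebra with complex conjugate scalar multiplication: homomorphisms from \<open>A\<close> to
  \<open>conj_opposite B\<close> are the antilinear antihomomorphisms from \<open>A\<close> to \<open>B\<close>.
\<close>

definition conj_opposite :: "'a calg \<Rightarrow> 'a calg" where
  "conj_opposite A =
     A\<lparr>mult := (\<lambda>x y. y \<otimes>\<^bsub>A\<^esub> x), smult := (\<lambda>c x. cnj c \<odot>\<^bsub>A\<^esub> x)\<rparr>"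

inductive_set linear_span :: "'a calg \<Rightarrow> 'a set \<Rightarrow> 'a set" for A :: "'a calg" and S :: "'a set" where
  zero: "\<zero>\<^bsub>A\<^esub> \<in> linear_span A S"
| step: "s \<in> S \<Longrightarrow> x \<in> linear_span A S \<Longrightarrow> c \<odot>\<^bsub>A\<^esub> s \<oplus>\<^bsub>A\<^esub> x \<in> linear_span A S"

inductive_set algebra_span :: "'a calg \<Rightarrow> 'a set \<Rightarrow> 'a set" for A :: "'a calg" and S :: "'a set" where
  one: "\<one>\<^bsub>A\<^esub> \<in> algebra_span A S"
| incl: "s \<in> S \<Longrightarrow> s \<in> algebra_span A S"
| add: "x \<in> algebra_span A S \<Longrightarrow> y \<in> algebra_span A S \<Longrightarrow> x \<oplus>\<^bsub>A\<^esub> y \<in> algebra_span A S"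
| mult: "x \<in> algebra_span A S \<Longrightarrow> y \<in> algebra_span A S \<Longrightarrow> x \<otimes>\<^bsub>A\<^esub> y \<in> algebra_span A S"
| smult: "x \<in> algebra_span A S \<Longrightarrow> c \<odot>\<^bsub>A\<^esub> x \<in> algebra_span A S"

text \<open>Elements of \<open>S\<close> outside \<open>A\<close> are ignored, so the result is always contained in \<open>A\<close>.\<close>

definition subalgebra_generated :: "'a calg \<Rightarrow> 'a set \<Rightarrow> 'a calg" where
  "subalgebra_generated A S = A\<lparr>carrier := algebra_span A (carrier A \<inter> S)\<rparr>"

text \<open>The ring structure is that of \<^const>\<open>FactRing\<close>.\<close>

definition quotient_algebra :: "'a calg \<Rightarrow> 'a set \<Rightarrow> 'a set calg" where
  "quotient_algebra A N =
     \<lparr>carrier = a_rcosets\<^bsub>A\<^esub> N, mult = rcoset_mult A N, one = N +>\<^bsub>A\<^esub> \<one>\<^bsub>A\<^esub>,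
      zero = N, add = set_add A, smult = (\<lambda>c K. \<Union>x\<in>K. N +>\<^bsub>A\<^esub> (c \<odot>\<^bsub>A\<^esub> x))\<rparr>"

definition monoid_algebra :: "('m, 'z) monoid_scheme \<Rightarrow> ('m \<Rightarrow>\<^sub>0 complex) calg" where
  "monoid_algebra M =
     \<lparr>carrier = {p. Poly_Mapping.keys p \<subseteq> carrier M},
      mult = (\<lambda>p r. \<Sum>a\<in>Poly_Mapping.keys p. \<Sum>b\<in>Poly_Mapping.keys r.
        Poly_Mapping.single (a \<otimes>\<^bsub>M\<^esub> b) (Poly_Mapping.lookup p a * Poly_Mapping.lookup r b)),
      one = Poly_Mapping.single \<one>\<^bsub>M\<^esub> 1,
      zero = 0, add = (+), smult = (\<lambda>c. Poly_Mapping.map ((*) c))\<rparr>"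

definition linear_extension :: "(complex, 'b, 'z) module_scheme \<Rightarrow> ('m \<Rightarrow> 'b) \<Rightarrow> ('m \<Rightarrow>\<^sub>0 complex) \<Rightarrow> 'b" where
  "linear_extension B f p =
     (\<Oplus>\<^bsub>B\<^esub> m \<in> Poly_Mapping.keys p. Poly_Mapping.lookup p m \<odot>\<^bsub>B\<^esub> f m)"


section \<open>Generators and relations\<close>

definition free_algebra :: "'g set \<Rightarrow> ('g list \<Rightarrow>\<^sub>0 complex) calg" where
  "free_algebra X = monoid_algebra \<lparr>carrier = lists X, mult = (@), one = []\<rparr>"

type_synonym 'g presented = "('g list \<Rightarrow>\<^sub>0 complex) set"

definition presented_algebra :: "'g set \<Rightarrow> ('g list \<Rightarrow>\<^sub>0 complex) set \<Rightarrow> 'g presented calg" where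
  "presented_algebra X rels = quotient_algebra (free_algebra X) (Idl\<^bsub>free_algebra X\<^esub> rels)"

definition generator :: "'g set \<Rightarrow> ('g list \<Rightarrow>\<^sub>0 complex) set \<Rightarrow> 'g \<Rightarrow> 'g presented" where
  "generator X rels g =
     (Idl\<^bsub>free_algebra X\<^esub> rels) +>\<^bsub>free_algebra X\<^esub> Poly_Mapping.single [g] 1"

text \<open>
  If the elements \<open>f g\<close> of \<open>B\<close> satisfy the defining relations, then this is the algebra homomorphism
  to \<open>B\<close> that sends each generator \<open>g\<close> to \<open>f g\<close>: the value at a coset is the common value of the
  substitution homomorphism at its members.
\<close>

definition induced_hom :: "(complex, 'b, 'z) module_scheme \<Rightarrow> ('g \<Rightarrow> 'b) \<Rightarrow> 'g presented \<Rightarrow> 'b" where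
  "induced_hom B f K =
     the_elem (linear_extension B (\<lambda>w. foldr (\<lambda>g y. f g \<otimes>\<^bsub>B\<^esub> y) w \<one>\<^bsub>B\<^esub>) ` K)"


section \<open>Tensor products\<close>

text \<open>
  \<open>V \<otimes> W\<close> is the vector space with basis \<open>carrier V \<times> carrier W\<close> modulo the span of the bilinearity
  relations. The product of basis elements, taken in the direct product \<open>V \<times>\<times> W\<close> of multiplicative
  monoids, makes it an algebra with \<open>(v \<otimes> w)(v' \<otimes> w') = vv' \<otimes> ww'\<close>.
\<close>

type_synonym ('a, 'b) tensor = "('a \<times> 'b \<Rightarrow>\<^sub>0 complex) set"

definition bilinearity :: "'a calg \<Rightarrow> 'b calg \<Rightarrow> ('a, 'b) tensor" where
  "bilinearity V W = linear_span (monoid_algebra (V \<times>\<times> W))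
    ({Poly_Mapping.single (v \<oplus>\<^bsub>V\<^esub> v', w) 1 - Poly_Mapping.single (v, w) 1
        - Poly_Mapping.single (v', w) 1 | v v' w.
        v \<in> carrier V \<and> v' \<in> carrier V \<and> w \<in> carrier W} \<union>
     {Poly_Mapping.single (v, w \<oplus>\<^bsub>W\<^esub> w') 1 - Poly_Mapping.single (v, w) 1
        - Poly_Mapping.single (v, w') 1 | v w w'.
        v \<in> carrier V \<and> w \<in> carrier W \<and> w' \<in> carrier W} \<union>
     {Poly_Mapping.single (c \<odot>\<^bsub>V\<^esub> v, w) 1 - Poly_Mapping.single (v, w) c | c v w.
        v \<in> carrier V \<and> w \<in> carrier W} \<union>
     {Poly_Mapping.single (v, c \<odot>\<^bsub>W\<^esub> w) 1 - Poly_Mapping.single (v, w) c | c v w.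
        v \<in> carrier V \<and> w \<in> carrier W})"

definition tensor_algebra :: "'a calg \<Rightarrow> 'b calg \<Rightarrow> ('a, 'b) tensor calg" where
  "tensor_algebra V W = quotient_algebra (monoid_algebra (V \<times>\<times> W)) (bilinearity V W)"

definition pure_tensor :: "'a calg \<Rightarrow> 'b calg \<Rightarrow> 'a \<Rightarrow> 'b \<Rightarrow> ('a, 'b) tensor" where
  "pure_tensor V W v w =
     bilinearity V W +>\<^bsub>monoid_algebra (V \<times>\<times> W)\<^esub> Poly_Mapping.single (v, w) 1"

text \<open>The linear map \<open>V \<otimes> W \<rightarrow> U\<close> that a bilinear map \<open>b\<close> induces.\<close>

definition tensor_lift :: "(complex, 'u, 'z) module_scheme \<Rightarrow> ('a \<Rightarrow> 'b \<Rightarrow> 'u) \<Rightarrow> ('a, 'b) tensor \<Rightarrow> 'u" where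
  "tensor_lift U b t = the_elem (linear_extension U (\<lambda>(v, w). b v w) ` t)"


section \<open>Cleft extensions\<close>

text \<open>
  The Hopf algebra is given by its algebra \<open>H\<close>, comultiplication \<open>\<Delta>\<close> and counit \<open>e\<close>; the antipode,
  which these determine, plays no role below.
\<close>

definition comodule_maps ::
    "'h calg \<Rightarrow> ('h \<Rightarrow> ('h, 'h) tensor) \<Rightarrow> 'p calg \<Rightarrow> ('p \<Rightarrow> ('p, 'h) tensor) \<Rightarrow> ('h \<Rightarrow> 'p) set" where
  "comodule_maps H \<Delta> P \<delta> = {\<Phi> \<in> linear_maps H P. \<forall>h\<in>carrier H.
     \<delta> (\<Phi> h) = tensor_lift (tensor_algebra P H) (\<lambda>a b. pure_tensor P H (\<Phi> a) b) (\<Delta> h)}"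

definition convolution ::
    "('h \<Rightarrow> ('h, 'h) tensor) \<Rightarrow> 'p calg \<Rightarrow> ('h \<Rightarrow> 'p) \<Rightarrow> ('h \<Rightarrow> 'p) \<Rightarrow> 'h \<Rightarrow> 'p" where
  "convolution \<Delta> P \<Phi> \<Psi> h = tensor_lift P (\<lambda>a b. \<Phi> a \<otimes>\<^bsub>P\<^esub> \<Psi> b) (\<Delta> h)"

definition convolution_invertible ::
    "'h calg \<Rightarrow> ('h \<Rightarrow> ('h, 'h) tensor) \<Rightarrow> ('h \<Rightarrow> complex) \<Rightarrow> 'p calg \<Rightarrow> ('h \<Rightarrow> 'p) \<Rightarrow> bool" where
  "convolution_invertible H \<Delta> e P \<Phi> \<longleftrightarrow> (\<exists>\<Psi>\<in>linear_maps H P. \<forall>h\<in>carrier H.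
     convolution \<Delta> P \<Phi> \<Psi> h = e h \<odot>\<^bsub>P\<^esub> \<one>\<^bsub>P\<^esub> \<and> convolution \<Delta> P \<Psi> \<Phi> h = e h \<odot>\<^bsub>P\<^esub> \<one>\<^bsub>P\<^esub>)"

definition cleft_extension ::
    "'h calg \<Rightarrow> ('h \<Rightarrow> ('h, 'h) tensor) \<Rightarrow> ('h \<Rightarrow> complex) \<Rightarrow>
     'p calg \<Rightarrow> 'p calg \<Rightarrow> ('p \<Rightarrow> ('p, 'h) tensor) \<Rightarrow> bool" where
  "cleft_extension H \<Delta> e B P \<delta> \<longleftrightarrow>
     carrier B \<subseteq> carrier P \<and> (\<exists>\<Phi>\<in>comodule_maps H \<Delta> P \<delta>. convolution_invertible H \<Delta> e P \<Phi>)"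


section \<open>The quantum symplectic group\<close>

text \<open>Indices are the natural numbers 1 to 4, and \<open>dual_ix i\<close> is \<open>i'\<close>.\<close>

definition dual_ix :: "nat \<Rightarrow> nat" where "dual_ix i = 5 - i"

definition eps :: "nat \<Rightarrow> real" where "eps i = [1, 1, -1, -1] ! (i - 1)"

definition rho :: "nat \<Rightarrow> int" where "rho i = [2, 1, -1, -2] ! (i - 1)"

text \<open>
  The entry of \<open>e\<^sub>i\<^sup>j \<otimes> e\<^sub>k\<^sup>l\<close> in row \<open>(a, b)\<close> and column \<open>(c, d)\<close>, where \<open>e\<^sub>i\<^sup>j\<close> has its 1 in row \<open>i\<close> and
  column \<open>j\<close>.
\<close>

definition unit_tensor :: "nat \<Rightarrow> nat \<Rightarrow> nat \<Rightarrow> nat \<Rightarrow> nat \<times> nat \<Rightarrow> nat \<times> nat \<Rightarrow> real" where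
  "unit_tensor i j k l = (\<lambda>(a, b) (c, d). of_bool (a = i \<and> c = j \<and> b = k \<and> d = l))"

definition R_matrix :: "real \<Rightarrow> nat \<times> nat \<Rightarrow> nat \<times> nat \<Rightarrow> real" where
  "R_matrix q r s =
     q * (\<Sum>i\<in>{1..4}. unit_tensor i i i i r s)
     + (\<Sum>i\<in>{1..4}. \<Sum>j\<in>{j\<in>{1..4}. i \<noteq> j \<and> i \<noteq> dual_ix j}. unit_tensor i i j j r s)
     + inverse q * (\<Sum>i\<in>{1..4}. unit_tensor (dual_ix i) (dual_ix i) i i r s)
     + (q - inverse q) * (\<Sum>i\<in>{1..4}. \<Sum>j\<in>{j\<in>{1..4}. i > j}. unit_tensor i j j i r s)
     - (q - inverse q) * (\<Sum>i\<in>{1..4}. \<Sum>j\<in>{j\<in>{1..4}. i > j}.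
         q powi (rho i - rho j) * eps i * eps j * unit_tensor i j (dual_ix i) (dual_ix j) r s)"

definition C_matrix :: "real \<Rightarrow> nat \<Rightarrow> nat \<Rightarrow> real" where
  "C_matrix q i j = q powi rho j * eps i * of_bool (i = dual_ix j)"

text \<open>The inverse of \<^const>\<open>C_matrix\<close>, whose square is minus the identity.\<close>

definition C_inverse :: "real \<Rightarrow> nat \<Rightarrow> nat \<Rightarrow> real" where
  "C_inverse q i j = - C_matrix q i j"

lemma atLeastAtMost_1_4: "{1..4::nat} = {1, 2, 3, 4}"
  by auto

lemma C_matrix_C_inverse:
  assumes "q \<noteq> 0" "i \<in> {1..4}" "j \<in> {1..4}"
  shows "(\<Sum>k\<in>{1..4}. C_matrix q i k * C_inverse q k j) = of_bool (i = j)"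
    and "(\<Sum>k\<in>{1..4}. C_inverse q i k * C_matrix q k j) = of_bool (i = j)"
  using assms unfolding atLeastAtMost_1_4
  by (auto simp: C_matrix_def C_inverse_def dual_ix_def eps_def rho_def power_int_minus)

definition Sp_generators :: "(nat \<times> nat) set" where
  "Sp_generators = {1..4} \<times> {1..4}"

text \<open>
  The letter \<open>(i, j)\<close> stands for \<open>T\<^sub>i\<^sup>j\<close>. The relations are the entries of \<open>R T\<^sub>1 T\<^sub>2 - T\<^sub>2 T\<^sub>1 R\<close>,
  using \<open>(T\<^sub>1 T\<^sub>2)\<^bsub>(a,b),(c,d)\<^esub> = T\<^sub>a\<^sup>c T\<^sub>b\<^sup>d\<close> and \<open>(T\<^sub>2 T\<^sub>1)\<^bsub>(a,b),(c,d)\<^esub> = T\<^sub>b\<^sup>d T\<^sub>a\<^sup>c\<close>, and those of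
  \<open>T C T\<^sup>t C\<^sup>-\<^sup>1 - 1\<close> and \<open>C T\<^sup>t C\<^sup>-\<^sup>1 T - 1\<close>.
\<close>

definition Sp_relations :: "real \<Rightarrow> ((nat \<times> nat) list \<Rightarrow>\<^sub>0 complex) set" where
  "Sp_relations q =
    {(\<Sum>a\<in>{1..4}. \<Sum>b\<in>{1..4}.
        Poly_Mapping.single [(a, k), (b, l)] (of_real (R_matrix q (i, j) (a, b))))
     - (\<Sum>a\<in>{1..4}. \<Sum>b\<in>{1..4}.
        Poly_Mapping.single [(j, b), (i, a)] (of_real (R_matrix q (a, b) (k, l)))) | i j k l.
      i \<in> {1..4} \<and> j \<in> {1..4} \<and> k \<in> {1..4} \<and> l \<in> {1..4}} \<union>
    {(\<Sum>k\<in>{1..4}. \<Sum>l\<in>{1..4}. \<Sum>m\<in>{1..4}.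
        Poly_Mapping.single [(i, k), (m, l)] (of_real (C_matrix q k l * C_inverse q m j)))
     - Poly_Mapping.single [] (of_bool (i = j)) | i j. i \<in> {1..4} \<and> j \<in> {1..4}} \<union>
    {(\<Sum>k\<in>{1..4}. \<Sum>l\<in>{1..4}. \<Sum>m\<in>{1..4}.
        Poly_Mapping.single [(l, k), (m, j)] (of_real (C_matrix q i k * C_inverse q l m)))
     - Poly_Mapping.single [] (of_bool (i = j)) | i j. i \<in> {1..4} \<and> j \<in> {1..4}}"

definition A_Sp :: "real \<Rightarrow> (nat \<times> nat) presented calg" where
  "A_Sp q = presented_algebra Sp_generators (Sp_relations q)"

definition T_gen :: "real \<Rightarrow> nat \<Rightarrow> nat \<Rightarrow> (nat \<times> nat) presented" where
  "T_gen q i j = generator Sp_generators (Sp_relations q) (i, j)"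

text \<open>The entries of \<open>S(T) = C T\<^sup>t C\<^sup>-\<^sup>1\<close>.\<close>

definition antipode_T :: "real \<Rightarrow> nat \<Rightarrow> nat \<Rightarrow> (nat \<times> nat) presented" where
  "antipode_T q i j =
     of_real (- (q powi (rho (dual_ix i) + rho j) * eps i * eps (dual_ix j)))
       \<odot>\<^bsub>A_Sp q\<^esub> T_gen q (dual_ix j) (dual_ix i)"

definition Sp_star :: "real \<Rightarrow> (nat \<times> nat) presented \<Rightarrow> (nat \<times> nat) presented" where
  "Sp_star q = induced_hom (conj_opposite (A_Sp q)) (\<lambda>(i, j). antipode_T q j i)"


section \<open>The quantum spheres\<close>

definition x_gen :: "real \<Rightarrow> nat \<Rightarrow> (nat \<times> nat) presented" where
  "x_gen q i = T_gen q i 4"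

definition x_bar :: "real \<Rightarrow> nat \<Rightarrow> (nat \<times> nat) presented" where
  "x_bar q i = antipode_T q 4 i"

definition A_S7 :: "real \<Rightarrow> (nat \<times> nat) presented calg" where
  "A_S7 q = subalgebra_generated (A_Sp q) (x_gen q ` {1..4} \<union> x_bar q ` {1..4})"

definition v_matrix :: "real \<Rightarrow> nat \<Rightarrow> nat \<Rightarrow> (nat \<times> nat) presented" where
  "v_matrix q i j = (let s = (\<lambda>c y. complex_of_real c \<odot>\<^bsub>A_Sp q\<^esub> y) in
     [[s (q powi -3) (x_gen q 1),     s (q powi -2) (x_gen q 2)],
      [s (- (q powi -1)) (x_bar q 2), s (q powi -1) (x_bar q 1)],
      [s (q powi -1) (x_gen q 3),     s (-1) (x_gen q 4)],
      [s (-1) (x_bar q 4),            s (-1) (x_bar q 3)]] ! (i - 1) ! (j - 1))"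

definition p_matrix :: "real \<Rightarrow> nat \<Rightarrow> nat \<Rightarrow> (nat \<times> nat) presented" where
  "p_matrix q i j = (\<Oplus>\<^bsub>A_Sp q\<^esub> k \<in> {1..2}. v_matrix q i k \<otimes>\<^bsub>A_Sp q\<^esub> Sp_star q (v_matrix q j k))"

definition A_S4 :: "real \<Rightarrow> (nat \<times> nat) presented calg" where
  "A_S4 q = subalgebra_generated (A_S7 q) {p_matrix q i j | i j. i \<in> {1..4} \<and> j \<in> {1..4}}"

lemma A_S4_subset_A_S7: "carrier (A_S4 q) \<subseteq> carrier (A_S7 q)"
proof
  fix a assume "a \<in> carrier (A_S4 q)"
  then have "a \<in> algebra_span (A_S7 q)
      (carrier (A_S7 q) \<inter> {p_matrix q i j | i j. i \<in> {1..4} \<and> j \<in> {1..4}})"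
    by (simp add: A_S4_def subalgebra_generated_def)
  then show "a \<in> carrier (A_S7 q)"
    by induction (auto simp: A_S7_def subalgebra_generated_def intro: algebra_span.intros)
qed


section \<open>Quantum SU(2) and its coaction\<close>

datatype su_generator = Alpha | Gamma | Alpha_bar | Gamma_bar

definition SU_relations :: "real \<Rightarrow> (su_generator list \<Rightarrow>\<^sub>0 complex) set" where
  "SU_relations q = (let m = (\<lambda>w c. Poly_Mapping.single w (complex_of_real c)) in
    {m [Alpha, Gamma] 1 - m [Gamma, Alpha] q,
     m [Gamma_bar, Alpha_bar] 1 - m [Alpha_bar, Gamma_bar] q,
     m [Alpha, Gamma_bar] 1 - m [Gamma_bar, Alpha] q,
     m [Gamma, Alpha_bar] 1 - m [Alpha_bar, Gamma] q,
     m [Gamma, Gamma_bar] 1 - m [Gamma_bar, Gamma] 1,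
     m [Alpha, Alpha_bar] 1 + m [Gamma_bar, Gamma] (q\<^sup>2) - m [] 1,
     m [Alpha_bar, Alpha] 1 + m [Gamma_bar, Gamma] 1 - m [] 1})"

definition A_SU :: "real \<Rightarrow> su_generator presented calg" where
  "A_SU q = presented_algebra UNIV (SU_relations q)"

definition su_gen :: "real \<Rightarrow> su_generator \<Rightarrow> su_generator presented" where
  "su_gen q = generator UNIV (SU_relations q)"

definition u_matrix :: "real \<Rightarrow> nat \<Rightarrow> nat \<Rightarrow> su_generator presented" where
  "u_matrix q i j =
     [[su_gen q Alpha, of_real (- q) \<odot>\<^bsub>A_SU q\<^esub> su_gen q Gamma_bar],
      [su_gen q Gamma, su_gen q Alpha_bar]] ! (i - 1) ! (j - 1)"

definition SU_star :: "real \<Rightarrow> su_generator presented \<Rightarrow> su_generator presented" where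
  "SU_star q = induced_hom (conj_opposite (A_SU q)) (\<lambda>g. case g of
     Alpha \<Rightarrow> su_gen q Alpha_bar | Gamma \<Rightarrow> su_gen q Gamma_bar
   | Alpha_bar \<Rightarrow> su_gen q Alpha | Gamma_bar \<Rightarrow> su_gen q Gamma)"

text \<open>
  Comultiplication and counit are determined by \<open>\<Delta>(u\<^sub>i\<^sub>j) = \<Sigma>\<^sub>k u\<^sub>i\<^sub>k \<otimes> u\<^sub>k\<^sub>j\<close> and \<open>\<epsilon>(u\<^sub>i\<^sub>j) = \<delta>\<^sub>i\<^sub>j\<close>; the
  generator \<open>Gamma_bar\<close> is \<open>- q\<^sup>-\<^sup>1 u\<^sub>1\<^sub>2\<close>.
\<close>

definition SU_comult :: "real \<Rightarrow> su_generator presented \<Rightarrow> (su_generator presented, su_generator presented) tensor" where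
  "SU_comult q = (let HH = tensor_algebra (A_SU q) (A_SU q);
       D = (\<lambda>i j. \<Oplus>\<^bsub>HH\<^esub> k \<in> {1..2}. pure_tensor (A_SU q) (A_SU q) (u_matrix q i k) (u_matrix q k j))
     in induced_hom HH (\<lambda>g. case g of
       Alpha \<Rightarrow> D 1 1 | Gamma \<Rightarrow> D 2 1 | Alpha_bar \<Rightarrow> D 2 2
     | Gamma_bar \<Rightarrow> of_real (- inverse q) \<odot>\<^bsub>HH\<^esub> D 1 2))"

definition SU_counit :: "real \<Rightarrow> su_generator presented \<Rightarrow> complex" where
  "SU_counit q = induced_hom complex_numbers (\<lambda>g. case g of
     Alpha \<Rightarrow> 1 | Gamma \<Rightarrow> 0 | Alpha_bar \<Rightarrow> 1 | Gamma_bar \<Rightarrow> 0)"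

text \<open>
  The entries of \<open>v\<close> are nonzero multiples of all the generators of \<^const>\<open>A_S7\<close>, so there is at most
  one such \<open>\<delta>\<close> on the carrier. The involution of the tensor product is \<open>(a \<otimes> b)\<^sup>* = a\<^sup>* \<otimes> b\<^sup>*\<close>.
\<close>

definition is_coaction_R ::
    "real \<Rightarrow> ((nat \<times> nat) presented \<Rightarrow> ((nat \<times> nat) presented, su_generator presented) tensor) \<Rightarrow> bool" where
  "is_coaction_R q \<delta> \<longleftrightarrow> (let PH = tensor_algebra (A_S7 q) (A_SU q);
       pure = pure_tensor (A_S7 q) (A_SU q)
     in \<delta> \<in> algebra_homs (A_S7 q) PH \<and>
       (\<forall>a\<in>carrier (A_S7 q). \<delta> (Sp_star q a) =
          tensor_lift (conj_opposite PH) (\<lambda>a b. pure (Sp_star q a) (SU_star q b)) (\<delta> a)) \<and>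
       (\<forall>i\<in>{1..4}. \<forall>j\<in>{1..2}. \<delta> (v_matrix q i j) = (\<Oplus>\<^bsub>PH\<^esub> k \<in> {1..2}. pure (v_matrix q i k) (u_matrix q k j))))"

end

theory Submission
  imports "HOL-Analysis.Infinite_Sum" "HOL-Analysis.Brouwer_Fixpoint" Defs
begin

text \<open>
  A cleaving map would make the principal bundle of the quantum seven-sphere trivial, and this is refuted as
  in classical topology: the fibre bounds a ball, and its inclusion does not extend to the ball.

  Let \<open>\<Phi>\<close> be a cleaving map. The matrix \<open>F\<close> with entries \<open>\<Phi>(u\<^sub>i\<^sub>j)\<close> is invertible over \<open>A(S\<^sup>7\<^sub>q)\<close> and satisfies
  \<open>\<delta>(F) = F u\<close>, and it can be normalised to be the identity at the base point, the character \<open>T \<mapsto> 1\<close>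
  (\<open>cleft_matrices\<close>). Restricted to the fibre of the base point, where the coordinates are the entries of \<open>u\<close>, the
  matrix \<open>F\<close> is then \<open>u\<close> itself (\<open>fibre_hom_equivariant\<close>). On the other hand the product of a matrix of quantum
  \<open>SL\<^sub>2\<close> with parameter \<open>q\<^sup>2\<close>, placed along a long root, and one with parameter \<open>q\<close>, placed along a short root, is a
  representation of \<open>A(Sp\<^sub>q(2))\<close> (\<open>symplectic_rank_one_product\<close>); on the sphere it describes the slice \<open>x\<^sub>1 = 0\<close>, which
  contains a ball with boundary \<open>x\<^sub>2 = 0\<close>, the fibre. On this ball \<open>F\<close> is an invertible matrix that
  extends \<open>u\<close>.

  If \<open>q \<noteq> \<plusminus>1\<close>, the ball and its boundary are represented by operators on functions on a quarter plane and on a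
  half plane of the lattice \<open>\<int>\<^sup>2\<close>. Up to trace class operators the former are compressions of the latter. Invertibility
  over the ball makes the index of \<open>u\<close> vanish, where the index is the trace of the commutators of lifts of the entries of
  \<open>u\<close> and \<open>u\<^sup>-\<^sup>1\<close>; computed with explicit lifts, it is a nonzero multiple of a convergent sum of positive
  numbers (\<open>index_vanishes\<close>, \<open>index_nonzero\<close>).

  If \<open>q = \<plusminus>1\<close>, the ball is represented by two by two matrices that depend continuously on a point of the closed unit
  ball of \<open>\<complex>\<^sup>2\<close>. The action of \<open>- 1 \<in> SU(2)\<close> forces the entries of \<open>F\<close> to be off-diagonal matrices, so that the
  second row of \<open>F\<close> becomes a nowhere vanishing map from the ball to \<open>\<complex>\<^sup>2\<close> that is essentially the identity on the
  boundary sphere. By Brouwer's theorem there is none (\<open>no_cleaving_matrices_unit\<close>).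

  Much of the text supplies the algebra that this takes: quotients, presentations and tensor products of
  complex algebras with their universal properties, by which representations are given by matrices that satisfy
  the defining relations.
\<close>

section \<open>Complex algebras\<close>

locale complex_algebra = ring A for A :: "'a calg" (structure) +
  assumes smult_closed [simp, intro]: "x \<in> carrier A \<Longrightarrow> c \<odot> x \<in> carrier A"
    and smult_l_distr: "x \<in> carrier A \<Longrightarrow> (c + d) \<odot> x = c \<odot> x \<oplus> d \<odot> x"
    and smult_r_distr: "x \<in> carrier A \<Longrightarrow> y \<in> carrier A \<Longrightarrow> c \<odot> (x \<oplus> y) = c \<odot> x \<oplus> c \<odot> y"
    and smult_smult: "x \<in> carrier A \<Longrightarrow> c \<odot> (d \<odot> x) = (c * d) \<odot> x"
    and smult_one [simp]: "x \<in> carrier A \<Longrightarrow> 1 \<odot> x = x"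
    and smult_mult_left: "x \<in> carrier A \<Longrightarrow> y \<in> carrier A \<Longrightarrow> (c \<odot> x) \<otimes> y = c \<odot> (x \<otimes> y)"
    and smult_mult_right: "x \<in> carrier A \<Longrightarrow> y \<in> carrier A \<Longrightarrow> x \<otimes> (c \<odot> y) = c \<odot> (x \<otimes> y)"
begin

lemma smult_zero [simp]: "c \<odot> \<zero> = \<zero>"
proof -
  have "c \<odot> \<zero> \<oplus> c \<odot> \<zero> = c \<odot> \<zero>"
    by (simp flip: smult_r_distr)
  then show ?thesis using add.l_cancel_one[of "c \<odot> \<zero>" "c \<odot> \<zero>"] by simp
qed

lemma zero_smult [simp]:
  assumes "x \<in> carrier A" shows "0 \<odot> x = \<zero>"
proof -
  have "0 \<odot> x \<oplus> 0 \<odot> x = 0 \<odot> x"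
    using assms by (simp flip: smult_l_distr)
  then show ?thesis using assms add.l_cancel_one[of "0 \<odot> x" "0 \<odot> x"] by simp
qed

lemma minus_one_smult:
  assumes "x \<in> carrier A" shows "(-1) \<odot> x = \<ominus> x"
proof -
  have "(-1) \<odot> x \<oplus> x = ((-1) + 1) \<odot> x"
    using assms by (subst smult_l_distr) auto
  then have "(-1) \<odot> x \<oplus> x = \<zero>" using assms by simp
  then show ?thesis using assms by (simp add: minus_equality)
qed

lemma finsum_pair:
  assumes "g 1 \<in> carrier A" "g 2 \<in> carrier A"
  shows "(\<Oplus>k\<in>{1..2::nat}. g k) = g 1 \<oplus> g 2"
proof -
  have "{1..2::nat} = insert 1 {2}" by auto
  then show ?thesis using assms by (simp add: finsum_insert Pi_def)
qed

end

subsection \<open>Linear extension\<close>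

lemma lookup_smult [simp]:
  "Poly_Mapping.lookup (Poly_Mapping.map ((*) c) p) k = (c::complex) * Poly_Mapping.lookup p k"
  by (simp add: Poly_Mapping.map.rep_eq when_def)

lemma keys_smult: "Poly_Mapping.keys (Poly_Mapping.map ((*) (c::complex)) p) \<subseteq> Poly_Mapping.keys p"
  by (auto simp: in_keys_iff)

lemma map_smult_single [simp]:
  "Poly_Mapping.map ((*) (c::complex)) (Poly_Mapping.single m d) = Poly_Mapping.single m (c * d)"
  by (rule poly_mapping_eqI) (simp add: lookup_single when_def)

lemma map_smult_add:
  "Poly_Mapping.map ((*) (c::complex)) (p + r) = Poly_Mapping.map ((*) c) p + Poly_Mapping.map ((*) c) r"
  by (rule poly_mapping_eqI) (simp add: lookup_add distrib_left)

lemma map_smult_zero [simp]: "Poly_Mapping.map ((*) (c::complex)) 0 = 0"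
  by (rule poly_mapping_eqI) simp

text \<open>
  Multiplicativity, associativity and linearity of maps on a monoid algebra are all checked on basis
  elements with this induction.
\<close>

lemma poly_mapping_carrier_induct [consumes 1, case_names zero add]:
  fixes p :: "'m \<Rightarrow>\<^sub>0 complex"
  assumes "Poly_Mapping.keys p \<subseteq> S"
    and "P 0"
    and "\<And>m c p. m \<in> S \<Longrightarrow> Poly_Mapping.keys p \<subseteq> S \<Longrightarrow> P p \<Longrightarrow> P (Poly_Mapping.single m c + p)"
  shows "P p"
proof -
  have step: "P (\<Sum>m\<in>K. Poly_Mapping.single m (Poly_Mapping.lookup p m)) \<and>
      Poly_Mapping.keys (\<Sum>m\<in>K. Poly_Mapping.single m (Poly_Mapping.lookup p m)) \<subseteq> S"
    if "finite K" "K \<subseteq> S" for K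
    using that
  proof (induction K rule: finite_induct)
    case empty
    then show ?case using assms by simp
  next
    case (insert m K)
    let ?s = "\<Sum>m\<in>K. Poly_Mapping.single m (Poly_Mapping.lookup p m)"
    have IH: "P ?s" "Poly_Mapping.keys ?s \<subseteq> S" and m: "m \<in> S" using insert by auto
    have "Poly_Mapping.keys (Poly_Mapping.single m (Poly_Mapping.lookup p m) + ?s) \<subseteq> S"
      by (rule subset_trans[OF keys_add]) (use IH m in simp)
    then show ?case
      using insert.hyps assms(3)[OF m IH(2,1)] by simp
  qed
  moreover have "(\<Sum>m\<in>Poly_Mapping.keys p. Poly_Mapping.single m (Poly_Mapping.lookup p m)) = p"
    by (rule poly_mapping_eqI) (simp add: lookup_sum lookup_single when_def in_keys_iff)
  moreover note step[of "Poly_Mapping.keys p"]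
  ultimately show ?thesis
    using assms(1) by simp
qed

context complex_algebra
begin

lemma linear_extension_superset:
  assumes "finite T" "Poly_Mapping.keys p \<subseteq> T" "f \<in> T \<rightarrow> carrier A"
  shows "linear_extension A f p = (\<Oplus>m\<in>T. Poly_Mapping.lookup p m \<odot> f m)"
  unfolding linear_extension_def using assms
  by (intro add.finprod_mono_neutral_cong_left) (auto simp: in_keys_iff Pi_iff)

lemma linear_extension_zero [simp]: "linear_extension A f 0 = \<zero>"
  by (simp add: linear_extension_def)

lemma linear_extension_single:
  "f m \<in> carrier A \<Longrightarrow> linear_extension A f (Poly_Mapping.single m c) = c \<odot> f m"
  by (cases "c = 0") (simp_all add: linear_extension_def)

lemma linear_extension_closed:
  "Poly_Mapping.keys p \<subseteq> S \<Longrightarrow> f \<in> S \<rightarrow> carrier A \<Longrightarrow> linear_extension A f p \<in> carrier A"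
  unfolding linear_extension_def by (rule finsum_closed) auto

lemma linear_extension_add:
  assumes "Poly_Mapping.keys p \<subseteq> S" "Poly_Mapping.keys r \<subseteq> S" "f \<in> S \<rightarrow> carrier A"
  shows "linear_extension A f (p + r) = linear_extension A f p \<oplus> linear_extension A f r"
proof -
  let ?T = "Poly_Mapping.keys p \<union> Poly_Mapping.keys r"
  have f: "f \<in> ?T \<rightarrow> carrier A" using assms by auto
  have "linear_extension A f (p + r) = (\<Oplus>m\<in>?T. Poly_Mapping.lookup (p + r) m \<odot> f m)"
    using keys_add[of p r] f by (intro linear_extension_superset) auto
  also have "\<dots> = (\<Oplus>m\<in>?T. Poly_Mapping.lookup p m \<odot> f m \<oplus> Poly_Mapping.lookup r m \<odot> f m)"
    using f by (intro finsum_cong') (auto simp: lookup_add smult_l_distr Pi_iff)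
  also have "\<dots> = (\<Oplus>m\<in>?T. Poly_Mapping.lookup p m \<odot> f m) \<oplus> (\<Oplus>m\<in>?T. Poly_Mapping.lookup r m \<odot> f m)"
    using f by (intro finsum_addf) (auto simp: Pi_iff)
  also have "\<dots> = linear_extension A f p \<oplus> linear_extension A f r"
    using f by (simp add: linear_extension_superset[where T = ?T])
  finally show ?thesis .
qed

lemma linear_extension_smult:
  assumes "Poly_Mapping.keys p \<subseteq> S" "f \<in> S \<rightarrow> carrier A"
  shows "linear_extension A f (Poly_Mapping.map ((*) c) p) = c \<odot> linear_extension A f p"
  using assms(1)
proof (induction rule: poly_mapping_carrier_induct)
  case zero
  show ?case by simp
next
  case (add m d p)
  have eq: "Poly_Mapping.map ((*) c) (Poly_Mapping.single m d + p) =
      Poly_Mapping.single m (c * d) + Poly_Mapping.map ((*) c) p"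
    by (rule poly_mapping_eqI) (simp add: lookup_add distrib_left lookup_single when_def)
  have k: "Poly_Mapping.keys (Poly_Mapping.single m x) \<subseteq> S" for x :: complex
    using add by auto
  have fm: "f m \<in> carrier A" using add assms by auto
  have "linear_extension A f (Poly_Mapping.map ((*) c) (Poly_Mapping.single m d + p)) =
      (c * d) \<odot> f m \<oplus> c \<odot> linear_extension A f p"
    unfolding eq using add assms fm k keys_smult[of c p]
    by (subst linear_extension_add[of _ S]) (auto simp: linear_extension_single)
  also have "\<dots> = c \<odot> (linear_extension A f (Poly_Mapping.single m d + p))"
    using add assms fm k linear_extension_closed[OF add(2) assms(2)]
    by (subst linear_extension_add[of _ S])
      (auto simp: linear_extension_single smult_r_distr smult_smult)
  finally show ?case .
qed

end

subsection \<open>Monoid algebras\<close>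

context
  fixes M :: "('m, 'z) monoid_scheme" (structure)
begin

lemma monoid_algebra_simps [simp]:
  "carrier (monoid_algebra M) = {p. Poly_Mapping.keys p \<subseteq> carrier M}"
  "one (monoid_algebra M) = Poly_Mapping.single \<one> 1"
  "zero (monoid_algebra M) = 0"
  "add (monoid_algebra M) = (+)"
  "smult (monoid_algebra M) = (\<lambda>c. Poly_Mapping.map ((*) c))"
  by (simp_all add: monoid_algebra_def)

lemma monoid_algebra_mult_superset:
  assumes "finite S" "finite T" "Poly_Mapping.keys p \<subseteq> S" "Poly_Mapping.keys r \<subseteq> T"
  shows "p \<otimes>\<^bsub>monoid_algebra M\<^esub> r = (\<Sum>a\<in>S. \<Sum>b\<in>T.
    Poly_Mapping.single (a \<otimes> b) (Poly_Mapping.lookup p a * Poly_Mapping.lookup r b))"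
proof -
  have "p \<otimes>\<^bsub>monoid_algebra M\<^esub> r = (\<Sum>a\<in>Poly_Mapping.keys p. \<Sum>b\<in>T.
    Poly_Mapping.single (a \<otimes> b) (Poly_Mapping.lookup p a * Poly_Mapping.lookup r b))"
    unfolding monoid_algebra_def partial_object.simps monoid.simps
    by (rule sum.cong[OF refl], rule sum.mono_neutral_left) (use assms in \<open>auto simp: in_keys_iff\<close>)
  also have "\<dots> = (\<Sum>a\<in>S. \<Sum>b\<in>T.
    Poly_Mapping.single (a \<otimes> b) (Poly_Mapping.lookup p a * Poly_Mapping.lookup r b))"
    using assms by (intro sum.mono_neutral_left) (auto simp: in_keys_iff)
  finally show ?thesis .
qed

lemma monoid_algebra_mult_add_left:
  "(p + p') \<otimes>\<^bsub>monoid_algebra M\<^esub> r = p \<otimes>\<^bsub>monoid_algebra M\<^esub> r + p' \<otimes>\<^bsub>monoid_algebra M\<^esub> r"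
  using keys_add[of p p']
  by (simp add: monoid_algebra_mult_superset[where S = "Poly_Mapping.keys p \<union> Poly_Mapping.keys p'"
        and T = "Poly_Mapping.keys r"] lookup_add distrib_right single_add sum.distrib)

lemma monoid_algebra_mult_add_right:
  "p \<otimes>\<^bsub>monoid_algebra M\<^esub> (r + r') = p \<otimes>\<^bsub>monoid_algebra M\<^esub> r + p \<otimes>\<^bsub>monoid_algebra M\<^esub> r'"
  using keys_add[of r r']
  by (simp add: monoid_algebra_mult_superset[where S = "Poly_Mapping.keys p"
        and T = "Poly_Mapping.keys r \<union> Poly_Mapping.keys r'"] lookup_add distrib_left single_add sum.distrib)

lemma monoid_algebra_mult_zero [simp]:
  "0 \<otimes>\<^bsub>monoid_algebra M\<^esub> r = 0" "p \<otimes>\<^bsub>monoid_algebra M\<^esub> 0 = 0"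
  by (simp_all add: monoid_algebra_def)

lemma monoid_algebra_mult_single [simp]:
  "Poly_Mapping.single a c \<otimes>\<^bsub>monoid_algebra M\<^esub> Poly_Mapping.single b d =
     Poly_Mapping.single (a \<otimes> b) (c * d)"
  by (simp add: monoid_algebra_mult_superset[where S = "{a}" and T = "{b}"])

lemma monoid_algebra_smult_left:
  "Poly_Mapping.map ((*) c) p \<otimes>\<^bsub>monoid_algebra M\<^esub> r = Poly_Mapping.map ((*) c) (p \<otimes>\<^bsub>monoid_algebra M\<^esub> r)"
proof (induction p rule: poly_mapping_carrier_induct[OF subset_UNIV])
  case (2 m d p)
  have "Poly_Mapping.single m (c * d) \<otimes>\<^bsub>monoid_algebra M\<^esub> r =
      Poly_Mapping.map ((*) c) (Poly_Mapping.single m d \<otimes>\<^bsub>monoid_algebra M\<^esub> r)"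
    by (induction r rule: poly_mapping_carrier_induct[OF subset_UNIV])
      (auto simp: monoid_algebra_mult_add_right map_smult_add mult.assoc)
  with 2 show ?case by (simp add: monoid_algebra_mult_add_left map_smult_add)
qed simp

lemma monoid_algebra_smult_right:
  "p \<otimes>\<^bsub>monoid_algebra M\<^esub> Poly_Mapping.map ((*) c) r = Poly_Mapping.map ((*) c) (p \<otimes>\<^bsub>monoid_algebra M\<^esub> r)"
proof (induction p rule: poly_mapping_carrier_induct[OF subset_UNIV])
  case (2 m d p)
  have "Poly_Mapping.single m d \<otimes>\<^bsub>monoid_algebra M\<^esub> Poly_Mapping.map ((*) c) r =
      Poly_Mapping.map ((*) c) (Poly_Mapping.single m d \<otimes>\<^bsub>monoid_algebra M\<^esub> r)"
    by (induction r rule: poly_mapping_carrier_induct[OF subset_UNIV])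
      (auto simp: monoid_algebra_mult_add_right map_smult_add mult.assoc mult.left_commute)
  with 2 show ?case by (simp add: monoid_algebra_mult_add_left map_smult_add)
qed simp

end

lemma (in monoid) keys_monoid_algebra_mult:
  assumes "Poly_Mapping.keys p \<subseteq> carrier G" "Poly_Mapping.keys r \<subseteq> carrier G"
  shows "Poly_Mapping.keys (p \<otimes>\<^bsub>monoid_algebra G\<^esub> r) \<subseteq> carrier G"
  using assms(1)
proof (induction rule: poly_mapping_carrier_induct)
  case (add m c p)
  have "Poly_Mapping.keys (Poly_Mapping.single m c \<otimes>\<^bsub>monoid_algebra G\<^esub> r) \<subseteq> carrier G"
    using assms(2)
  proof (induction rule: poly_mapping_carrier_induct)
    case (add m' c' p')
    then show ?case
      using keys_add[of "Poly_Mapping.single (m \<otimes> m') (c * c')"] \<open>m \<in> carrier G\<close>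
      by (fastforce simp: monoid_algebra_mult_add_right split: if_splits)
  qed simp
  with add show ?case
    using keys_add by (fastforce simp: monoid_algebra_mult_add_left)
qed simp

lemma (in monoid) monoid_algebra_assoc:
  assumes "Poly_Mapping.keys p \<subseteq> carrier G" "Poly_Mapping.keys r \<subseteq> carrier G"
    "Poly_Mapping.keys s \<subseteq> carrier G"
  shows "(p \<otimes>\<^bsub>monoid_algebra G\<^esub> r) \<otimes>\<^bsub>monoid_algebra G\<^esub> s =
    p \<otimes>\<^bsub>monoid_algebra G\<^esub> (r \<otimes>\<^bsub>monoid_algebra G\<^esub> s)"
  using assms(1)
proof (induction rule: poly_mapping_carrier_induct)
  case (add m c p)
  have "(Poly_Mapping.single m c \<otimes>\<^bsub>monoid_algebra G\<^esub> r) \<otimes>\<^bsub>monoid_algebra G\<^esub> s =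
      Poly_Mapping.single m c \<otimes>\<^bsub>monoid_algebra G\<^esub> (r \<otimes>\<^bsub>monoid_algebra G\<^esub> s)"
    using assms(2)
  proof (induction rule: poly_mapping_carrier_induct)
    case (add m' c' r)
    have "Poly_Mapping.single (m \<otimes> m') (c * c') \<otimes>\<^bsub>monoid_algebra G\<^esub> s =
      Poly_Mapping.single m c \<otimes>\<^bsub>monoid_algebra G\<^esub> (Poly_Mapping.single m' c' \<otimes>\<^bsub>monoid_algebra G\<^esub> s)"
      using assms(3)
      by (induction rule: poly_mapping_carrier_induct)
        (use add \<open>m \<in> carrier G\<close> in \<open>auto simp: monoid_algebra_mult_add_right m_assoc mult.assoc\<close>)
    with add show ?case
      by (simp add: monoid_algebra_mult_add_right monoid_algebra_mult_add_left)
  qed simp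
  with add show ?case by (simp add: monoid_algebra_mult_add_left)
qed simp

lemma (in monoid) monoid_algebra_one:
  assumes "Poly_Mapping.keys p \<subseteq> carrier G"
  shows "Poly_Mapping.single \<one> 1 \<otimes>\<^bsub>monoid_algebra G\<^esub> p = p"
    and "p \<otimes>\<^bsub>monoid_algebra G\<^esub> Poly_Mapping.single \<one> 1 = p"
  using assms
  by (induction rule: poly_mapping_carrier_induct)
    (auto simp: monoid_algebra_mult_add_right monoid_algebra_mult_add_left)

lemma (in monoid) complex_algebra_monoid_algebra: "complex_algebra (monoid_algebra G)"
proof (intro complex_algebra.intro complex_algebra_axioms.intro ringI abelian_groupI monoidI)
  fix p q assume pq: "p \<in> carrier (monoid_algebra G)" "q \<in> carrier (monoid_algebra G)"
  then show "p \<oplus>\<^bsub>monoid_algebra G\<^esub> q \<in> carrier (monoid_algebra G)"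
    using keys_add[of p q] by auto
  from pq show "p \<otimes>\<^bsub>monoid_algebra G\<^esub> q \<in> carrier (monoid_algebra G)"
    using keys_monoid_algebra_mult by auto
next
  fix p assume "p \<in> carrier (monoid_algebra G)"
  then show "\<exists>y\<in>carrier (monoid_algebra G). y \<oplus>\<^bsub>monoid_algebra G\<^esub> p = \<zero>\<^bsub>monoid_algebra G\<^esub>"
    by (intro bexI[of _ "- p"]) (auto simp: in_keys_iff)
next
  fix c :: complex and p assume "p \<in> carrier (monoid_algebra G)"
  then show "c \<odot>\<^bsub>monoid_algebra G\<^esub> p \<in> carrier (monoid_algebra G)"
    using keys_smult[of c p] by auto
qed (auto simp: monoid_algebra_mult_add_right monoid_algebra_mult_add_left monoid_algebra_assoc
    monoid_algebra_one add.assoc add.commute map_smult_add monoid_algebra_smult_left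
    monoid_algebra_smult_right lookup_add distrib_right intro!: poly_mapping_eqI)

text \<open>
  Both sides are bilinear, so the multiplicativity of \<open>f\<close> on the basis suffices.
\<close>

lemma (in complex_algebra) linear_extension_mult:
  assumes "monoid M" "f \<in> hom M A" 
    "Poly_Mapping.keys p \<subseteq> carrier M" "Poly_Mapping.keys r \<subseteq> carrier M"
  shows "linear_extension A f (p \<otimes>\<^bsub>monoid_algebra M\<^esub> r) = linear_extension A f p \<otimes> linear_extension A f r"
proof -
  interpret M: monoid M by fact
  have f: "f \<in> carrier M \<rightarrow> carrier A" and fm: "\<And>x y. x \<in> carrier M \<Longrightarrow> y \<in> carrier M \<Longrightarrow> f (x \<otimes>\<^bsub>M\<^esub> y) = f x \<otimes> f y"
    using assms(2) by (auto simp: hom_def)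
  note [simp] = linear_extension_add[OF _ _ f] linear_extension_closed[OF _ f]
  have [simp]: "Poly_Mapping.keys (Poly_Mapping.single m x) \<subseteq> carrier M" if "m \<in> carrier M" for m and x :: complex
    using that by auto
  have [simp]: "f x \<in> carrier A" if "x \<in> carrier M" for x using f that by auto
  show ?thesis
    using assms(3)
  proof (induction rule: poly_mapping_carrier_induct)
    case zero
    then show ?case using assms(4) by simp
  next
    case (add m c p)
    have "linear_extension A f (Poly_Mapping.single m c \<otimes>\<^bsub>monoid_algebra M\<^esub> r) =
        (c \<odot> f m) \<otimes> linear_extension A f r"
      using assms(4)
    proof (induction rule: poly_mapping_carrier_induct)
      case zero
      then show ?case using add by simp
    next
      case (add m' c' r)
      then show ?case using \<open>m \<in> carrier M\<close>
        by (simp add: monoid_algebra_mult_add_right M.keys_monoid_algebra_mult linear_extension_single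
            fm r_distr smult_mult_left smult_mult_right smult_smult mult.commute)
    qed
    with add assms(4) show ?case
      by (simp add: monoid_algebra_mult_add_left M.keys_monoid_algebra_mult linear_extension_single l_distr)
  qed
qed

context complex_algebra
begin

lemma linear_extension_diff:
  assumes "Poly_Mapping.keys p \<subseteq> S" "Poly_Mapping.keys r \<subseteq> S" "f \<in> S \<rightarrow> carrier A"
  shows "linear_extension A f (p - r) = linear_extension A f p \<ominus> linear_extension A f r"
proof -
  have eq: "p - r = p + Poly_Mapping.map ((*) (-1)) r"
    by (rule poly_mapping_eqI) (simp add: lookup_add lookup_minus)
  have "Poly_Mapping.keys (Poly_Mapping.map ((*) (-1)) r) \<subseteq> S"
    by (rule subset_trans[OF keys_smult assms(2)])
  then show ?thesis
    unfolding eq using assms linear_extension_closed[OF assms(2,3)]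
    by (simp add: linear_extension_add[of _ S] linear_extension_smult[of _ S] minus_one_smult a_minus_def)
qed

text \<open>
  A scalar multiple is a product with a multiple of the unit, so the ideals of the ring are subspaces.
\<close>

lemma ideal_smult:
  assumes "ideal N A" "x \<in> N"
  shows "c \<odot> x \<in> N"
proof -
  interpret ideal N A by fact
  have "x \<in> carrier A" using assms by simp
  then have "c \<odot> x = (c \<odot> \<one>) \<otimes> x" by (simp add: smult_mult_left)
  also have "\<dots> \<in> N" using assms(2) by (intro I_l_closed) auto
  finally show ?thesis .
qed

end

lemma linear_mapsD:
  assumes "f \<in> linear_maps A B"
  shows "x \<in> carrier A \<Longrightarrow> f x \<in> carrier B"
    and "x \<in> carrier A \<Longrightarrow> y \<in> carrier A \<Longrightarrow> f (x \<oplus>\<^bsub>A\<^esub> y) = f x \<oplus>\<^bsub>B\<^esub> f y"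
    and "x \<in> carrier A \<Longrightarrow> f (c \<odot>\<^bsub>A\<^esub> x) = c \<odot>\<^bsub>B\<^esub> f x"
  using assms by (auto simp: linear_maps_def)

lemma algebra_homsD:
  assumes "f \<in> algebra_homs A B"
  shows "x \<in> carrier A \<Longrightarrow> f x \<in> carrier B"
    and "x \<in> carrier A \<Longrightarrow> y \<in> carrier A \<Longrightarrow> f (x \<otimes>\<^bsub>A\<^esub> y) = f x \<otimes>\<^bsub>B\<^esub> f y"
    and "x \<in> carrier A \<Longrightarrow> y \<in> carrier A \<Longrightarrow> f (x \<oplus>\<^bsub>A\<^esub> y) = f x \<oplus>\<^bsub>B\<^esub> f y"
    and "x \<in> carrier A \<Longrightarrow> f (c \<odot>\<^bsub>A\<^esub> x) = c \<odot>\<^bsub>B\<^esub> f x"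
    and "f \<one>\<^bsub>A\<^esub> = \<one>\<^bsub>B\<^esub>"
  using assms by (auto simp: algebra_homs_def ring_hom_def linear_maps_def)

lemma algebra_homsI:
  assumes "\<And>x. x \<in> carrier A \<Longrightarrow> f x \<in> carrier B"
    and "\<And>x y. x \<in> carrier A \<Longrightarrow> y \<in> carrier A \<Longrightarrow> f (x \<otimes>\<^bsub>A\<^esub> y) = f x \<otimes>\<^bsub>B\<^esub> f y"
    and "\<And>x y. x \<in> carrier A \<Longrightarrow> y \<in> carrier A \<Longrightarrow> f (x \<oplus>\<^bsub>A\<^esub> y) = f x \<oplus>\<^bsub>B\<^esub> f y"
    and "\<And>c x. x \<in> carrier A \<Longrightarrow> f (c \<odot>\<^bsub>A\<^esub> x) = c \<odot>\<^bsub>B\<^esub> f x"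
    and "f \<one>\<^bsub>A\<^esub> = \<one>\<^bsub>B\<^esub>"
  shows "f \<in> algebra_homs A B"
  using assms by (auto simp: algebra_homs_def linear_maps_def intro!: ring_hom_memI)

subsection \<open>Quotient algebras\<close>

lemma quotient_algebra_simps [simp]:
  "carrier (quotient_algebra A N) = a_rcosets\<^bsub>A\<^esub> N"
  "mult (quotient_algebra A N) = rcoset_mult A N"
  "one (quotient_algebra A N) = N +>\<^bsub>A\<^esub> \<one>\<^bsub>A\<^esub>"
  "zero (quotient_algebra A N) = N"
  "add (quotient_algebra A N) = set_add A"
  by (simp_all add: quotient_algebra_def)

locale algebra_ideal = complex_algebra A + ideal N A for A :: "'a calg" (structure) and N
begin

lemma carrier_quotient: "K \<in> a_rcosets N \<longleftrightarrow> (\<exists>x\<in>carrier A. K = N +> x)"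
  by (auto simp: A_RCOSETS_def')

lemma coset_eqI:
  assumes "x \<in> carrier A" "y \<in> carrier A" "x \<ominus> y \<in> N"
  shows "N +> x = N +> y"
proof -
  have "x \<in> N +> y"
    using assms by (intro a_rcos_module_rev) (auto simp: a_minus_def ring_axioms)
  from a_repr_independence'[OF this] show ?thesis
    using assms by simp
qed

lemma coset_smult:
  assumes x: "x \<in> carrier A"
  shows "c \<odot>\<^bsub>quotient_algebra A N\<^esub> (N +> x) = N +> (c \<odot> x)"
proof -
  have "N +> (c \<odot> y) = N +> (c \<odot> x)" if "y \<in> N +> x" for y
  proof -
    obtain n where n: "n \<in> N" "y = n \<oplus> x"
      using \<open>y \<in> N +> x\<close> by (auto simp: a_r_coset_def')
    have nc: "n \<in> carrier A" using n by simp
    have "c \<odot> y \<ominus> c \<odot> x = c \<odot> n"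
      using n nc x by (simp add: smult_r_distr a_minus_def a_assoc r_neg)
    then have "c \<odot> y \<ominus> c \<odot> x \<in> N"
      using ideal_smult[OF is_ideal n(1)] by simp
    then show ?thesis using n nc x by (intro coset_eqI) auto
  qed
  moreover have "x \<in> N +> x" using x by (rule a_rcos_self)
  ultimately have "(\<Union>y\<in>N +> x. N +> (c \<odot> y)) = N +> (c \<odot> x)" by blast
  then show ?thesis by (simp add: quotient_algebra_def)
qed

lemma ring_quotient: "ring (quotient_algebra A N)"
proof (rule ringI)
  show "abelian_group (quotient_algebra A N)"
  proof (rule abelian_groupI)
    have zero: "N = N +> \<zero>" by (simp add: a_rcos_const)
    then show "\<zero>\<^bsub>quotient_algebra A N\<^esub> \<in> carrier (quotient_algebra A N)"
      unfolding quotient_algebra_simps carrier_quotient by blast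
    fix K assume "K \<in> carrier (quotient_algebra A N)"
    then obtain x where x: "x \<in> carrier A" "K = N +> x" by (auto simp: carrier_quotient)
    then show "\<zero>\<^bsub>quotient_algebra A N\<^esub> \<oplus>\<^bsub>quotient_algebra A N\<^esub> K = K"
      using a_rcos_sum[of \<zero> x] zero by simp
    show "\<exists>L\<in>carrier (quotient_algebra A N).
        L \<oplus>\<^bsub>quotient_algebra A N\<^esub> K = \<zero>\<^bsub>quotient_algebra A N\<^esub>"
      using x zero by (intro bexI[of _ "N +> \<ominus> x"]) (auto simp: carrier_quotient a_rcos_sum l_neg)
  next
    fix K L M assume "K \<in> carrier (quotient_algebra A N)" "L \<in> carrier (quotient_algebra A N)"
      "M \<in> carrier (quotient_algebra A N)"
    then show "K \<oplus>\<^bsub>quotient_algebra A N\<^esub> L \<oplus>\<^bsub>quotient_algebra A N\<^esub> M =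
        K \<oplus>\<^bsub>quotient_algebra A N\<^esub> (L \<oplus>\<^bsub>quotient_algebra A N\<^esub> M)"
      by (auto simp: carrier_quotient a_rcos_sum a_assoc)
  next
    fix K L assume "K \<in> carrier (quotient_algebra A N)" "L \<in> carrier (quotient_algebra A N)"
    then obtain x y where "x \<in> carrier A" "K = N +> x" "y \<in> carrier A" "L = N +> y"
      by (auto simp: carrier_quotient)
    then show "K \<oplus>\<^bsub>quotient_algebra A N\<^esub> L = L \<oplus>\<^bsub>quotient_algebra A N\<^esub> K"
      using a_comm[of x y] by (simp add: a_rcos_sum)
  qed (auto simp: carrier_quotient a_rcos_sum)
  show "Group.monoid (quotient_algebra A N)"
    by (rule monoidI) (auto simp: carrier_quotient rcoset_mult_add m_assoc)
qed (auto simp: carrier_quotient rcoset_mult_add a_rcos_sum l_distr r_distr)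

lemma complex_algebra_quotient: "complex_algebra (quotient_algebra A N)"
proof (intro complex_algebra.intro complex_algebra_axioms.intro ring_quotient)
qed (auto simp: carrier_quotient coset_smult a_rcos_sum rcoset_mult_add smult_l_distr smult_r_distr
    smult_smult smult_mult_left smult_mult_right)

lemma coset_value:
  assumes "\<And>n. n \<in> N \<Longrightarrow> f (n \<oplus> x) = f x" "x \<in> carrier A"
  shows "the_elem (f ` (N +> x)) = f x"
proof -
  have "\<zero> \<in> N" by simp
  then have "f ` (N +> x) = {f x}"
    using assms by (force simp: a_r_coset_def')
  then show ?thesis by simp
qed

text \<open>
  The elements of a quotient are cosets. A map that vanishes on the ideal is constant on each coset, and
  its value there is read off with \<^const>\<open>the_elem\<close>.
\<close>

lemma quotient_value:
  assumes U: "complex_algebra U" and f: "f \<in> linear_maps A U" and N: "\<And>n. n \<in> N \<Longrightarrow> f n = \<zero>\<^bsub>U\<^esub>"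
    and x: "x \<in> carrier A"
  shows "the_elem (f ` (N +> x)) = f x"
proof (rule coset_value[OF _ x])
  interpret U: complex_algebra U by fact
  fix n assume n: "n \<in> N"
  then have "n \<in> carrier A" by simp
  with f x show "f (n \<oplus> x) = f x"
    by (auto simp: linear_maps_def N[OF n] Pi_iff)
qed

lemma quotient_linear_map:
  assumes U: "complex_algebra U" and f: "f \<in> linear_maps A U" and N: "\<And>n. n \<in> N \<Longrightarrow> f n = \<zero>\<^bsub>U\<^esub>"
  shows "(\<lambda>K. the_elem (f ` K)) \<in> linear_maps (quotient_algebra A N) U"
  using linear_mapsD[OF f]
  by (auto simp: linear_maps_def carrier_quotient a_rcos_sum coset_smult quotient_value[OF assms])

lemma quotient_algebra_hom:
  assumes U: "complex_algebra U" and f: "f \<in> algebra_homs A U" and N: "\<And>n. n \<in> N \<Longrightarrow> f n = \<zero>\<^bsub>U\<^esub>"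
  shows "(\<lambda>K. the_elem (f ` K)) \<in> algebra_homs (quotient_algebra A N) U"
proof -
  have l: "f \<in> linear_maps A U" using f by (simp add: algebra_homs_def)
  note D = linear_mapsD[OF quotient_linear_map[OF U l N]]
  show ?thesis
  proof (rule algebra_homsI)
    fix K L assume "K \<in> carrier (quotient_algebra A N)" "L \<in> carrier (quotient_algebra A N)"
    then obtain x y where "x \<in> carrier A" "K = N +> x" "y \<in> carrier A" "L = N +> y"
      by (auto simp: carrier_quotient)
    then show "the_elem (f ` (K \<otimes>\<^bsub>quotient_algebra A N\<^esub> L)) = the_elem (f ` K) \<otimes>\<^bsub>U\<^esub> the_elem (f ` L)"
      by (simp add: rcoset_mult_add quotient_value[OF U l N] algebra_homsD(2)[OF f])
  next
    show "the_elem (f ` \<one>\<^bsub>quotient_algebra A N\<^esub>) = \<one>\<^bsub>U\<^esub>"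
      by (simp add: quotient_value[OF U l N] algebra_homsD(5)[OF f])
  qed (use D in auto)
qed

lemma quotient_projection: "(\<lambda>x. N +> x) \<in> algebra_homs A (quotient_algebra A N)"
  by (rule algebra_homsI) (auto simp: carrier_quotient a_rcos_sum coset_smult rcoset_mult_add)

end

lemma (in complex_algebra) algebra_idealI: "ideal N A \<Longrightarrow> algebra_ideal A N"
  by (intro algebra_ideal.intro complex_algebra_axioms)

subsection \<open>Homomorphisms\<close>

lemma linear_extension_linear:
  assumes "complex_algebra U" "f \<in> carrier M \<rightarrow> carrier U"
  shows "linear_extension U f \<in> linear_maps (monoid_algebra M) U"
proof -
  interpret complex_algebra U by fact
  show ?thesis using assms(2)
    by (auto simp: linear_maps_def linear_extension_closed linear_extension_add linear_extension_smult)
qed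

lemma linear_extension_hom:
  assumes "complex_algebra U" "monoid M" "f \<in> hom M U" "f \<one>\<^bsub>M\<^esub> = \<one>\<^bsub>U\<^esub>"
  shows "linear_extension U f \<in> algebra_homs (monoid_algebra M) U"
proof -
  interpret complex_algebra U by fact
  interpret M: monoid M by fact
  have f: "f \<in> carrier M \<rightarrow> carrier U" using assms by (auto simp: hom_def)
  show ?thesis
    using linear_extension_linear[OF assms(1) f] linear_extension_mult[OF assms(2,3)] assms(4)
    by (auto simp: algebra_homs_def linear_extension_single linear_maps_def intro!: ring_hom_memI)
qed

lemma kernel_ideal:
  assumes "complex_algebra A" "complex_algebra U" "f \<in> algebra_homs A U"
  shows "ideal {x \<in> carrier A. f x = \<zero>\<^bsub>U\<^esub>} A"
proof -
  interpret A: complex_algebra A by fact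
  interpret U: complex_algebra U by fact
  have "ring_hom_ring A U f"
    using assms(3) by (intro ring_hom_ringI2[OF A.ring_axioms U.ring_axioms]) (simp add: algebra_homs_def)
  from ring_hom_ring.kernel_is_ideal[OF this] show ?thesis
    unfolding a_kernel_def' .
qed

subsection \<open>Subalgebras\<close>

lemma (in complex_algebra) algebra_span_closed:
  assumes "x \<in> algebra_span A S" "S \<subseteq> carrier A"
  shows "x \<in> carrier A"
  using assms by induction auto

lemma (in complex_algebra) complex_algebra_subalgebra:
  "complex_algebra (subalgebra_generated A S)"
proof -
  note cl = algebra_span_closed[of _ "carrier A \<inter> S", OF _ Int_lower1]
  have neg: "\<ominus> x \<in> algebra_span A (carrier A \<inter> S)" if "x \<in> algebra_span A (carrier A \<inter> S)" for x
    using algebra_span.smult[OF that, where c = "-1"] that cl by (simp add: minus_one_smult)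
  have zero: "\<zero> \<in> algebra_span A (carrier A \<inter> S)"
    using algebra_span.smult[OF algebra_span.one, where c = 0 and A = A] by simp
  show ?thesis
  proof (intro complex_algebra.intro complex_algebra_axioms.intro ringI abelian_groupI monoidI)
    fix x assume "x \<in> carrier (subalgebra_generated A S)"
    then show "\<exists>y\<in>carrier (subalgebra_generated A S).
        y \<oplus>\<^bsub>subalgebra_generated A S\<^esub> x = \<zero>\<^bsub>subalgebra_generated A S\<^esub>"
      using neg cl by (intro bexI[of _ "\<ominus> x"]) (auto simp: subalgebra_generated_def l_neg)
  next
    fix x y z assume "x \<in> carrier (subalgebra_generated A S)" "y \<in> carrier (subalgebra_generated A S)"
      "z \<in> carrier (subalgebra_generated A S)"
    then show "x \<oplus>\<^bsub>subalgebra_generated A S\<^esub> y \<oplus>\<^bsub>subalgebra_generated A S\<^esub> z =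
        x \<oplus>\<^bsub>subalgebra_generated A S\<^esub> (y \<oplus>\<^bsub>subalgebra_generated A S\<^esub> z)"
      using cl by (simp add: subalgebra_generated_def a_assoc)
  qed (auto simp: subalgebra_generated_def cl zero a_comm m_assoc l_distr r_distr
      smult_l_distr smult_r_distr smult_smult smult_mult_left smult_mult_right
      intro: algebra_span.intros)
qed

lemma subalgebra_generated_simps [simp]:
  "mult (subalgebra_generated A S) = mult A" "one (subalgebra_generated A S) = one A"
  "zero (subalgebra_generated A S) = zero A" "add (subalgebra_generated A S) = add A"
  "smult (subalgebra_generated A S) = smult A"
  by (simp_all add: subalgebra_generated_def)

subsection \<open>Algebras given by generators and relations\<close>

abbreviation word_monoid :: "'g set \<Rightarrow> 'g list monoid" where
  "word_monoid X \<equiv> \<lparr>carrier = lists X, mult = (@), one = []\<rparr>"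

lemma monoid_words: "monoid (word_monoid X)"
  by (rule monoidI) auto

lemma complex_algebra_free: "complex_algebra (free_algebra X)"
  unfolding free_algebra_def by (rule monoid.complex_algebra_monoid_algebra[OF monoid_words])

lemma carrier_free_algebra: "p \<in> carrier (free_algebra X) \<longleftrightarrow> Poly_Mapping.keys p \<subseteq> lists X"
  by (simp add: free_algebra_def)

definition word_value :: "(complex, 'b, 'z) module_scheme \<Rightarrow> ('g \<Rightarrow> 'b) \<Rightarrow> 'g list \<Rightarrow> 'b" where
  "word_value B f w = foldr (\<lambda>g y. f g \<otimes>\<^bsub>B\<^esub> y) w \<one>\<^bsub>B\<^esub>"

lemma word_value_simps [simp]:
  "word_value B f [] = \<one>\<^bsub>B\<^esub>" "word_value B f (g # w) = f g \<otimes>\<^bsub>B\<^esub> word_value B f w"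
  by (simp_all add: word_value_def)

context complex_algebra
begin

lemma word_value_closed: "f \<in> X \<rightarrow> carrier A \<Longrightarrow> w \<in> lists X \<Longrightarrow> word_value A f w \<in> carrier A"
  by (induction w) auto

lemma word_value_append:
  "f \<in> X \<rightarrow> carrier A \<Longrightarrow> w \<in> lists X \<Longrightarrow> w' \<in> lists X \<Longrightarrow>
    word_value A f (w @ w') = word_value A f w \<otimes> word_value A f w'"
  by (induction w) (auto simp: word_value_closed m_assoc Pi_iff)

lemma substitution_hom:
  assumes "f \<in> X \<rightarrow> carrier A"
  shows "linear_extension A (word_value A f) \<in> algebra_homs (free_algebra X) A"
  unfolding free_algebra_def
  by (rule linear_extension_hom)
    (use assms in \<open>auto simp: complex_algebra_axioms monoid_words hom_def word_value_closed word_value_append\<close>)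

end

locale presentation =
  fixes X :: "'g set" and rels :: "('g list \<Rightarrow>\<^sub>0 complex) set"
  assumes rels: "rels \<subseteq> carrier (free_algebra X)"
begin

sublocale free: complex_algebra "free_algebra X"
  by (rule complex_algebra_free)

sublocale relation_ideal: algebra_ideal "free_algebra X" "Idl\<^bsub>free_algebra X\<^esub> rels"
  by (rule free.algebra_idealI, rule free.genideal_ideal, rule rels)

sublocale presented: complex_algebra "presented_algebra X rels"
  unfolding presented_algebra_def by (rule relation_ideal.complex_algebra_quotient)

lemma complex_algebra_presented: "complex_algebra (presented_algebra X rels)"
  by (rule presented.complex_algebra_axioms)

lemma generator_closed [simp]: "g \<in> X \<Longrightarrow> generator X rels g \<in> carrier (presented_algebra X rels)"
  unfolding generator_def presented_algebra_def quotient_algebra_simps relation_ideal.carrier_quotient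
  by (auto simp: carrier_free_algebra)

text \<open>
  The universal property of a presentation: the kernel of the substitution homomorphism is an ideal, so it
  contains the ideal generated by the relations as soon as it contains the relations.
\<close>

lemma
  assumes U: "complex_algebra U" and f: "f \<in> X \<rightarrow> carrier U"
    and r: "\<And>r. r \<in> rels \<Longrightarrow> linear_extension U (word_value U f) r = \<zero>\<^bsub>U\<^esub>"
  shows induced_hom: "induced_hom U f \<in> algebra_homs (presented_algebra X rels) U"
    and induced_hom_generator: "g \<in> X \<Longrightarrow> induced_hom U f (generator X rels g) = f g"
proof -
  interpret U: complex_algebra U by fact
  let ?ev = "linear_extension U (word_value U f)"
  have ev: "?ev \<in> algebra_homs (free_algebra X) U" by (rule U.substitution_hom[OF f])
  have "Idl\<^bsub>free_algebra X\<^esub> rels \<subseteq> {x \<in> carrier (free_algebra X). ?ev x = \<zero>\<^bsub>U\<^esub>}"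
    using r rels kernel_ideal[OF complex_algebra_free U ev] by (intro free.genideal_minimal) auto
  then have N: "\<And>n. n \<in> Idl\<^bsub>free_algebra X\<^esub> rels \<Longrightarrow> ?ev n = \<zero>\<^bsub>U\<^esub>" by blast
  have eq: "induced_hom U f = (\<lambda>K. the_elem (?ev ` K))"
    by (simp add: induced_hom_def[abs_def] word_value_def[abs_def])
  show "induced_hom U f \<in> algebra_homs (presented_algebra X rels) U"
    unfolding eq presented_algebra_def by (rule relation_ideal.quotient_algebra_hom[OF U ev N])
  assume "g \<in> X"
  then have "induced_hom U f (generator X rels g) = ?ev (Poly_Mapping.single [g] 1)"
    unfolding eq generator_def using ev
    by (intro relation_ideal.quotient_value[OF U _ N]) (auto simp: algebra_homs_def carrier_free_algebra)
  then show "induced_hom U f (generator X rels g) = f g"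
    using \<open>g \<in> X\<close> f by (simp add: U.linear_extension_single Pi_iff)
qed

text \<open>
  Substitution of the generators and the projection to the quotient are homomorphisms that agree on single
  letters. This is what turns a relation into an equation between generators.
\<close>

lemma substitution_generators:
  assumes "p \<in> carrier (free_algebra X)"
  shows "linear_extension (presented_algebra X rels) (word_value (presented_algebra X rels) (generator X rels)) p =
    Idl\<^bsub>free_algebra X\<^esub> rels +>\<^bsub>free_algebra X\<^esub> p" (is "?ev p = ?pr p")
proof -
  have g: "generator X rels \<in> X \<rightarrow> carrier (presented_algebra X rels)" by simp
  have ev: "?ev \<in> algebra_homs (free_algebra X) (presented_algebra X rels)"
    by (rule presented.substitution_hom[OF g])
  have pr: "?pr \<in> algebra_homs (free_algebra X) (presented_algebra X rels)"
    unfolding presented_algebra_def by (rule relation_ideal.quotient_projection)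
  have word: "?ev (Poly_Mapping.single w 1) = ?pr (Poly_Mapping.single w 1)" if "w \<in> lists X" for w
    using that
  proof (induction w)
    case Nil
    have "Poly_Mapping.single [] 1 = \<one>\<^bsub>free_algebra X\<^esub>" by (simp add: free_algebra_def)
    then show ?case using algebra_homsD(5)[OF ev] algebra_homsD(5)[OF pr] by simp
  next
    case (Cons x w)
    have "Poly_Mapping.single (x # w) 1 = Poly_Mapping.single [x] 1 \<otimes>\<^bsub>free_algebra X\<^esub> Poly_Mapping.single w 1"
      by (simp add: free_algebra_def)
    moreover have "?ev (Poly_Mapping.single [x] 1) = ?pr (Poly_Mapping.single [x] 1)"
      using Cons by (simp add: presented.linear_extension_single generator_def[symmetric])
    ultimately show ?case
      using Cons algebra_homsD(2)[OF ev] algebra_homsD(2)[OF pr] by (simp add: carrier_free_algebra)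
  qed
  from assms[unfolded carrier_free_algebra] show ?thesis
  proof (induction rule: poly_mapping_carrier_induct)
    case zero
    have "?pr 0 = ?pr (0 \<odot>\<^bsub>free_algebra X\<^esub> Poly_Mapping.single [] 1)"
      by (simp add: free_algebra_def)
    also have "\<dots> = \<zero>\<^bsub>presented_algebra X rels\<^esub>"
      using algebra_homsD(1)[OF pr] by (subst algebra_homsD(4)[OF pr]) (simp_all add: carrier_free_algebra)
    finally show ?case by simp
  next
    case (add w c p)
    have "Poly_Mapping.single w c + p =
        c \<odot>\<^bsub>free_algebra X\<^esub> Poly_Mapping.single w 1 \<oplus>\<^bsub>free_algebra X\<^esub> p"
      by (simp add: free_algebra_def)
    moreover have c: "Poly_Mapping.single w 1 \<in> carrier (free_algebra X)" "p \<in> carrier (free_algebra X)"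
      using add by (simp_all add: carrier_free_algebra)
    moreover note word[OF add(1)] add(3)
    ultimately show ?case
      using free.smult_closed[OF c(1), of c] algebra_homsD(3,4)[OF ev] algebra_homsD(3,4)[OF pr] by simp
  qed
qed

lemma relation_holds:
  assumes "r \<in> rels"
  shows "linear_extension (presented_algebra X rels) (word_value (presented_algebra X rels) (generator X rels)) r =
    \<zero>\<^bsub>presented_algebra X rels\<^esub>"
proof -
  have "r \<in> Idl\<^bsub>free_algebra X\<^esub> rels" using free.genideal_self[OF rels] assms by blast
  then have "Idl\<^bsub>free_algebra X\<^esub> rels +>\<^bsub>free_algebra X\<^esub> r = \<zero>\<^bsub>presented_algebra X rels\<^esub>"
    unfolding presented_algebra_def quotient_algebra_simps by (rule relation_ideal.a_rcos_const)
  moreover have "r \<in> carrier (free_algebra X)" using assms rels by blast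
  ultimately show ?thesis
    by (simp only: substitution_generators)
qed

end

section \<open>Tensor products\<close>

context
  fixes M :: "('m, 'z) monoid_scheme" (structure)
begin

lemma monoid_algebra_mult_diff_left:
  "(p - p') \<otimes>\<^bsub>monoid_algebra M\<^esub> r = p \<otimes>\<^bsub>monoid_algebra M\<^esub> r - p' \<otimes>\<^bsub>monoid_algebra M\<^esub> r"
  using monoid_algebra_mult_add_left[of M "p - p'" p' r] by simp

lemma monoid_algebra_mult_diff_right:
  "r \<otimes>\<^bsub>monoid_algebra M\<^esub> (p - p') = r \<otimes>\<^bsub>monoid_algebra M\<^esub> p - r \<otimes>\<^bsub>monoid_algebra M\<^esub> p'"
  using monoid_algebra_mult_add_right[of M r "p - p'" p'] by simp

end

lemma map_smult_diff:
  "Poly_Mapping.map ((*) (c::complex)) (p - r) = Poly_Mapping.map ((*) c) p - Poly_Mapping.map ((*) c) r"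
  by (rule poly_mapping_eqI) (simp add: lookup_minus right_diff_distrib)

context complex_algebra
begin

lemma add_diff_diff:
  assumes "x \<in> carrier A" "y \<in> carrier A"
  shows "x \<oplus> y \<ominus> x \<ominus> y = \<zero>"
proof -
  have "x \<oplus> y \<ominus> x = y \<oplus> (x \<oplus> \<ominus> x)"
    using assms a_comm[of x y] by (simp add: a_minus_def a_assoc)
  then show ?thesis using assms by (simp add: r_neg a_minus_def)
qed

context
  fixes S assumes S: "S \<subseteq> carrier A"
begin

lemma linear_span_closed: "x \<in> linear_span A S \<Longrightarrow> x \<in> carrier A"
  by (induction rule: linear_span.induct) (use S in auto)

lemma linear_span_add: "x \<in> linear_span A S \<Longrightarrow> y \<in> linear_span A S \<Longrightarrow> x \<oplus> y \<in> linear_span A S"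
proof (induction rule: linear_span.induct)
  case (step s x c)
  moreover have "(c \<odot> s \<oplus> x) \<oplus> y = c \<odot> s \<oplus> (x \<oplus> y)"
    using step S linear_span_closed by (intro a_assoc) auto
  ultimately show ?case by (simp add: linear_span.step)
qed (simp add: linear_span_closed)

lemma linear_span_smult: "x \<in> linear_span A S \<Longrightarrow> c \<odot> x \<in> linear_span A S"
proof (induction rule: linear_span.induct)
  case (step s x d)
  have "c \<odot> (d \<odot> s \<oplus> x) = (c * d) \<odot> s \<oplus> c \<odot> x"
    using step S linear_span_closed[of x] by (auto simp: smult_r_distr smult_smult)
  then show ?case using step by (simp add: linear_span.step)
qed (simp add: linear_span.zero)

lemma linear_span_base: "s \<in> S \<Longrightarrow> s \<in> linear_span A S"
  using linear_span.step[OF _ linear_span.zero, of s S A 1] S by auto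

lemma linear_span_subgroup: "subgroup (linear_span A S) (add_monoid A)"
proof (rule add.subgroupI)
  show "linear_span A S \<noteq> {}" using linear_span.zero[of A S] by blast
  fix x assume x: "x \<in> linear_span A S"
  then show "\<ominus> x \<in> linear_span A S"
    using linear_span_smult[OF x, of "-1"] linear_span_closed by (simp add: minus_one_smult)
qed (use linear_span_closed linear_span_add in auto)

end

end

text \<open>The generators of \<^const>\<open>bilinearity\<close>, named so that inductions over the span can refer to them.\<close>

definition bilinearity_relations :: "'a calg \<Rightarrow> 'b calg \<Rightarrow> ('a, 'b) tensor" where
  "bilinearity_relations V W =
     {Poly_Mapping.single (v \<oplus>\<^bsub>V\<^esub> v', w) 1 - Poly_Mapping.single (v, w) 1
        - Poly_Mapping.single (v', w) 1 | v v' w.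
        v \<in> carrier V \<and> v' \<in> carrier V \<and> w \<in> carrier W} \<union>
     {Poly_Mapping.single (v, w \<oplus>\<^bsub>W\<^esub> w') 1 - Poly_Mapping.single (v, w) 1
        - Poly_Mapping.single (v, w') 1 | v w w'.
        v \<in> carrier V \<and> w \<in> carrier W \<and> w' \<in> carrier W} \<union>
     {Poly_Mapping.single (c \<odot>\<^bsub>V\<^esub> v, w) 1 - Poly_Mapping.single (v, w) c | c v w.
        v \<in> carrier V \<and> w \<in> carrier W} \<union>
     {Poly_Mapping.single (v, c \<odot>\<^bsub>W\<^esub> w) 1 - Poly_Mapping.single (v, w) c | c v w.
        v \<in> carrier V \<and> w \<in> carrier W}"

lemma bilinearity_relations_cases:
  assumes "s \<in> bilinearity_relations V W"
  obtains (add_left) v v' w where "v \<in> carrier V" "v' \<in> carrier V" "w \<in> carrier W"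
      "s = Poly_Mapping.single (v \<oplus>\<^bsub>V\<^esub> v', w) 1 - Poly_Mapping.single (v, w) 1 - Poly_Mapping.single (v', w) 1"
  | (add_right) v w w' where "v \<in> carrier V" "w \<in> carrier W" "w' \<in> carrier W"
      "s = Poly_Mapping.single (v, w \<oplus>\<^bsub>W\<^esub> w') 1 - Poly_Mapping.single (v, w) 1 - Poly_Mapping.single (v, w') 1"
  | (smult_left) c v w where "v \<in> carrier V" "w \<in> carrier W"
      "s = Poly_Mapping.single (c \<odot>\<^bsub>V\<^esub> v, w) 1 - Poly_Mapping.single (v, w) c"
  | (smult_right) c v w where "v \<in> carrier V" "w \<in> carrier W"
      "s = Poly_Mapping.single (v, c \<odot>\<^bsub>W\<^esub> w) 1 - Poly_Mapping.single (v, w) c"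
  using assms unfolding bilinearity_relations_def by blast

lemma bilinearity_relationsI:
  "v \<in> carrier V \<Longrightarrow> v' \<in> carrier V \<Longrightarrow> w \<in> carrier W \<Longrightarrow>
    Poly_Mapping.single (v \<oplus>\<^bsub>V\<^esub> v', w) 1 - Poly_Mapping.single (v, w) 1 - Poly_Mapping.single (v', w) 1
      \<in> bilinearity_relations V W"
  "v \<in> carrier V \<Longrightarrow> w \<in> carrier W \<Longrightarrow> w' \<in> carrier W \<Longrightarrow>
    Poly_Mapping.single (v, w \<oplus>\<^bsub>W\<^esub> w') 1 - Poly_Mapping.single (v, w) 1 - Poly_Mapping.single (v, w') 1
      \<in> bilinearity_relations V W"
  "v \<in> carrier V \<Longrightarrow> w \<in> carrier W \<Longrightarrow>
    Poly_Mapping.single (c \<odot>\<^bsub>V\<^esub> v, w) 1 - Poly_Mapping.single (v, w) c \<in> bilinearity_relations V W"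
  "v \<in> carrier V \<Longrightarrow> w \<in> carrier W \<Longrightarrow>
    Poly_Mapping.single (v, c \<odot>\<^bsub>W\<^esub> w) 1 - Poly_Mapping.single (v, w) c \<in> bilinearity_relations V W"
  unfolding bilinearity_relations_def by blast+

locale tensor_product = V: complex_algebra V + W: complex_algebra W
  for V :: "'a calg" and W :: "'b calg"
begin

lemma monoid_DirProd: "monoid (V \<times>\<times> W)"
  by (intro DirProd_monoid V.monoid_axioms W.monoid_axioms)

sublocale formal: complex_algebra "monoid_algebra (V \<times>\<times> W)"
  by (rule monoid.complex_algebra_monoid_algebra[OF monoid_DirProd])

lemma carrier_formal: "p \<in> carrier (monoid_algebra (V \<times>\<times> W)) \<longleftrightarrow> Poly_Mapping.keys p \<subseteq> carrier V \<times> carrier W"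
  by (simp add: DirProd_def)

lemma single_formal: "v \<in> carrier V \<Longrightarrow> w \<in> carrier W \<Longrightarrow>
    Poly_Mapping.single (v, w) c \<in> carrier (monoid_algebra (V \<times>\<times> W))"
  by (simp add: carrier_formal)

lemma diff_formal:
  assumes "p \<in> carrier (monoid_algebra (V \<times>\<times> W))" "r \<in> carrier (monoid_algebra (V \<times>\<times> W))"
  shows "p - r \<in> carrier (monoid_algebra (V \<times>\<times> W))"
  using assms keys_diff[of p r] by (auto simp: carrier_formal)

lemma bilinearity_relations_closed: "bilinearity_relations V W \<subseteq> carrier (monoid_algebra (V \<times>\<times> W))"
proof
  fix s assume "s \<in> bilinearity_relations V W"
  then show "s \<in> carrier (monoid_algebra (V \<times>\<times> W))"
    by (cases rule: bilinearity_relations_cases) (auto intro!: diff_formal single_formal simp del: monoid_algebra_simps)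
qed

lemma bilinearity_eq: "bilinearity V W = linear_span (monoid_algebra (V \<times>\<times> W)) (bilinearity_relations V W)"
  by (simp add: bilinearity_def bilinearity_relations_def)

text \<open>
  A basis element times a bilinearity relation is a multiple of another bilinearity relation; this is why
  the span of these relations is an ideal.
\<close>

lemma relation_mult:
  assumes "s \<in> bilinearity_relations V W" "v \<in> carrier V" "w \<in> carrier W"
  shows "\<exists>s'\<in>bilinearity_relations V W.
      Poly_Mapping.single (v, w) c \<otimes>\<^bsub>monoid_algebra (V \<times>\<times> W)\<^esub> s = Poly_Mapping.map ((*) c) s'"
    and "\<exists>s'\<in>bilinearity_relations V W.
      s \<otimes>\<^bsub>monoid_algebra (V \<times>\<times> W)\<^esub> Poly_Mapping.single (v, w) c = Poly_Mapping.map ((*) c) s'"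
proof -
  note [simp] = map_smult_diff monoid_algebra_mult_diff_left monoid_algebra_mult_diff_right DirProd_def
    V.l_distr V.r_distr W.l_distr W.r_distr V.smult_mult_left V.smult_mult_right W.smult_mult_left
    W.smult_mult_right mult.commute
  from assms(1) have "(\<exists>s'\<in>bilinearity_relations V W.
      Poly_Mapping.single (v, w) c \<otimes>\<^bsub>monoid_algebra (V \<times>\<times> W)\<^esub> s = Poly_Mapping.map ((*) c) s') \<and>
    (\<exists>s'\<in>bilinearity_relations V W.
      s \<otimes>\<^bsub>monoid_algebra (V \<times>\<times> W)\<^esub> Poly_Mapping.single (v, w) c = Poly_Mapping.map ((*) c) s')"
  proof (cases rule: bilinearity_relations_cases)
    case (add_left a a' b)
    note m1 = bilinearity_relationsI(1)[OF V.m_closed[OF assms(2) add_left(1)] V.m_closed[OF assms(2) add_left(2)] W.m_closed[OF assms(3) add_left(3)]]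
    note m2 = bilinearity_relationsI(1)[OF V.m_closed[OF add_left(1) assms(2)] V.m_closed[OF add_left(2) assms(2)] W.m_closed[OF add_left(3) assms(3)]]
    show ?thesis
      by (rule conjI[OF bexI[OF _ m1] bexI[OF _ m2]]) (use add_left assms(2,3) in auto)
  next
    case (add_right a b b')
    note m1 = bilinearity_relationsI(2)[OF V.m_closed[OF assms(2) add_right(1)] W.m_closed[OF assms(3) add_right(2)] W.m_closed[OF assms(3) add_right(3)]]
    note m2 = bilinearity_relationsI(2)[OF V.m_closed[OF add_right(1) assms(2)] W.m_closed[OF add_right(2) assms(3)] W.m_closed[OF add_right(3) assms(3)]]
    show ?thesis
      by (rule conjI[OF bexI[OF _ m1] bexI[OF _ m2]]) (use add_right assms(2,3) in auto)
  next
    case (smult_left d a b)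
    note m1 = bilinearity_relationsI(3)[OF V.m_closed[OF assms(2) smult_left(1)] W.m_closed[OF assms(3) smult_left(2)], of d]
    note m2 = bilinearity_relationsI(3)[OF V.m_closed[OF smult_left(1) assms(2)] W.m_closed[OF smult_left(2) assms(3)], of d]
    show ?thesis
      by (rule conjI[OF bexI[OF _ m1] bexI[OF _ m2]]) (use smult_left assms(2,3) in auto)
  next
    case (smult_right d a b)
    note m1 = bilinearity_relationsI(4)[OF V.m_closed[OF assms(2) smult_right(1)] W.m_closed[OF assms(3) smult_right(2)], of d]
    note m2 = bilinearity_relationsI(4)[OF V.m_closed[OF smult_right(1) assms(2)] W.m_closed[OF smult_right(2) assms(3)], of d]
    show ?thesis
      by (rule conjI[OF bexI[OF _ m1] bexI[OF _ m2]]) (use smult_right assms(2,3) in auto)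
  qed
  then show "\<exists>s'\<in>bilinearity_relations V W.
      Poly_Mapping.single (v, w) c \<otimes>\<^bsub>monoid_algebra (V \<times>\<times> W)\<^esub> s = Poly_Mapping.map ((*) c) s'"
    and "\<exists>s'\<in>bilinearity_relations V W.
      s \<otimes>\<^bsub>monoid_algebra (V \<times>\<times> W)\<^esub> Poly_Mapping.single (v, w) c = Poly_Mapping.map ((*) c) s'"
    by blast+
qed

lemma bilinearity_mult_single:
  assumes "x \<in> bilinearity V W" "v \<in> carrier V" "w \<in> carrier W"
  shows "Poly_Mapping.single (v, w) c \<otimes>\<^bsub>monoid_algebra (V \<times>\<times> W)\<^esub> x \<in> bilinearity V W \<and>
    x \<otimes>\<^bsub>monoid_algebra (V \<times>\<times> W)\<^esub> Poly_Mapping.single (v, w) c \<in> bilinearity V W"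
  using assms(1) unfolding bilinearity_eq
proof (induction rule: linear_span.induct)
  case zero
  show ?case
    using linear_span.zero[of "monoid_algebra (V \<times>\<times> W)"] by simp
next
  case (step s x d)
  obtain s1 s2 where s: "s1 \<in> bilinearity_relations V W" "s2 \<in> bilinearity_relations V W"
      "Poly_Mapping.single (v, w) c \<otimes>\<^bsub>monoid_algebra (V \<times>\<times> W)\<^esub> s = Poly_Mapping.map ((*) c) s1"
      "s \<otimes>\<^bsub>monoid_algebra (V \<times>\<times> W)\<^esub> Poly_Mapping.single (v, w) c = Poly_Mapping.map ((*) c) s2"
    using relation_mult[OF step(1) assms(2,3)] by blast
  have "Poly_Mapping.map ((*) d) (Poly_Mapping.map ((*) c) s') \<in>
      linear_span (monoid_algebra (V \<times>\<times> W)) (bilinearity_relations V W)"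
    if "s' \<in> bilinearity_relations V W" for s'
    using formal.linear_span_smult[OF bilinearity_relations_closed
        formal.linear_span_smult[OF bilinearity_relations_closed
          formal.linear_span_base[OF bilinearity_relations_closed that]]] by simp
  then show ?case
    using step s formal.linear_span_add[OF bilinearity_relations_closed]
    by (simp add: monoid_algebra_mult_add_left monoid_algebra_mult_add_right
        monoid_algebra_smult_left monoid_algebra_smult_right)
qed

lemma ideal_bilinearity: "ideal (bilinearity V W) (monoid_algebra (V \<times>\<times> W))"
proof (rule idealI)
  show "ring (monoid_algebra (V \<times>\<times> W))" by (rule formal.ring_axioms)
  show "subgroup (bilinearity V W) (add_monoid (monoid_algebra (V \<times>\<times> W)))"
    unfolding bilinearity_eq by (rule formal.linear_span_subgroup[OF bilinearity_relations_closed])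
  fix a x assume a: "a \<in> bilinearity V W" and x: "x \<in> carrier (monoid_algebra (V \<times>\<times> W))"
  have add: "p + r \<in> bilinearity V W" if "p \<in> bilinearity V W" "r \<in> bilinearity V W" for p r
    using formal.linear_span_add[OF bilinearity_relations_closed] that unfolding bilinearity_eq by simp
  have zero: "0 \<in> bilinearity V W"
    using linear_span.zero[of "monoid_algebra (V \<times>\<times> W)"] unfolding bilinearity_eq by simp
  from x[unfolded carrier_formal] have "x \<otimes>\<^bsub>monoid_algebra (V \<times>\<times> W)\<^esub> a \<in> bilinearity V W \<and>
      a \<otimes>\<^bsub>monoid_algebra (V \<times>\<times> W)\<^esub> x \<in> bilinearity V W"
  proof (induction rule: poly_mapping_carrier_induct)
    case (add m c p)
    then show ?case
      using bilinearity_mult_single[OF a] \<open>\<And>p r. \<lbrakk>p \<in> bilinearity V W; r \<in> bilinearity V W\<rbrakk> \<Longrightarrow> p + r \<in> bilinearity V W\<close>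
      by (auto simp: monoid_algebra_mult_add_left monoid_algebra_mult_add_right)
  qed (simp add: zero)
  then show "x \<otimes>\<^bsub>monoid_algebra (V \<times>\<times> W)\<^esub> a \<in> bilinearity V W"
    "a \<otimes>\<^bsub>monoid_algebra (V \<times>\<times> W)\<^esub> x \<in> bilinearity V W" by blast+
qed

sublocale relation_ideal: algebra_ideal "monoid_algebra (V \<times>\<times> W)" "bilinearity V W"
  by (rule formal.algebra_idealI[OF ideal_bilinearity])

sublocale tensor: complex_algebra "tensor_algebra V W"
  unfolding tensor_algebra_def by (rule relation_ideal.complex_algebra_quotient)

abbreviation pure where "pure \<equiv> pure_tensor V W"

lemma projection: "(\<lambda>x. bilinearity V W +>\<^bsub>monoid_algebra (V \<times>\<times> W)\<^esub> x) \<in>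
    algebra_homs (monoid_algebra (V \<times>\<times> W)) (tensor_algebra V W)"
  unfolding tensor_algebra_def by (rule relation_ideal.quotient_projection)

lemma pure_closed [simp]: "v \<in> carrier V \<Longrightarrow> w \<in> carrier W \<Longrightarrow> pure v w \<in> carrier (tensor_algebra V W)"
  unfolding pure_tensor_def by (intro algebra_homsD(1)[OF projection] single_formal)

lemma formal_minus:
  assumes "p \<in> carrier (monoid_algebra (V \<times>\<times> W))" "r \<in> carrier (monoid_algebra (V \<times>\<times> W))"
  shows "p \<ominus>\<^bsub>monoid_algebra (V \<times>\<times> W)\<^esub> r = p - r"
proof -
  have "- r \<in> carrier (monoid_algebra (V \<times>\<times> W))" using assms by (simp add: carrier_formal)
  then have "\<ominus>\<^bsub>monoid_algebra (V \<times>\<times> W)\<^esub> r = - r"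
    using assms by (intro formal.minus_equality) auto
  then show ?thesis by (simp add: a_minus_def)
qed

lemma projection_eqI:
  assumes "s \<in> bilinearity_relations V W" "s = p - r"
    "p \<in> carrier (monoid_algebra (V \<times>\<times> W))" "r \<in> carrier (monoid_algebra (V \<times>\<times> W))"
  shows "bilinearity V W +>\<^bsub>monoid_algebra (V \<times>\<times> W)\<^esub> p = bilinearity V W +>\<^bsub>monoid_algebra (V \<times>\<times> W)\<^esub> r"
proof (rule relation_ideal.coset_eqI[OF assms(3,4)])
  show "p \<ominus>\<^bsub>monoid_algebra (V \<times>\<times> W)\<^esub> r \<in> bilinearity V W"
    unfolding formal_minus[OF assms(3,4)] bilinearity_eq using assms(1,2)
      formal.linear_span_base[OF bilinearity_relations_closed] by blast
qed

lemma projection_single: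
  assumes "v \<in> carrier V" "w \<in> carrier W"
  shows "bilinearity V W +>\<^bsub>monoid_algebra (V \<times>\<times> W)\<^esub> Poly_Mapping.single (v, w) c =
    c \<odot>\<^bsub>tensor_algebra V W\<^esub> pure v w"
  using algebra_homsD(4)[OF projection single_formal[OF assms, of 1], of c]
  by (simp add: pure_tensor_def)

lemma pure_smult_left:
  assumes "v \<in> carrier V" "w \<in> carrier W"
  shows "pure (c \<odot>\<^bsub>V\<^esub> v) w = c \<odot>\<^bsub>tensor_algebra V W\<^esub> pure v w"
proof -
  have "pure (c \<odot>\<^bsub>V\<^esub> v) w = bilinearity V W +>\<^bsub>monoid_algebra (V \<times>\<times> W)\<^esub> Poly_Mapping.single (v, w) c"
    unfolding pure_tensor_def using assms
    by (intro projection_eqI[OF bilinearity_relationsI(3)[OF assms, of c]] single_formal) auto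
  then show ?thesis using projection_single assms by simp
qed

lemma pure_smult_right:
  assumes "v \<in> carrier V" "w \<in> carrier W"
  shows "pure v (c \<odot>\<^bsub>W\<^esub> w) = c \<odot>\<^bsub>tensor_algebra V W\<^esub> pure v w"
proof -
  have "pure v (c \<odot>\<^bsub>W\<^esub> w) = bilinearity V W +>\<^bsub>monoid_algebra (V \<times>\<times> W)\<^esub> Poly_Mapping.single (v, w) c"
    unfolding pure_tensor_def using assms
    by (intro projection_eqI[OF bilinearity_relationsI(4)[OF assms, of c]] single_formal) auto
  then show ?thesis using projection_single assms by simp
qed

lemma projection_add:
  assumes "p \<in> carrier (monoid_algebra (V \<times>\<times> W))" "r \<in> carrier (monoid_algebra (V \<times>\<times> W))"
  shows "bilinearity V W +>\<^bsub>monoid_algebra (V \<times>\<times> W)\<^esub> (p + r) =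
    (bilinearity V W +>\<^bsub>monoid_algebra (V \<times>\<times> W)\<^esub> p) \<oplus>\<^bsub>tensor_algebra V W\<^esub>
    (bilinearity V W +>\<^bsub>monoid_algebra (V \<times>\<times> W)\<^esub> r)"
  using algebra_homsD(3)[OF projection assms] by simp

lemma formal_add:
  assumes "p \<in> carrier (monoid_algebra (V \<times>\<times> W))" "r \<in> carrier (monoid_algebra (V \<times>\<times> W))"
  shows "p + r \<in> carrier (monoid_algebra (V \<times>\<times> W))"
  using formal.a_closed[OF assms] by simp

lemma pure_add_left:
  assumes "v \<in> carrier V" "v' \<in> carrier V" "w \<in> carrier W"
  shows "pure (v \<oplus>\<^bsub>V\<^esub> v') w = pure v w \<oplus>\<^bsub>tensor_algebra V W\<^esub> pure v' w"
proof -
  have "pure (v \<oplus>\<^bsub>V\<^esub> v') w = bilinearity V W +>\<^bsub>monoid_algebra (V \<times>\<times> W)\<^esub>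
      (Poly_Mapping.single (v, w) 1 + Poly_Mapping.single (v', w) 1)"
    unfolding pure_tensor_def using assms
    by (intro projection_eqI[OF bilinearity_relationsI(1)[OF assms]] formal_add single_formal)
      (auto simp: diff_diff_eq)
  then show ?thesis using assms by (simp only: projection_add single_formal pure_tensor_def)
qed

lemma pure_add_right:
  assumes "v \<in> carrier V" "w \<in> carrier W" "w' \<in> carrier W"
  shows "pure v (w \<oplus>\<^bsub>W\<^esub> w') = pure v w \<oplus>\<^bsub>tensor_algebra V W\<^esub> pure v w'"
proof -
  have "pure v (w \<oplus>\<^bsub>W\<^esub> w') = bilinearity V W +>\<^bsub>monoid_algebra (V \<times>\<times> W)\<^esub>
      (Poly_Mapping.single (v, w) 1 + Poly_Mapping.single (v, w') 1)"
    unfolding pure_tensor_def using assms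
    by (intro projection_eqI[OF bilinearity_relationsI(2)[OF assms]] formal_add single_formal)
      (auto simp: diff_diff_eq)
  then show ?thesis using assms by (simp only: projection_add single_formal pure_tensor_def)
qed

lemma pure_mult:
  assumes "v \<in> carrier V" "w \<in> carrier W" "v' \<in> carrier V" "w' \<in> carrier W"
  shows "pure v w \<otimes>\<^bsub>tensor_algebra V W\<^esub> pure v' w' = pure (v \<otimes>\<^bsub>V\<^esub> v') (w \<otimes>\<^bsub>W\<^esub> w')"
  using algebra_homsD(2)[OF projection single_formal[OF assms(1,2), of 1] single_formal[OF assms(3,4), of 1]]
  by (simp add: pure_tensor_def DirProd_def)

lemma pure_one: "pure \<one>\<^bsub>V\<^esub> \<one>\<^bsub>W\<^esub> = \<one>\<^bsub>tensor_algebra V W\<^esub>"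
  using algebra_homsD(5)[OF projection] by (simp add: pure_tensor_def DirProd_def)

text \<open>The universal property: the linear extension of a bilinear map kills every bilinearity relation.\<close>

context
  fixes U :: "'u calg" and b
  assumes U: "complex_algebra U"
    and b_closed: "\<And>v w. v \<in> carrier V \<Longrightarrow> w \<in> carrier W \<Longrightarrow> b v w \<in> carrier U"
    and b_add_left: "\<And>v v' w. v \<in> carrier V \<Longrightarrow> v' \<in> carrier V \<Longrightarrow> w \<in> carrier W \<Longrightarrow>
      b (v \<oplus>\<^bsub>V\<^esub> v') w = b v w \<oplus>\<^bsub>U\<^esub> b v' w"
    and b_add_right: "\<And>v w w'. v \<in> carrier V \<Longrightarrow> w \<in> carrier W \<Longrightarrow> w' \<in> carrier W \<Longrightarrow>
      b v (w \<oplus>\<^bsub>W\<^esub> w') = b v w \<oplus>\<^bsub>U\<^esub> b v w'"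
    and b_smult_left: "\<And>c v w. v \<in> carrier V \<Longrightarrow> w \<in> carrier W \<Longrightarrow> b (c \<odot>\<^bsub>V\<^esub> v) w = c \<odot>\<^bsub>U\<^esub> b v w"
    and b_smult_right: "\<And>c v w. v \<in> carrier V \<Longrightarrow> w \<in> carrier W \<Longrightarrow> b v (c \<odot>\<^bsub>W\<^esub> w) = c \<odot>\<^bsub>U\<^esub> b v w"
begin

interpretation U: complex_algebra U by (rule U)

lemma b_Pi: "(\<lambda>(v, w). b v w) \<in> carrier (V \<times>\<times> W) \<rightarrow> carrier U"
  using b_closed by (auto simp: DirProd_def)

lemma extension_linear: "linear_extension U (\<lambda>(v, w). b v w) \<in> linear_maps (monoid_algebra (V \<times>\<times> W)) U"
  by (rule linear_extension_linear[OF U b_Pi])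

lemma extension_single: "v \<in> carrier V \<Longrightarrow> w \<in> carrier W \<Longrightarrow>
    linear_extension U (\<lambda>(v, w). b v w) (Poly_Mapping.single (v, w) c) = c \<odot>\<^bsub>U\<^esub> b v w"
  by (subst U.linear_extension_single) (auto simp: b_closed)

lemma extension_diff:
  assumes "p \<in> carrier (monoid_algebra (V \<times>\<times> W))" "r \<in> carrier (monoid_algebra (V \<times>\<times> W))"
  shows "linear_extension U (\<lambda>(v, w). b v w) (p - r) =
    linear_extension U (\<lambda>(v, w). b v w) p \<ominus>\<^bsub>U\<^esub> linear_extension U (\<lambda>(v, w). b v w) r"
  using assms U.linear_extension_diff[OF _ _ b_Pi] by simp

lemma extension_relation:
  assumes "s \<in> bilinearity_relations V W"
  shows "linear_extension U (\<lambda>(v, w). b v w) s = \<zero>\<^bsub>U\<^esub>"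
  using assms
proof (cases rule: bilinearity_relations_cases)
  case (add_left v v' w)
  then show ?thesis
    by (simp add: extension_diff diff_formal single_formal extension_single b_closed b_add_left del: monoid_algebra_simps)
      (simp add: b_closed U.add_diff_diff)
next
  case (add_right v w w')
  then show ?thesis
    by (simp add: extension_diff diff_formal single_formal extension_single b_closed b_add_right del: monoid_algebra_simps)
      (simp add: b_closed U.add_diff_diff)
next
  case (smult_left c v w)
  then show ?thesis
    by (simp add: extension_diff single_formal extension_single b_closed b_smult_left del: monoid_algebra_simps)
      (simp add: b_closed a_minus_def U.r_neg)
next
  case (smult_right c v w)
  then show ?thesis
    by (simp add: extension_diff single_formal extension_single b_closed b_smult_right del: monoid_algebra_simps)
      (simp add: b_closed a_minus_def U.r_neg)
qed

lemma extension_bilinearity: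
  assumes "x \<in> bilinearity V W"
  shows "linear_extension U (\<lambda>(v, w). b v w) x = \<zero>\<^bsub>U\<^esub>"
  using assms unfolding bilinearity_eq
proof (induction rule: linear_span.induct)
  case (step s x c)
  moreover have s: "s \<in> carrier (monoid_algebra (V \<times>\<times> W))"
    using bilinearity_relations_closed step(1) by blast
  moreover have x: "x \<in> carrier (monoid_algebra (V \<times>\<times> W))"
    using formal.linear_span_closed[OF bilinearity_relations_closed step(2)] .
  ultimately show ?case
    using linear_mapsD(2)[OF extension_linear formal.smult_closed[OF s] x, of c]
      linear_mapsD(3)[OF extension_linear s, of c]
    by (simp add: extension_relation del: monoid_algebra_simps)
qed simp

lemma tensor_lift_linear: "tensor_lift U b \<in> linear_maps (tensor_algebra V W) U"
  unfolding tensor_lift_def[abs_def] tensor_algebra_def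
  by (rule relation_ideal.quotient_linear_map[OF U extension_linear extension_bilinearity])

lemma tensor_lift_pure:
  assumes "v \<in> carrier V" "w \<in> carrier W"
  shows "tensor_lift U b (pure v w) = b v w"
  unfolding tensor_lift_def pure_tensor_def
  using relation_ideal.quotient_value[OF U extension_linear extension_bilinearity single_formal[OF assms, of 1]]
    extension_single[OF assms, of 1] assms b_closed by simp

end

text \<open>The two images have to commute for the map to be multiplicative on the basis of pure tensors.\<close>

lemma tensor_lift_hom:
  assumes U: "complex_algebra U" and f: "f \<in> algebra_homs V U" and g: "g \<in> algebra_homs W U"
    and comm: "\<And>v w. v \<in> carrier V \<Longrightarrow> w \<in> carrier W \<Longrightarrow> f v \<otimes>\<^bsub>U\<^esub> g w = g w \<otimes>\<^bsub>U\<^esub> f v"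
  shows "tensor_lift U (\<lambda>v w. f v \<otimes>\<^bsub>U\<^esub> g w) \<in> algebra_homs (tensor_algebra V W) U"
proof -
  interpret U: complex_algebra U by (rule U)
  note fD = algebra_homsD[OF f] and gD = algebra_homsD[OF g]
  let ?b = "\<lambda>(v, w). f v \<otimes>\<^bsub>U\<^esub> g w"
  have "?b \<in> hom (V \<times>\<times> W) U"
  proof (rule homI)
    fix x y assume "x \<in> carrier (V \<times>\<times> W)" "y \<in> carrier (V \<times>\<times> W)"
    then obtain v w v' w' where vw: "x = (v, w)" "y = (v', w')" "v \<in> carrier V" "w \<in> carrier W"
        "v' \<in> carrier V" "w' \<in> carrier W"
      by (auto simp: DirProd_def)
    have "f v \<otimes>\<^bsub>U\<^esub> f v' \<otimes>\<^bsub>U\<^esub> (g w \<otimes>\<^bsub>U\<^esub> g w') = f v \<otimes>\<^bsub>U\<^esub> (f v' \<otimes>\<^bsub>U\<^esub> g w) \<otimes>\<^bsub>U\<^esub> g w'"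
      using vw fD gD by (simp add: U.m_assoc)
    also have "\<dots> = f v \<otimes>\<^bsub>U\<^esub> (g w \<otimes>\<^bsub>U\<^esub> f v') \<otimes>\<^bsub>U\<^esub> g w'"
      using vw comm by simp
    also have "\<dots> = (f v \<otimes>\<^bsub>U\<^esub> g w) \<otimes>\<^bsub>U\<^esub> (f v' \<otimes>\<^bsub>U\<^esub> g w')"
      using vw fD gD by (simp add: U.m_assoc)
    finally show "?b (x \<otimes>\<^bsub>V \<times>\<times> W\<^esub> y) = ?b x \<otimes>\<^bsub>U\<^esub> ?b y"
      using vw fD gD by (simp add: DirProd_def)
  qed (use fD gD in \<open>auto simp: DirProd_def\<close>)
  then have hom: "linear_extension U ?b \<in> algebra_homs (monoid_algebra (V \<times>\<times> W)) U"
    using fD gD by (intro linear_extension_hom[OF U monoid_DirProd]) (auto simp: DirProd_def)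
  have kills: "linear_extension U ?b x = \<zero>\<^bsub>U\<^esub>" if "x \<in> bilinearity V W" for x
    using that fD gD
    by (intro extension_bilinearity[OF U])
      (auto simp: U.l_distr U.r_distr U.smult_mult_left U.smult_mult_right)
  show ?thesis
    unfolding tensor_lift_def[abs_def] tensor_algebra_def
    by (rule relation_ideal.quotient_algebra_hom[OF U hom kills])
qed

lemma tensor_lift_hom_pure:
  assumes U: "complex_algebra U" and f: "f \<in> algebra_homs V U" and g: "g \<in> algebra_homs W U"
    and "v \<in> carrier V" "w \<in> carrier W"
  shows "tensor_lift U (\<lambda>v w. f v \<otimes>\<^bsub>U\<^esub> g w) (pure v w) = f v \<otimes>\<^bsub>U\<^esub> g w"
proof -
  interpret U: complex_algebra U by (rule U)
  note fD = algebra_homsD[OF f] and gD = algebra_homsD[OF g]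
  show ?thesis
    using assms(4,5) fD gD
    by (intro tensor_lift_pure[OF U])
      (auto simp: U.l_distr U.r_distr U.smult_mult_left U.smult_mult_right)
qed

end

section \<open>Quantum SU(2)\<close>

(* Matrix indices are 1 and 2; they stay in this form, in which the definitions mention them. *)
declare One_nat_def [simp del]

text \<open>
  The relations of quantum \<open>SL\<^sub>2\<close>. A homomorphism from \<^const>\<open>A_SU\<close> is the same as a matrix \<open>u\<close> that satisfies
  them, the image of \<^const>\<open>u_matrix\<close>; compatibility with involutions is not asked for, which leaves room for
  representations by arbitrary operators.
\<close>

definition quantum_SL2 :: "'a calg \<Rightarrow> real \<Rightarrow> (nat \<Rightarrow> nat \<Rightarrow> 'a) \<Rightarrow> bool" where
  "quantum_SL2 U q u \<longleftrightarrow>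
     u 1 1 \<in> carrier U \<and> u 1 2 \<in> carrier U \<and> u 2 1 \<in> carrier U \<and> u 2 2 \<in> carrier U \<and>
     u 1 1 \<otimes>\<^bsub>U\<^esub> u 1 2 = of_real q \<odot>\<^bsub>U\<^esub> (u 1 2 \<otimes>\<^bsub>U\<^esub> u 1 1) \<and>
     u 1 1 \<otimes>\<^bsub>U\<^esub> u 2 1 = of_real q \<odot>\<^bsub>U\<^esub> (u 2 1 \<otimes>\<^bsub>U\<^esub> u 1 1) \<and>
     u 1 2 \<otimes>\<^bsub>U\<^esub> u 2 2 = of_real q \<odot>\<^bsub>U\<^esub> (u 2 2 \<otimes>\<^bsub>U\<^esub> u 1 2) \<and>
     u 2 1 \<otimes>\<^bsub>U\<^esub> u 2 2 = of_real q \<odot>\<^bsub>U\<^esub> (u 2 2 \<otimes>\<^bsub>U\<^esub> u 2 1) \<and>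
     u 2 1 \<otimes>\<^bsub>U\<^esub> u 1 2 = u 1 2 \<otimes>\<^bsub>U\<^esub> u 2 1 \<and>
     u 1 1 \<otimes>\<^bsub>U\<^esub> u 2 2 = of_real q \<odot>\<^bsub>U\<^esub> (u 1 2 \<otimes>\<^bsub>U\<^esub> u 2 1) \<oplus>\<^bsub>U\<^esub> \<one>\<^bsub>U\<^esub> \<and>
     u 2 2 \<otimes>\<^bsub>U\<^esub> u 1 1 = of_real (inverse q) \<odot>\<^bsub>U\<^esub> (u 1 2 \<otimes>\<^bsub>U\<^esub> u 2 1) \<oplus>\<^bsub>U\<^esub> \<one>\<^bsub>U\<^esub>"

definition q_epsilon :: "real \<Rightarrow> nat \<Rightarrow> nat \<Rightarrow> complex" where
  "q_epsilon q i j = (if i = 1 \<and> j = 2 then 1 else if i = 2 \<and> j = 1 then - of_real q else 0)"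

text \<open>
  The same relations in the form \<open>u E u\<^sup>t = E\<close>, \<open>u\<^sup>t E u = E\<close> for a \<open>q\<close>-deformed symplectic form \<open>E\<close>, written without
  inverses. All relations then have one shape, and they visibly pass to products of matrices.
\<close>

definition q_bilinear :: "'a calg \<Rightarrow> real \<Rightarrow> (nat \<Rightarrow> nat \<Rightarrow> 'a) \<Rightarrow> bool" where
  "q_bilinear U q u \<longleftrightarrow> (\<forall>i\<in>{1,2}. \<forall>j\<in>{1,2}. u i j \<in> carrier U \<and>
     u i 1 \<otimes>\<^bsub>U\<^esub> u j 2 = of_real q \<odot>\<^bsub>U\<^esub> (u i 2 \<otimes>\<^bsub>U\<^esub> u j 1) \<oplus>\<^bsub>U\<^esub> q_epsilon q i j \<odot>\<^bsub>U\<^esub> \<one>\<^bsub>U\<^esub> \<and>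
     u 1 i \<otimes>\<^bsub>U\<^esub> u 2 j = of_real q \<odot>\<^bsub>U\<^esub> (u 2 i \<otimes>\<^bsub>U\<^esub> u 1 j) \<oplus>\<^bsub>U\<^esub> q_epsilon q i j \<odot>\<^bsub>U\<^esub> \<one>\<^bsub>U\<^esub>)"

context complex_algebra
begin

lemma smult_cancel:
  assumes "c \<noteq> 0" "x \<in> carrier A" "y \<in> carrier A" "c \<odot> x = c \<odot> y"
  shows "x = y"
proof -
  have "inverse c \<odot> (c \<odot> x) = inverse c \<odot> (c \<odot> y)" using assms by simp
  then show ?thesis using assms(1-3) by (simp add: smult_smult)
qed

lemma add_minus_smult:
  assumes "x \<in> carrier A" "y \<in> carrier A"
  shows "c \<odot> x \<oplus> ((- c) \<odot> x \<oplus> y) = y"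
proof -
  have "c \<odot> x \<oplus> ((- c) \<odot> x \<oplus> y) = (c + - c) \<odot> x \<oplus> y"
    using assms by (simp only: smult_l_distr smult_closed a_assoc)
  then show ?thesis using assms by simp
qed

lemma quantum_SL2_iff_bilinear:
  assumes q: "q \<noteq> 0"
  shows "quantum_SL2 A q u \<longleftrightarrow> q_bilinear A q u"
proof (cases "u 1 1 \<in> carrier A \<and> u 1 2 \<in> carrier A \<and> u 2 1 \<in> carrier A \<and> u 2 2 \<in> carrier A")
  case True
  let ?Q = "complex_of_real q"
  have u: "u 1 1 \<in> carrier A" "u 1 2 \<in> carrier A" "u 2 1 \<in> carrier A" "u 2 2 \<in> carrier A"
    using True by auto
  have Q: "?Q \<noteq> 0" using q by simp
  have comm: "u 2 1 \<otimes> u 1 2 = u 1 2 \<otimes> u 2 1"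
    if "?Q \<odot> (u 1 2 \<otimes> u 2 1) \<oplus> \<one> = ?Q \<odot> (u 2 1 \<otimes> u 1 2) \<oplus> \<one>"
  proof -
    have "?Q \<odot> (u 2 1 \<otimes> u 1 2) = ?Q \<odot> (u 1 2 \<otimes> u 2 1)"
      using that u add.right_cancel[of \<one>] by simp
    from smult_cancel[OF Q _ _ this] show ?thesis using u by simp
  qed
  have da: "u 2 2 \<otimes> u 1 1 = of_real (inverse q) \<odot> x \<oplus> \<one> \<longleftrightarrow> x = ?Q \<odot> (u 2 2 \<otimes> u 1 1) \<oplus> (- ?Q) \<odot> \<one>"
    if x: "x \<in> carrier A" for x
  proof
    assume "u 2 2 \<otimes> u 1 1 = of_real (inverse q) \<odot> x \<oplus> \<one>"
    then have "?Q \<odot> (u 2 2 \<otimes> u 1 1) \<oplus> (- ?Q) \<odot> \<one> = (x \<oplus> ?Q \<odot> \<one>) \<oplus> (- ?Q) \<odot> \<one>"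
      using x q by (simp add: smult_r_distr smult_smult flip: of_real_mult)
    also have "\<dots> = x \<oplus> (?Q + - ?Q) \<odot> \<one>"
      using x by (simp only: smult_l_distr smult_closed a_assoc one_closed)
    finally show "x = ?Q \<odot> (u 2 2 \<otimes> u 1 1) \<oplus> (- ?Q) \<odot> \<one>" using x by simp
  next
    assume eq: "x = ?Q \<odot> (u 2 2 \<otimes> u 1 1) \<oplus> (- ?Q) \<odot> \<one>"
    have "of_real (inverse q) \<odot> x = u 2 2 \<otimes> u 1 1 \<oplus> (- 1) \<odot> \<one>"
      unfolding eq using u q by (simp add: smult_r_distr smult_smult)
    then have "of_real (inverse q) \<odot> x \<oplus> \<one> = u 2 2 \<otimes> u 1 1 \<oplus> ((- 1) \<odot> \<one> \<oplus> 1 \<odot> \<one>)"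
      using u by (simp add: a_assoc)
    also have "\<dots> = u 2 2 \<otimes> u 1 1" using u by (simp add: minus_one_smult l_neg)
    finally show "u 2 2 \<otimes> u 1 1 = of_real (inverse q) \<odot> x \<oplus> \<one>" by simp
  qed
  show ?thesis
  proof
    assume "quantum_SL2 A q u"
    then show "q_bilinear A q u"
      using u da[of "u 1 2 \<otimes> u 2 1"] unfolding quantum_SL2_def q_bilinear_def q_epsilon_def by auto
  next
    assume *: "q_bilinear A q u"
    then have "?Q \<odot> (u 1 2 \<otimes> u 2 1) \<oplus> \<one> = ?Q \<odot> (u 2 1 \<otimes> u 1 2) \<oplus> \<one>"
      unfolding q_bilinear_def q_epsilon_def by force
    from comm[OF this] * show "quantum_SL2 A q u"
      using u da[of "u 1 2 \<otimes> u 2 1"] unfolding quantum_SL2_def q_bilinear_def q_epsilon_def by auto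
  qed
qed (auto simp: quantum_SL2_def q_bilinear_def)

lemma sum_of_four:
  assumes "z1 \<in> carrier A" "z2 \<in> carrier A" "z3 \<in> carrier A" "z4 \<in> carrier A" "w2 \<in> carrier A" "w3 \<in> carrier A"
  shows "(c \<odot> z1 \<oplus> (c \<odot> z2 \<oplus> w2)) \<oplus> ((c \<odot> z3 \<oplus> w3) \<oplus> c \<odot> z4) =
    c \<odot> ((z1 \<oplus> z2) \<oplus> (z3 \<oplus> z4)) \<oplus> (w2 \<oplus> w3)"
  using assms by (simp add: smult_r_distr a_ac)

end

definition SU_assignment :: "'a calg \<Rightarrow> real \<Rightarrow> (nat \<Rightarrow> nat \<Rightarrow> 'a) \<Rightarrow> su_generator \<Rightarrow> 'a" where
  "SU_assignment U q u g = (case g of Alpha \<Rightarrow> u 1 1 | Gamma \<Rightarrow> u 2 1 | Alpha_bar \<Rightarrow> u 2 2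
     | Gamma_bar \<Rightarrow> of_real (- inverse q) \<odot>\<^bsub>U\<^esub> u 1 2)"

lemma SU_assignment_simps [simp]:
  "SU_assignment U q u Alpha = u 1 1" "SU_assignment U q u Gamma = u 2 1" "SU_assignment U q u Alpha_bar = u 2 2"
  "SU_assignment U q u Gamma_bar = of_real (- inverse q) \<odot>\<^bsub>U\<^esub> u 1 2"
  by (simp_all add: SU_assignment_def)

lemma presentation_SU: "presentation UNIV (SU_relations q)"
  by unfold_locales (auto simp: carrier_free_algebra)

lemma complex_algebra_SU: "complex_algebra (A_SU q)"
  unfolding A_SU_def by (rule presentation.complex_algebra_presented[OF presentation_SU])

lemma su_gen_closed [simp]: "su_gen q g \<in> carrier (A_SU q)"
  unfolding A_SU_def su_gen_def by (simp add: presentation.generator_closed[OF presentation_SU])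

context complex_algebra
begin

context
  fixes f :: "'g \<Rightarrow> 'a"
  assumes f: "\<And>g. f g \<in> carrier A"
begin

lemma word_Pi: "word_value A f \<in> UNIV \<rightarrow> carrier A"
  using word_value_closed[of f UNIV] f by (auto simp: lists_UNIV)

lemmas relation_value = linear_extension_add[OF subset_UNIV subset_UNIV word_Pi]
  linear_extension_diff[OF subset_UNIV subset_UNIV word_Pi]

lemma single_value: "linear_extension A (word_value A f) (Poly_Mapping.single w c) = c \<odot> word_value A f w"
  using word_Pi by (intro linear_extension_single) auto

end

lemma diff_eq_zero: 
  assumes "x \<in> carrier A" "y \<in> carrier A"
  shows "x \<ominus> y = \<zero> \<longleftrightarrow> x = y"
proof
  note * = assms
  assume "x \<ominus> y = \<zero>"
  moreover have "x = (x \<ominus> y) \<oplus> y" using * by (simp add: a_minus_def a_assoc l_neg)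
  ultimately show "x = y" using * by simp
qed (use assms in \<open>simp add: a_minus_def r_neg\<close>)

text \<open>
  The generator \<open>Gamma_bar\<close> is \<open>- q\<^sup>-\<^sup>1 u\<^sub>1\<^sub>2\<close>; with this translation each relation of \<^const>\<open>A_SU\<close> is one of the
  relations between the entries of \<open>u\<close>.
\<close>

lemma SU_relations_hold:
  assumes q: "q \<noteq> 0" and u: "quantum_SL2 A q u" and r: "r \<in> SU_relations q"
  shows "linear_extension A (word_value A (SU_assignment A q u)) r = \<zero>"
proof -
  let ?t = "- inverse (complex_of_real q)"
  note eqs = u[unfolded quantum_SL2_def]
  have c: "u 1 1 \<in> carrier A" "u 1 2 \<in> carrier A" "u 2 1 \<in> carrier A" "u 2 2 \<in> carrier A"
    using eqs by auto
  have f: "SU_assignment A q u g \<in> carrier A" for g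
    using c by (cases g) auto
  have tq: "?t * complex_of_real q = -1" "?t + inverse (complex_of_real q) = 0"
     "(complex_of_real q)\<^sup>2 * ?t = - complex_of_real q"
    using q by (auto simp: power2_eq_square)
  have bc: "x \<in> carrier A \<Longrightarrow> y \<in> carrier A \<Longrightarrow> (s \<odot> x \<oplus> y) \<oplus> (- s) \<odot> x = y" for s x y
    using add_minus_smult[of x y "-s"] by (simp add: a_comm)
  note [simp] = relation_value[OF f] single_value[OF f] c smult_mult_left smult_mult_right smult_smult diff_eq_zero
  from r consider "r = Poly_Mapping.single [Alpha, Gamma] 1 - Poly_Mapping.single [Gamma, Alpha] (complex_of_real q)"
    | "r = Poly_Mapping.single [Gamma_bar, Alpha_bar] 1 - Poly_Mapping.single [Alpha_bar, Gamma_bar] (complex_of_real q)"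
    | "r = Poly_Mapping.single [Alpha, Gamma_bar] 1 - Poly_Mapping.single [Gamma_bar, Alpha] (complex_of_real q)"
    | "r = Poly_Mapping.single [Gamma, Alpha_bar] 1 - Poly_Mapping.single [Alpha_bar, Gamma] (complex_of_real q)"
    | "r = Poly_Mapping.single [Gamma, Gamma_bar] 1 - Poly_Mapping.single [Gamma_bar, Gamma] 1"
    | "r = Poly_Mapping.single [Alpha, Alpha_bar] 1 + Poly_Mapping.single [Gamma_bar, Gamma] (complex_of_real (q\<^sup>2))
        - Poly_Mapping.single [] 1"
    | "r = Poly_Mapping.single [Alpha_bar, Alpha] 1 + Poly_Mapping.single [Gamma_bar, Gamma] 1
        - Poly_Mapping.single [] 1"
    unfolding SU_relations_def Let_def of_real_1 by blast
  then show ?thesis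
  proof cases
    case 1 then show ?thesis using eqs by simp
  next
    case 2 then show ?thesis using eqs by (simp add: mult.commute)
  next
    case 3 then show ?thesis using eqs by (simp add: mult.commute)
  next
    case 4 then show ?thesis using eqs by simp
  next
    case 5 then show ?thesis using eqs by simp
  next
    case 6 then show ?thesis using eqs tq bc by simp
  next
    case 7 then show ?thesis using eqs bc by simp
  qed
qed

end

lemma
  assumes q: "q \<noteq> 0" and U: "complex_algebra U" and u: "quantum_SL2 U q u"
  shows SU_hom: "induced_hom U (SU_assignment U q u) \<in> algebra_homs (A_SU q) U"
    and SU_hom_gen: "induced_hom U (SU_assignment U q u) (su_gen q g) = SU_assignment U q u g"
proof -
  interpret complex_algebra U by fact
  have "SU_assignment U q u \<in> UNIV \<rightarrow> carrier U"
    using u by (auto simp: quantum_SL2_def SU_assignment_def split: su_generator.split)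
  note * = this SU_relations_hold[OF q u]
  show "induced_hom U (SU_assignment U q u) \<in> algebra_homs (A_SU q) U"
    unfolding A_SU_def by (rule presentation.induced_hom[OF presentation_SU U *])
  show "induced_hom U (SU_assignment U q u) (su_gen q g) = SU_assignment U q u g"
    unfolding su_gen_def by (rule presentation.induced_hom_generator[OF presentation_SU U * UNIV_I])
qed

lemma u_matrix_simps [simp]:
  "u_matrix q 1 1 = su_gen q Alpha" "u_matrix q 1 2 = of_real (- q) \<odot>\<^bsub>A_SU q\<^esub> su_gen q Gamma_bar"
  "u_matrix q 2 1 = su_gen q Gamma" "u_matrix q 2 2 = su_gen q Alpha_bar"
  by (simp_all add: u_matrix_def)

lemma SU_hom_u_matrix:
  assumes q: "q \<noteq> 0" and U: "complex_algebra U" and u: "quantum_SL2 U q u" and ij: "i \<in> {1,2}" "j \<in> {1,2}"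
  shows "induced_hom U (SU_assignment U q u) (u_matrix q i j) = u i j"
proof -
  interpret complex_algebra U by fact
  show ?thesis
    using ij u SU_hom_gen[OF q U u] algebra_homsD(4)[OF SU_hom[OF q U u]] q
    by (auto simp: smult_smult quantum_SL2_def simp flip: of_real_mult simp del: One_nat_def)
qed

lemma quantum_SL2_u_matrix:
  assumes q: "q \<noteq> 0"
  shows "quantum_SL2 (A_SU q) q (u_matrix q)"
proof -
  interpret H: complex_algebra "A_SU q" by (rule complex_algebra_SU)
  let ?g = "su_gen q"
  note [simp] = H.relation_value[of ?g] H.single_value[of ?g] H.smult_mult_left H.smult_mult_right H.smult_smult
    H.diff_eq_zero
  let ?Q = "complex_of_real q"
  have Q: "?Q \<noteq> 0" using q by simp
  note rel = presentation.relation_holds[OF presentation_SU[of q], folded A_SU_def su_gen_def]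
  have "?g Alpha \<otimes>\<^bsub>A_SU q\<^esub> ?g Gamma = ?Q \<odot>\<^bsub>A_SU q\<^esub> (?g Gamma \<otimes>\<^bsub>A_SU q\<^esub> ?g Alpha)"
    using rel[of "Poly_Mapping.single [Alpha, Gamma] 1 - Poly_Mapping.single [Gamma, Alpha] ?Q"]
    by (simp add: SU_relations_def)
  moreover have "?g Gamma_bar \<otimes>\<^bsub>A_SU q\<^esub> ?g Alpha_bar = ?Q \<odot>\<^bsub>A_SU q\<^esub> (?g Alpha_bar \<otimes>\<^bsub>A_SU q\<^esub> ?g Gamma_bar)"
    using rel[of "Poly_Mapping.single [Gamma_bar, Alpha_bar] 1 - Poly_Mapping.single [Alpha_bar, Gamma_bar] ?Q"]
    by (simp add: SU_relations_def)
  moreover have "?g Alpha \<otimes>\<^bsub>A_SU q\<^esub> ?g Gamma_bar = ?Q \<odot>\<^bsub>A_SU q\<^esub> (?g Gamma_bar \<otimes>\<^bsub>A_SU q\<^esub> ?g Alpha)"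
    using rel[of "Poly_Mapping.single [Alpha, Gamma_bar] 1 - Poly_Mapping.single [Gamma_bar, Alpha] ?Q"]
    by (simp add: SU_relations_def)
  moreover have "?g Gamma \<otimes>\<^bsub>A_SU q\<^esub> ?g Alpha_bar = ?Q \<odot>\<^bsub>A_SU q\<^esub> (?g Alpha_bar \<otimes>\<^bsub>A_SU q\<^esub> ?g Gamma)"
    using rel[of "Poly_Mapping.single [Gamma, Alpha_bar] 1 - Poly_Mapping.single [Alpha_bar, Gamma] ?Q"]
    by (simp add: SU_relations_def)
  moreover have "?g Gamma \<otimes>\<^bsub>A_SU q\<^esub> ?g Gamma_bar = ?g Gamma_bar \<otimes>\<^bsub>A_SU q\<^esub> ?g Gamma"
    using rel[of "Poly_Mapping.single [Gamma, Gamma_bar] 1 - Poly_Mapping.single [Gamma_bar, Gamma] 1"]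
    by (simp add: SU_relations_def)
  moreover have "?g Alpha \<otimes>\<^bsub>A_SU q\<^esub> ?g Alpha_bar =
      (- (?Q\<^sup>2)) \<odot>\<^bsub>A_SU q\<^esub> (?g Gamma_bar \<otimes>\<^bsub>A_SU q\<^esub> ?g Gamma) \<oplus>\<^bsub>A_SU q\<^esub> \<one>\<^bsub>A_SU q\<^esub>"
  proof -
    have "?g Alpha \<otimes>\<^bsub>A_SU q\<^esub> ?g Alpha_bar \<oplus>\<^bsub>A_SU q\<^esub>
        ?Q\<^sup>2 \<odot>\<^bsub>A_SU q\<^esub> (?g Gamma_bar \<otimes>\<^bsub>A_SU q\<^esub> ?g Gamma) = \<one>\<^bsub>A_SU q\<^esub>"
      using rel[of "Poly_Mapping.single [Alpha, Alpha_bar] 1 + Poly_Mapping.single [Gamma_bar, Gamma] (?Q\<^sup>2)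
        - Poly_Mapping.single [] 1"]
      by (simp add: SU_relations_def)
    then show ?thesis
      using H.add_minus_smult[of "?g Gamma_bar \<otimes>\<^bsub>A_SU q\<^esub> ?g Gamma" "?g Alpha \<otimes>\<^bsub>A_SU q\<^esub> ?g Alpha_bar" "- (?Q\<^sup>2)"]
      by (simp add: H.a_comm)
  qed
  moreover have "?g Alpha_bar \<otimes>\<^bsub>A_SU q\<^esub> ?g Alpha =
      (- 1) \<odot>\<^bsub>A_SU q\<^esub> (?g Gamma_bar \<otimes>\<^bsub>A_SU q\<^esub> ?g Gamma) \<oplus>\<^bsub>A_SU q\<^esub> \<one>\<^bsub>A_SU q\<^esub>"
  proof -
    have "?g Alpha_bar \<otimes>\<^bsub>A_SU q\<^esub> ?g Alpha \<oplus>\<^bsub>A_SU q\<^esub>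
        (?g Gamma_bar \<otimes>\<^bsub>A_SU q\<^esub> ?g Gamma) = \<one>\<^bsub>A_SU q\<^esub>"
      using rel[of "Poly_Mapping.single [Alpha_bar, Alpha] 1 + Poly_Mapping.single [Gamma_bar, Gamma] 1
        - Poly_Mapping.single [] 1"]
      by (simp add: SU_relations_def)
    then show ?thesis
      using H.add_minus_smult[of "?g Gamma_bar \<otimes>\<^bsub>A_SU q\<^esub> ?g Gamma" "?g Alpha_bar \<otimes>\<^bsub>A_SU q\<^esub> ?g Alpha" "- 1"]
      by (simp add: H.a_comm)
  qed
  ultimately show ?thesis
    unfolding quantum_SL2_def u_matrix_simps using Q
    by (simp add: power2_eq_square)
qed


lemma (in tensor_product) pure_sum_mult:
  assumes "a \<in> carrier V" "a' \<in> carrier V" "c \<in> carrier V" "c' \<in> carrier V"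
    "b \<in> carrier W" "b' \<in> carrier W" "d \<in> carrier W" "d' \<in> carrier W"
  shows "(pure a b \<oplus>\<^bsub>tensor_algebra V W\<^esub> pure a' b') \<otimes>\<^bsub>tensor_algebra V W\<^esub>
      (pure c d \<oplus>\<^bsub>tensor_algebra V W\<^esub> pure c' d') =
    (pure (a \<otimes>\<^bsub>V\<^esub> c) (b \<otimes>\<^bsub>W\<^esub> d) \<oplus>\<^bsub>tensor_algebra V W\<^esub> pure (a \<otimes>\<^bsub>V\<^esub> c') (b \<otimes>\<^bsub>W\<^esub> d')) \<oplus>\<^bsub>tensor_algebra V W\<^esub>
    (pure (a' \<otimes>\<^bsub>V\<^esub> c) (b' \<otimes>\<^bsub>W\<^esub> d) \<oplus>\<^bsub>tensor_algebra V W\<^esub> pure (a' \<otimes>\<^bsub>V\<^esub> c') (b' \<otimes>\<^bsub>W\<^esub> d'))"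
  using assms by (simp add: tensor.l_distr tensor.r_distr pure_mult tensor.a_ac)

text \<open>
  If two matrices preserve a bilinear form, so does their product: in each sum of four products the relation
  of the inner factor is used first and what remains is the relation of the outer factor. Applied to
  \<^const>\<open>u_matrix\<close> this says that the comultiplication of \<^const>\<open>A_SU\<close> is well defined.
\<close>

lemma (in tensor_product) q_bilinear_coproduct:
  assumes u: "q_bilinear V q u" and w: "q_bilinear W q w"
  shows "q_bilinear (tensor_algebra V W) q
    (\<lambda>i j. pure (u i 1) (w 1 j) \<oplus>\<^bsub>tensor_algebra V W\<^esub> pure (u i 2) (w 2 j))"
proof -
  let ?T = "tensor_algebra V W" and ?Q = "complex_of_real q"
  note uD = u[unfolded q_bilinear_def, rule_format] and wD = w[unfolded q_bilinear_def, rule_format]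
  have row: "w i 1 \<otimes>\<^bsub>W\<^esub> w j 2 = ?Q \<odot>\<^bsub>W\<^esub> (w i 2 \<otimes>\<^bsub>W\<^esub> w j 1) \<oplus>\<^bsub>W\<^esub> q_epsilon q i j \<odot>\<^bsub>W\<^esub> \<one>\<^bsub>W\<^esub>"
      "u i 1 \<otimes>\<^bsub>V\<^esub> u j 2 = ?Q \<odot>\<^bsub>V\<^esub> (u i 2 \<otimes>\<^bsub>V\<^esub> u j 1) \<oplus>\<^bsub>V\<^esub> q_epsilon q i j \<odot>\<^bsub>V\<^esub> \<one>\<^bsub>V\<^esub>"
    and column: "w 1 i \<otimes>\<^bsub>W\<^esub> w 2 j = ?Q \<odot>\<^bsub>W\<^esub> (w 2 i \<otimes>\<^bsub>W\<^esub> w 1 j) \<oplus>\<^bsub>W\<^esub> q_epsilon q i j \<odot>\<^bsub>W\<^esub> \<one>\<^bsub>W\<^esub>"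
      "u 1 i \<otimes>\<^bsub>V\<^esub> u 2 j = ?Q \<odot>\<^bsub>V\<^esub> (u 2 i \<otimes>\<^bsub>V\<^esub> u 1 j) \<oplus>\<^bsub>V\<^esub> q_epsilon q i j \<odot>\<^bsub>V\<^esub> \<one>\<^bsub>V\<^esub>"
    if "i \<in> {1, 2}" "j \<in> {1, 2}" for i j
    using uD wD that by blast+
  have uc: "u i j \<in> carrier V" and wc: "w i j \<in> carrier W" if "i \<in> {1, 2}" "j \<in> {1, 2}" for i j
    using uD wD that by blast+
  have [simp]: "u 1 1 \<in> carrier V" "u 1 2 \<in> carrier V" "u 2 1 \<in> carrier V" "u 2 2 \<in> carrier V"
     "w 1 1 \<in> carrier W" "w 1 2 \<in> carrier W" "w 2 1 \<in> carrier W" "w 2 2 \<in> carrier W"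
    by (rule uc wc; simp)+
  have e [simp]: "q_epsilon q 1 1 = 0" "q_epsilon q 2 2 = 0" "q_epsilon q 1 2 = 1" "q_epsilon q 2 1 = - ?Q"
    by (simp_all add: q_epsilon_def)
  have w_row: "w 1 1 \<otimes>\<^bsub>W\<^esub> w 1 2 = ?Q \<odot>\<^bsub>W\<^esub> (w 1 2 \<otimes>\<^bsub>W\<^esub> w 1 1)"
      "w 1 1 \<otimes>\<^bsub>W\<^esub> w 2 2 = ?Q \<odot>\<^bsub>W\<^esub> (w 1 2 \<otimes>\<^bsub>W\<^esub> w 2 1) \<oplus>\<^bsub>W\<^esub> \<one>\<^bsub>W\<^esub>"
      "w 2 1 \<otimes>\<^bsub>W\<^esub> w 1 2 = ?Q \<odot>\<^bsub>W\<^esub> (w 2 2 \<otimes>\<^bsub>W\<^esub> w 1 1) \<oplus>\<^bsub>W\<^esub> (- ?Q) \<odot>\<^bsub>W\<^esub> \<one>\<^bsub>W\<^esub>"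
      "w 2 1 \<otimes>\<^bsub>W\<^esub> w 2 2 = ?Q \<odot>\<^bsub>W\<^esub> (w 2 2 \<otimes>\<^bsub>W\<^esub> w 2 1)"
    by (simp_all add: row)
  have u_column: "u 1 1 \<otimes>\<^bsub>V\<^esub> u 2 1 = ?Q \<odot>\<^bsub>V\<^esub> (u 2 1 \<otimes>\<^bsub>V\<^esub> u 1 1)"
      "u 1 1 \<otimes>\<^bsub>V\<^esub> u 2 2 = ?Q \<odot>\<^bsub>V\<^esub> (u 2 1 \<otimes>\<^bsub>V\<^esub> u 1 2) \<oplus>\<^bsub>V\<^esub> \<one>\<^bsub>V\<^esub>"
      "u 1 2 \<otimes>\<^bsub>V\<^esub> u 2 1 = ?Q \<odot>\<^bsub>V\<^esub> (u 2 2 \<otimes>\<^bsub>V\<^esub> u 1 1) \<oplus>\<^bsub>V\<^esub> (- ?Q) \<odot>\<^bsub>V\<^esub> \<one>\<^bsub>V\<^esub>"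
      "u 1 2 \<otimes>\<^bsub>V\<^esub> u 2 2 = ?Q \<odot>\<^bsub>V\<^esub> (u 2 2 \<otimes>\<^bsub>V\<^esub> u 1 2)"
    by (simp_all add: column)
  note [simp] = pure_sum_mult pure_add_left pure_add_right pure_smult_left pure_smult_right
     tensor.smult_smult
  show ?thesis
    unfolding q_bilinear_def
  proof (intro ballI conjI)
    fix i j :: nat assume ij: "i \<in> {1, 2}" "j \<in> {1, 2}"
    have [simp]: "u i 1 \<in> carrier V" "u i 2 \<in> carrier V" "u j 1 \<in> carrier V" "u j 2 \<in> carrier V"
       "w 1 i \<in> carrier W" "w 2 i \<in> carrier W" "w 1 j \<in> carrier W" "w 2 j \<in> carrier W"
      using ij by (auto intro: uc wc)
    show "pure (u i 1) (w 1 j) \<oplus>\<^bsub>?T\<^esub> pure (u i 2) (w 2 j) \<in> carrier ?T" by simp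
    let ?E = "q_epsilon q i j"
    have "(pure (u i 1) (w 1 1) \<oplus>\<^bsub>?T\<^esub> pure (u i 2) (w 2 1)) \<otimes>\<^bsub>?T\<^esub>
        (pure (u j 1) (w 1 2) \<oplus>\<^bsub>?T\<^esub> pure (u j 2) (w 2 2)) =
      ?Q \<odot>\<^bsub>?T\<^esub> ((pure (u i 1) (w 1 2) \<oplus>\<^bsub>?T\<^esub> pure (u i 2) (w 2 2)) \<otimes>\<^bsub>?T\<^esub>
        (pure (u j 1) (w 1 1) \<oplus>\<^bsub>?T\<^esub> pure (u j 2) (w 2 1))) \<oplus>\<^bsub>?T\<^esub>
      (pure (u i 1 \<otimes>\<^bsub>V\<^esub> u j 2) \<one>\<^bsub>W\<^esub> \<oplus>\<^bsub>?T\<^esub> (- ?Q) \<odot>\<^bsub>?T\<^esub> pure (u i 2 \<otimes>\<^bsub>V\<^esub> u j 1) \<one>\<^bsub>W\<^esub>)"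
      by (simp add: w_row tensor.sum_of_four)
    also have "pure (u i 1 \<otimes>\<^bsub>V\<^esub> u j 2) \<one>\<^bsub>W\<^esub> \<oplus>\<^bsub>?T\<^esub> (- ?Q) \<odot>\<^bsub>?T\<^esub> pure (u i 2 \<otimes>\<^bsub>V\<^esub> u j 1) \<one>\<^bsub>W\<^esub> =
        ?E \<odot>\<^bsub>?T\<^esub> \<one>\<^bsub>?T\<^esub>"
      using row(2)[OF ij] tensor.add_minus_smult[of "pure (u i 2 \<otimes>\<^bsub>V\<^esub> u j 1) \<one>\<^bsub>W\<^esub>" "?E \<odot>\<^bsub>?T\<^esub> \<one>\<^bsub>?T\<^esub>" ?Q]
      by (simp add: pure_one tensor.a_ac del: e)
    finally show "(pure (u i 1) (w 1 1) \<oplus>\<^bsub>?T\<^esub> pure (u i 2) (w 2 1)) \<otimes>\<^bsub>?T\<^esub>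
        (pure (u j 1) (w 1 2) \<oplus>\<^bsub>?T\<^esub> pure (u j 2) (w 2 2)) =
      ?Q \<odot>\<^bsub>?T\<^esub> ((pure (u i 1) (w 1 2) \<oplus>\<^bsub>?T\<^esub> pure (u i 2) (w 2 2)) \<otimes>\<^bsub>?T\<^esub>
        (pure (u j 1) (w 1 1) \<oplus>\<^bsub>?T\<^esub> pure (u j 2) (w 2 1))) \<oplus>\<^bsub>?T\<^esub> ?E \<odot>\<^bsub>?T\<^esub> \<one>\<^bsub>?T\<^esub>" .
    have "(pure (u 1 1) (w 1 i) \<oplus>\<^bsub>?T\<^esub> pure (u 1 2) (w 2 i)) \<otimes>\<^bsub>?T\<^esub>
        (pure (u 2 1) (w 1 j) \<oplus>\<^bsub>?T\<^esub> pure (u 2 2) (w 2 j)) =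
      ?Q \<odot>\<^bsub>?T\<^esub> ((pure (u 2 1) (w 1 i) \<oplus>\<^bsub>?T\<^esub> pure (u 2 2) (w 2 i)) \<otimes>\<^bsub>?T\<^esub>
        (pure (u 1 1) (w 1 j) \<oplus>\<^bsub>?T\<^esub> pure (u 1 2) (w 2 j))) \<oplus>\<^bsub>?T\<^esub>
      (pure \<one>\<^bsub>V\<^esub> (w 1 i \<otimes>\<^bsub>W\<^esub> w 2 j) \<oplus>\<^bsub>?T\<^esub> (- ?Q) \<odot>\<^bsub>?T\<^esub> pure \<one>\<^bsub>V\<^esub> (w 2 i \<otimes>\<^bsub>W\<^esub> w 1 j))"
      by (simp add: u_column tensor.sum_of_four)
    also have "pure \<one>\<^bsub>V\<^esub> (w 1 i \<otimes>\<^bsub>W\<^esub> w 2 j) \<oplus>\<^bsub>?T\<^esub> (- ?Q) \<odot>\<^bsub>?T\<^esub> pure \<one>\<^bsub>V\<^esub> (w 2 i \<otimes>\<^bsub>W\<^esub> w 1 j) =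
        ?E \<odot>\<^bsub>?T\<^esub> \<one>\<^bsub>?T\<^esub>"
      using column(1)[OF ij] tensor.add_minus_smult[of "pure \<one>\<^bsub>V\<^esub> (w 2 i \<otimes>\<^bsub>W\<^esub> w 1 j)" "?E \<odot>\<^bsub>?T\<^esub> \<one>\<^bsub>?T\<^esub>" ?Q]
      by (simp add: pure_one tensor.a_ac del: e)
    finally show "(pure (u 1 1) (w 1 i) \<oplus>\<^bsub>?T\<^esub> pure (u 1 2) (w 2 i)) \<otimes>\<^bsub>?T\<^esub>
        (pure (u 2 1) (w 1 j) \<oplus>\<^bsub>?T\<^esub> pure (u 2 2) (w 2 j)) =
      ?Q \<odot>\<^bsub>?T\<^esub> ((pure (u 2 1) (w 1 i) \<oplus>\<^bsub>?T\<^esub> pure (u 2 2) (w 2 i)) \<otimes>\<^bsub>?T\<^esub>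
        (pure (u 1 1) (w 1 j) \<oplus>\<^bsub>?T\<^esub> pure (u 1 2) (w 2 j))) \<oplus>\<^bsub>?T\<^esub> ?E \<odot>\<^bsub>?T\<^esub> \<one>\<^bsub>?T\<^esub>" .
  qed
qed

lemma tensor_product_SU: "tensor_product (A_SU q) (A_SU q)"
  by (intro tensor_product.intro complex_algebra_SU)

lemma SU_comult_hom:
  assumes q: "q \<noteq> 0"
  shows "SU_comult q \<in> algebra_homs (A_SU q) (tensor_algebra (A_SU q) (A_SU q))"
    and "i \<in> {1, 2} \<Longrightarrow> j \<in> {1, 2} \<Longrightarrow> SU_comult q (u_matrix q i j) =
      pure_tensor (A_SU q) (A_SU q) (u_matrix q i 1) (u_matrix q 1 j) \<oplus>\<^bsub>tensor_algebra (A_SU q) (A_SU q)\<^esub>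
      pure_tensor (A_SU q) (A_SU q) (u_matrix q i 2) (u_matrix q 2 j)"
proof -
  interpret tensor_product "A_SU q" "A_SU q" by (rule tensor_product_SU)
  let ?T = "tensor_algebra (A_SU q) (A_SU q)"
  let ?D = "\<lambda>i j. \<Oplus>\<^bsub>?T\<^esub>k\<in>{1..2}. pure (u_matrix q i k) (u_matrix q k j)"
  let ?P = "\<lambda>i j. pure (u_matrix q i 1) (u_matrix q 1 j) \<oplus>\<^bsub>?T\<^esub> pure (u_matrix q i 2) (u_matrix q 2 j)"
  have u: "q_bilinear (A_SU q) q (u_matrix q)"
    using quantum_SL2_u_matrix[OF q] by (simp add: V.quantum_SL2_iff_bilinear[OF q])
  have P: "quantum_SL2 ?T q ?P"
    using q_bilinear_coproduct[OF u u] tensor.quantum_SL2_iff_bilinear[OF q] by simp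
  have c: "u_matrix q i j \<in> carrier (A_SU q)" if "i \<in> {1, 2}" "j \<in> {1, 2}" for i j
    using u that unfolding q_bilinear_def by blast
  have D: "?D i j = ?P i j" if "i \<in> {1, 2}" "j \<in> {1, 2}" for i j
    using c that by (intro tensor.finsum_pair) auto
  have eq: "SU_comult q = induced_hom ?T (SU_assignment ?T q ?P)"
    unfolding SU_comult_def Let_def by (simp add: SU_assignment_def[abs_def] D del: One_nat_def)
  show "SU_comult q \<in> algebra_homs (A_SU q) ?T"
    unfolding eq by (rule SU_hom[OF q tensor.complex_algebra_axioms P])
  assume "i \<in> {1, 2}" "j \<in> {1, 2}"
  then show "SU_comult q (u_matrix q i j) = ?P i j"
    unfolding eq by (rule SU_hom_u_matrix[OF q tensor.complex_algebra_axioms P])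
qed

lemma complex_algebra_complex_numbers: "complex_algebra complex_numbers"
  by (intro complex_algebra.intro complex_algebra_axioms.intro ringI abelian_groupI monoidI)
    (auto simp: complex_numbers_def algebra_simps intro!: exI[of _ "- _"])

lemma complex_numbers_simps [simp]:
  "carrier complex_numbers = UNIV" "mult complex_numbers = (*)" "one complex_numbers = 1"
  "zero complex_numbers = 0" "add complex_numbers = (+)" "smult complex_numbers = (*)"
  by (simp_all add: complex_numbers_def)

lemma SU_counit_u_matrix:
  assumes q: "q \<noteq> 0" and ij: "i \<in> {1, 2}" "j \<in> {1, 2}"
  shows "SU_counit q (u_matrix q i j) = of_bool (i = j)"
proof -
  have "quantum_SL2 complex_numbers q (\<lambda>i j. of_bool (i = j))"
    by (simp add: quantum_SL2_def)
  from SU_hom_u_matrix[OF q complex_algebra_complex_numbers this ij] show ?thesis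
    by (simp add: SU_counit_def SU_assignment_def[abs_def])
qed

section \<open>Corner algebras of complex rings\<close>

text \<open>
  Concrete representations take values in rings with complex scalars. For an idempotent \<open>e\<close> the corner \<open>e R e\<close> is
  an algebra with unit \<open>e\<close>; this allows operators that live on a part of the underlying space to be multiplied
  with operators on the whole space.
\<close>

class complex_ring = real_algebra_1 +
  fixes cscale :: "complex \<Rightarrow> 'a \<Rightarrow> 'a" (infixr "*\<^sub>C" 75)
  assumes cscale_add_left: "(c + d) *\<^sub>C x = c *\<^sub>C x + d *\<^sub>C x"
    and cscale_add_right: "c *\<^sub>C (x + y) = c *\<^sub>C x + c *\<^sub>C y"
    and cscale_cscale: "c *\<^sub>C (d *\<^sub>C x) = (c * d) *\<^sub>C x"
    and cscale_mult_left: "(c *\<^sub>C x) * y = c *\<^sub>C (x * y)"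
    and cscale_mult_right: "x * (c *\<^sub>C y) = c *\<^sub>C (x * y)"
    and cscale_of_real: "complex_of_real r *\<^sub>C x = r *\<^sub>R x"

lemma cscale_one [simp]: "1 *\<^sub>C (x :: 'a::complex_ring) = x"
  using cscale_of_real[of 1 x] by simp

lemma cscale_zero [simp]: "0 *\<^sub>C (x :: 'a::complex_ring) = 0" "c *\<^sub>C (0 :: 'a::complex_ring) = 0"
  using cscale_of_real[of 0 x] cscale_add_right[of c "0 :: 'a" 0] by simp_all

instantiation complex :: complex_ring
begin

definition cscale_complex :: "complex \<Rightarrow> complex \<Rightarrow> complex" where
  "cscale_complex = (*)"

instance by standard (auto simp: cscale_complex_def algebra_simps scaleR_conv_of_real)

end

definition corner :: "'r::complex_ring \<Rightarrow> 'r calg" where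
  "corner e = \<lparr>carrier = {x. e * x = x \<and> x * e = x}, mult = (*), one = e, zero = 0, add = (+), smult = (*\<^sub>C)\<rparr>"

lemma corner_simps [simp]:
  "x \<in> carrier (corner e) \<longleftrightarrow> e * x = x \<and> x * e = x"
  "mult (corner e) = (*)" "one (corner e) = e" "zero (corner e) = 0" "add (corner e) = (+)"
  "smult (corner e) = (*\<^sub>C)"
  by (simp_all add: corner_def)

lemma complex_numbers_corner: "complex_numbers = corner 1"
  by (auto simp: complex_numbers_def corner_def cscale_complex_def)

lemma complex_algebra_corner:
  assumes "e * e = e"
  shows "complex_algebra (corner e)"
proof (intro complex_algebra.intro complex_algebra_axioms.intro ringI abelian_groupI monoidI)
  fix x assume "x \<in> carrier (corner e)"
  then show "\<exists>y\<in>carrier (corner e). y \<oplus>\<^bsub>corner e\<^esub> x = \<zero>\<^bsub>corner e\<^esub>"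
    by (intro bexI[of _ "- x"]) auto
next
  fix x y assume xy: "x \<in> carrier (corner e)" "y \<in> carrier (corner e)"
  then have "e * (x * y) = x * y" "x * y * e = x * y"
    using mult.assoc[of e x y] mult.assoc[of x y e] by simp_all
  then show "x \<otimes>\<^bsub>corner e\<^esub> y \<in> carrier (corner e)" by simp
qed (use assms in \<open>auto simp: algebra_simps cscale_add_left cscale_add_right cscale_cscale
    cscale_mult_left cscale_mult_right\<close>)

lemma corner_minus:
  assumes "e * e = e" "x \<in> carrier (corner e)" "y \<in> carrier (corner e)"
  shows "x \<ominus>\<^bsub>corner e\<^esub> y = x - y"
proof -
  interpret complex_algebra "corner e" by (rule complex_algebra_corner) fact
  have "\<ominus>\<^bsub>corner e\<^esub> y = - y"
    using assms by (intro minus_equality) auto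
  then show ?thesis by (simp add: a_minus_def)
qed

lemma quantum_SL2_corner:
  "quantum_SL2 (corner e) q u \<longleftrightarrow>
     (\<forall>i\<in>{1, 2}. \<forall>j\<in>{1, 2}. e * u i j = u i j \<and> u i j * e = u i j) \<and>
     u 1 1 * u 1 2 = q *\<^sub>R (u 1 2 * u 1 1) \<and> u 1 1 * u 2 1 = q *\<^sub>R (u 2 1 * u 1 1) \<and>
     u 1 2 * u 2 2 = q *\<^sub>R (u 2 2 * u 1 2) \<and> u 2 1 * u 2 2 = q *\<^sub>R (u 2 2 * u 2 1) \<and>
     u 2 1 * u 1 2 = u 1 2 * u 2 1 \<and>
     u 1 1 * u 2 2 = q *\<^sub>R (u 1 2 * u 2 1) + e \<and> u 2 2 * u 1 1 = inverse q *\<^sub>R (u 1 2 * u 2 1) + e"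
  unfolding quantum_SL2_def corner_simps cscale_of_real by auto

subsection \<open>Linear operators on functions\<close>

text \<open>
  All linear operators on the space of all functions on \<open>'i\<close>, without any condition of continuity.
\<close>

typedef 'i linop = "{X :: ('i \<Rightarrow> complex) \<Rightarrow> ('i \<Rightarrow> complex).
    (\<forall>f g. X (\<lambda>i. f i + g i) = (\<lambda>i. X f i + X g i)) \<and> (\<forall>c f. X (\<lambda>i. c * f i) = (\<lambda>i. c * X f i))}"
  morphisms apply_op Abs_linop
  by (rule exI[of _ "\<lambda>f. f"]) auto

setup_lifting type_definition_linop

lemma linop_eqI: "(\<And>f i. apply_op X f i = apply_op Y f i) \<Longrightarrow> X = Y"
  by (metis apply_op_inject ext)

lemma apply_op_add: "apply_op X (\<lambda>i. f i + g i) = (\<lambda>i. apply_op X f i + apply_op X g i)"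
  using apply_op[of X] by blast

lemma apply_op_scale: "apply_op X (\<lambda>i. c * f i) = (\<lambda>i. c * apply_op X f i)"
  using apply_op[of X] by blast

instantiation linop :: (type) complex_ring
begin

lift_definition zero_linop :: "'i linop" is "\<lambda>f i. 0" by auto
lift_definition one_linop :: "'i linop" is "\<lambda>f. f" by auto
lift_definition plus_linop :: "'i linop \<Rightarrow> 'i linop \<Rightarrow> 'i linop" is "\<lambda>X Y f i. X f i + Y f i"
  by (auto simp: fun_eq_iff algebra_simps)
lift_definition minus_linop :: "'i linop \<Rightarrow> 'i linop \<Rightarrow> 'i linop" is "\<lambda>X Y f i. X f i - Y f i"
  by (auto simp: fun_eq_iff algebra_simps)
lift_definition uminus_linop :: "'i linop \<Rightarrow> 'i linop" is "\<lambda>X f i. - X f i"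
  by (auto simp: fun_eq_iff algebra_simps)
lift_definition times_linop :: "'i linop \<Rightarrow> 'i linop \<Rightarrow> 'i linop" is "\<lambda>X Y f. X (Y f)" by auto
lift_definition scaleR_linop :: "real \<Rightarrow> 'i linop \<Rightarrow> 'i linop" is "\<lambda>r X f i. of_real r * X f i"
  by (auto simp: fun_eq_iff algebra_simps)
lift_definition cscale_linop :: "complex \<Rightarrow> 'i linop \<Rightarrow> 'i linop" is "\<lambda>r X f i. r * X f i"
  by (auto simp: fun_eq_iff algebra_simps)

instance
proof
  show "(0 :: 'i linop) \<noteq> 1"
  proof
    assume "(0 :: 'i linop) = 1"
    then have "apply_op (0 :: 'i linop) (\<lambda>_. 1) = apply_op 1 (\<lambda>_. 1)" by simp
    then show False by (simp add: zero_linop.rep_eq one_linop.rep_eq fun_eq_iff)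
  qed
qed (transfer; auto simp: fun_eq_iff algebra_simps)+

end

lemmas apply_op_simps [simp] = zero_linop.rep_eq one_linop.rep_eq plus_linop.rep_eq minus_linop.rep_eq
  uminus_linop.rep_eq times_linop.rep_eq scaleR_linop.rep_eq cscale_linop.rep_eq

section \<open>The quantum symplectic group\<close>

lemma linear_extension_sum:
  assumes "e * e = e" "f \<in> S \<rightarrow> carrier (corner e)" "\<And>i. i \<in> I \<Longrightarrow> Poly_Mapping.keys (g i) \<subseteq> S"
  shows "linear_extension (corner e) f (\<Sum>i\<in>I. g i) = (\<Sum>i\<in>I. linear_extension (corner e) f (g i))"
proof -
  interpret complex_algebra "corner e" by (rule complex_algebra_corner) fact
  have "linear_extension (corner e) f (\<Sum>i\<in>I. g i) = (\<Sum>i\<in>I. linear_extension (corner e) f (g i)) \<and>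
    Poly_Mapping.keys (\<Sum>i\<in>I. g i) \<subseteq> S"
    using assms(3)
  proof (induction I rule: infinite_finite_induct)
    case (insert i I)
    moreover have "Poly_Mapping.keys (g i + (\<Sum>i\<in>I. g i)) \<subseteq> S"
      by (rule subset_trans[OF keys_add]) (use insert in auto)
    ultimately show ?case using assms(2) by (simp add: linear_extension_add[of _ S])
  qed (use linear_extension_zero in simp_all)
  then show ?thesis by blast
qed

text \<open>The tensor squares \<open>T\<^sub>1 T\<^sub>2\<close> and \<open>T\<^sub>2 T\<^sub>1\<close> of a matrix over a ring, as matrices indexed by pairs.\<close>

definition square12 :: "(nat \<Rightarrow> nat \<Rightarrow> 'r::ring) \<Rightarrow> nat \<times> nat \<Rightarrow> nat \<times> nat \<Rightarrow> 'r" where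
  "square12 T r s = T (fst r) (fst s) * T (snd r) (snd s)"

definition square21 :: "(nat \<Rightarrow> nat \<Rightarrow> 'r::ring) \<Rightarrow> nat \<times> nat \<Rightarrow> nat \<times> nat \<Rightarrow> 'r" where
  "square21 T r s = T (snd r) (snd s) * T (fst r) (fst s)"

definition RTT_relations :: "real \<Rightarrow> (nat \<Rightarrow> nat \<Rightarrow> 'r::complex_ring) \<Rightarrow> bool" where
  "RTT_relations q T \<longleftrightarrow> (\<forall>r\<in>Sp_generators. \<forall>s\<in>Sp_generators.
     (\<Sum>t\<in>Sp_generators. R_matrix q r t *\<^sub>R square12 T t s) = (\<Sum>t\<in>Sp_generators. R_matrix q t s *\<^sub>R square21 T r t))"

text \<open>
  The relations \<open>T C T\<^sup>t = C\<close> and \<open>T\<^sup>t C\<^sup>-\<^sup>1 T = C\<^sup>-\<^sup>1\<close>, which are equivalent to \<open>T C T\<^sup>t C\<^sup>-\<^sup>1 = 1 = C T\<^sup>t C\<^sup>-\<^sup>1 T\<close> and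
  which, unlike these, are evidently stable under products of matrices with commuting entries.
\<close>

definition symplectic_relations :: "real \<Rightarrow> 'r \<Rightarrow> (nat \<Rightarrow> nat \<Rightarrow> 'r::complex_ring) \<Rightarrow> bool" where
  "symplectic_relations q e T \<longleftrightarrow> (\<forall>i\<in>{1..4}. \<forall>j\<in>{1..4}.
     (\<Sum>k\<in>{1..4}. \<Sum>l\<in>{1..4}. C_matrix q k l *\<^sub>R (T i k * T j l)) = C_matrix q i j *\<^sub>R e \<and>
     (\<Sum>k\<in>{1..4}. \<Sum>l\<in>{1..4}. C_inverse q k l *\<^sub>R (T k i * T l j)) = C_inverse q i j *\<^sub>R e)"

definition symplectic_matrix :: "real \<Rightarrow> 'r \<Rightarrow> (nat \<Rightarrow> nat \<Rightarrow> 'r::complex_ring) \<Rightarrow> bool" where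
  "symplectic_matrix q e T \<longleftrightarrow> e * e = e \<and> (\<forall>i\<in>{1..4}. \<forall>j\<in>{1..4}. e * T i j = T i j \<and> T i j * e = T i j) \<and>
     RTT_relations q T \<and> symplectic_relations q e T"

lemma keys_sum_subset: "(\<And>i. i \<in> I \<Longrightarrow> Poly_Mapping.keys (g i) \<subseteq> S) \<Longrightarrow> Poly_Mapping.keys (\<Sum>i\<in>I. g i) \<subseteq> S"
proof (induction I rule: infinite_finite_induct)
  case (insert i I)
  then show ?case
    using keys_add[of "g i" "\<Sum>i\<in>I. g i"] by (simp add: subset_trans[OF keys_add])
qed auto

definition RTT_word :: "real \<Rightarrow> nat \<times> nat \<Rightarrow> nat \<times> nat \<Rightarrow> (nat \<times> nat) list \<Rightarrow>\<^sub>0 complex" where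
  "RTT_word q r s = (\<Sum>a\<in>{1..4}. \<Sum>b\<in>{1..4}.
        Poly_Mapping.single [(a, fst s), (b, snd s)] (of_real (R_matrix q r (a, b))))
     - (\<Sum>a\<in>{1..4}. \<Sum>b\<in>{1..4}.
        Poly_Mapping.single [(snd r, b), (fst r, a)] (of_real (R_matrix q (a, b) s)))"

definition row_word :: "real \<Rightarrow> nat \<Rightarrow> nat \<Rightarrow> (nat \<times> nat) list \<Rightarrow>\<^sub>0 complex" where
  "row_word q i j = (\<Sum>k\<in>{1..4}. \<Sum>l\<in>{1..4}. \<Sum>m\<in>{1..4}.
        Poly_Mapping.single [(i, k), (m, l)] (of_real (C_matrix q k l * C_inverse q m j)))
     - Poly_Mapping.single [] (of_bool (i = j))"

definition column_word :: "real \<Rightarrow> nat \<Rightarrow> nat \<Rightarrow> (nat \<times> nat) list \<Rightarrow>\<^sub>0 complex" where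
  "column_word q i j = (\<Sum>k\<in>{1..4}. \<Sum>l\<in>{1..4}. \<Sum>m\<in>{1..4}.
        Poly_Mapping.single [(l, k), (m, j)] (of_real (C_matrix q i k * C_inverse q l m)))
     - Poly_Mapping.single [] (of_bool (i = j))"

lemma Sp_relations_cases:
  assumes "r \<in> Sp_relations q"
  obtains (RTT) s t where "s \<in> Sp_generators" "t \<in> Sp_generators" "r = RTT_word q s t"
  | (row) i j where "i \<in> {1..4}" "j \<in> {1..4}" "r = row_word q i j"
  | (column) i j where "i \<in> {1..4}" "j \<in> {1..4}" "r = column_word q i j"
proof -
  from assms consider i j k l where "i \<in> {1..4}" "j \<in> {1..4}" "k \<in> {1..4}" "l \<in> {1..4}" "r = RTT_word q (i, j) (k, l)"
    | i j where "i \<in> {1..4}" "j \<in> {1..4}" "r = row_word q i j"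
    | i j where "i \<in> {1..4}" "j \<in> {1..4}" "r = column_word q i j"
    unfolding Sp_relations_def RTT_word_def row_word_def column_word_def fst_conv snd_conv by blast
  then show ?thesis
  proof cases
    case 1 then show ?thesis by (intro RTT[of "(i, j)" "(k, l)"]) (auto simp: Sp_generators_def)
  next
    case 2 then show ?thesis by (rule row)
  next
    case 3 then show ?thesis by (rule column)
  qed
qed

lemma RTT_word_keys:
  assumes "r \<in> Sp_generators" "s \<in> Sp_generators"
  shows "Poly_Mapping.keys (\<Sum>a\<in>{1..4}. \<Sum>b\<in>{1..4}.
        Poly_Mapping.single [(a, fst s), (b, snd s)] (c a b :: complex)) \<subseteq> lists Sp_generators"
    and "Poly_Mapping.keys (\<Sum>a\<in>{1..4}. \<Sum>b\<in>{1..4}.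
        Poly_Mapping.single [(snd r, b), (fst r, a)] (c a b :: complex)) \<subseteq> lists Sp_generators"
  using assms by - (intro keys_sum_subset, simp add: Sp_generators_def mem_Times_iff)+

lemma symplectic_word_keys:
  assumes "i \<in> {1..4}"
  shows "Poly_Mapping.keys (\<Sum>k\<in>{1..4}. \<Sum>l\<in>{1..4}. \<Sum>m\<in>{1..4}.
        Poly_Mapping.single [(i, k), (m, l)] (c k l m :: complex)) \<subseteq> lists Sp_generators"
    and "Poly_Mapping.keys (\<Sum>k\<in>{1..4}. \<Sum>l\<in>{1..4}. \<Sum>m\<in>{1..4}.
        Poly_Mapping.single [(l, k), (m, i)] (c k l m :: complex)) \<subseteq> lists Sp_generators"
  using assms by - (intro keys_sum_subset, simp add: Sp_generators_def mem_Times_iff)+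

lemma presentation_Sp: "presentation Sp_generators (Sp_relations q)"
proof
  have d: "Poly_Mapping.keys (p - r) \<subseteq> lists Sp_generators"
    if "Poly_Mapping.keys p \<subseteq> lists Sp_generators" "Poly_Mapping.keys r \<subseteq> lists Sp_generators"
    for p r :: "(nat \<times> nat) list \<Rightarrow>\<^sub>0 complex"
    by (rule subset_trans[OF keys_diff]) (use that in simp)
  have one: "Poly_Mapping.keys (Poly_Mapping.single [] (c :: complex)) \<subseteq> lists Sp_generators" for c
    by simp
  show "Sp_relations q \<subseteq> carrier (free_algebra Sp_generators)"
  proof
    fix r assume "r \<in> Sp_relations q"
    then show "r \<in> carrier (free_algebra Sp_generators)"
      unfolding carrier_free_algebra
    proof (cases rule: Sp_relations_cases)
      case (RTT s t)
      then show "Poly_Mapping.keys r \<subseteq> lists Sp_generators"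
        unfolding RTT(3) RTT_word_def by (intro d RTT_word_keys)
    next
      case (row i j)
      then show "Poly_Mapping.keys r \<subseteq> lists Sp_generators"
        unfolding row(3) row_word_def by (intro d symplectic_word_keys one)
    next
      case (column i j)
      then show "Poly_Mapping.keys r \<subseteq> lists Sp_generators"
        unfolding column(3) column_word_def by (intro d symplectic_word_keys one)
    qed
  qed
qed

lemma complex_algebra_Sp: "complex_algebra (A_Sp q)"
  unfolding A_Sp_def by (rule presentation.complex_algebra_presented[OF presentation_Sp])


lemma T_gen_closed [simp]: "i \<in> {1..4} \<Longrightarrow> j \<in> {1..4} \<Longrightarrow> T_gen q i j \<in> carrier (A_Sp q)"
  unfolding A_Sp_def T_gen_def
  by (rule presentation.generator_closed[OF presentation_Sp]) (simp add: Sp_generators_def)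

context
  fixes q :: real and e :: "'r::complex_ring" and T
  assumes T: "symplectic_matrix q e T"
begin

abbreviation (input) "evaluate \<equiv> linear_extension (corner e) (word_value (corner e) (\<lambda>(i, j). T i j))"

lemma unit_idem: "e * e = e"
  using T by (simp add: symplectic_matrix_def)

lemma entry_corner: "x \<in> Sp_generators \<Longrightarrow> (case x of (i, j) \<Rightarrow> T i j) \<in> carrier (corner e)"
  using T by (auto simp: symplectic_matrix_def Sp_generators_def)

lemma word_Pi_corner: "word_value (corner e) (\<lambda>(i, j). T i j) \<in> lists Sp_generators \<rightarrow> carrier (corner e)"
  by (intro Pi_I complex_algebra.word_value_closed[OF complex_algebra_corner[OF unit_idem]] entry_corner)

lemma evaluate_sum: "(\<And>i. i \<in> I \<Longrightarrow> Poly_Mapping.keys (g i) \<subseteq> lists Sp_generators) \<Longrightarrow>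
    evaluate (\<Sum>i\<in>I. g i) = (\<Sum>i\<in>I. evaluate (g i))"
  by (rule linear_extension_sum[OF unit_idem word_Pi_corner])

lemma evaluate_pair:
  assumes "x \<in> Sp_generators" "y \<in> Sp_generators"
  shows "evaluate (Poly_Mapping.single [x, y] (complex_of_real c)) = c *\<^sub>R ((case x of (i, j) \<Rightarrow> T i j) * (case y of (i, j) \<Rightarrow> T i j))"
proof -
  have "word_value (corner e) (\<lambda>(i, j). T i j) [x, y] \<in> carrier (corner e)"
    using assms by (intro funcset_mem[OF word_Pi_corner]) simp
  then have "evaluate (Poly_Mapping.single [x, y] (complex_of_real c)) =
      c *\<^sub>R (word_value (corner e) (\<lambda>(i, j). T i j) [x, y])"
    by (subst complex_algebra.linear_extension_single[OF complex_algebra_corner[OF unit_idem]])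
      (simp_all add: cscale_of_real)
  then show ?thesis using entry_corner[OF assms(2)] by simp
qed

lemma evaluate_pairs:
  assumes "\<And>a b. a \<in> I \<Longrightarrow> b \<in> J \<Longrightarrow> f a b \<in> Sp_generators \<and> g a b \<in> Sp_generators"
  shows "evaluate (\<Sum>a\<in>I. \<Sum>b\<in>J. Poly_Mapping.single [f a b, g a b] (complex_of_real (h a b))) =
    (\<Sum>a\<in>I. \<Sum>b\<in>J. h a b *\<^sub>R ((case f a b of (i, j) \<Rightarrow> T i j) * (case g a b of (i, j) \<Rightarrow> T i j)))"
proof -
  have k: "Poly_Mapping.keys (Poly_Mapping.single [f a b, g a b] (complex_of_real (h a b))) \<subseteq> lists Sp_generators"
    if "a \<in> I" "b \<in> J" for a b
    using assms[OF that] by simp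
  have "evaluate (\<Sum>a\<in>I. \<Sum>b\<in>J. Poly_Mapping.single [f a b, g a b] (complex_of_real (h a b))) =
      (\<Sum>a\<in>I. evaluate (\<Sum>b\<in>J. Poly_Mapping.single [f a b, g a b] (complex_of_real (h a b))))"
    by (intro evaluate_sum keys_sum_subset k)
  also have "\<dots> = (\<Sum>a\<in>I. \<Sum>b\<in>J. evaluate (Poly_Mapping.single [f a b, g a b] (complex_of_real (h a b))))"
    by (intro sum.cong refl evaluate_sum k)
  also have "\<dots> = (\<Sum>a\<in>I. \<Sum>b\<in>J. h a b *\<^sub>R ((case f a b of (i, j) \<Rightarrow> T i j) * (case g a b of (i, j) \<Rightarrow> T i j)))"
    using assms by (intro sum.cong refl evaluate_pair) auto
  finally show ?thesis .
qed

lemma evaluate_triples: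
  assumes "\<And>a b c. a \<in> I \<Longrightarrow> b \<in> J \<Longrightarrow> c \<in> K \<Longrightarrow> f a b c \<in> Sp_generators \<and> g a b c \<in> Sp_generators"
  shows "evaluate (\<Sum>a\<in>I. \<Sum>b\<in>J. \<Sum>c\<in>K. Poly_Mapping.single [f a b c, g a b c] (complex_of_real (h a b c))) =
    (\<Sum>a\<in>I. \<Sum>b\<in>J. \<Sum>c\<in>K. h a b c *\<^sub>R ((case f a b c of (i, j) \<Rightarrow> T i j) * (case g a b c of (i, j) \<Rightarrow> T i j)))"
proof -
  have k: "Poly_Mapping.keys (Poly_Mapping.single [f a b c, g a b c] (complex_of_real (h a b c))) \<subseteq> lists Sp_generators"
    if "a \<in> I" "b \<in> J" "c \<in> K" for a b c
    using assms[OF that] by simp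
  have "evaluate (\<Sum>a\<in>I. \<Sum>b\<in>J. \<Sum>c\<in>K. Poly_Mapping.single [f a b c, g a b c] (complex_of_real (h a b c))) =
      (\<Sum>a\<in>I. evaluate (\<Sum>b\<in>J. \<Sum>c\<in>K. Poly_Mapping.single [f a b c, g a b c] (complex_of_real (h a b c))))"
    by (intro evaluate_sum keys_sum_subset k)
  also have "\<dots> = (\<Sum>a\<in>I. \<Sum>b\<in>J. \<Sum>c\<in>K. h a b c *\<^sub>R ((case f a b c of (i, j) \<Rightarrow> T i j) * (case g a b c of (i, j) \<Rightarrow> T i j)))"
    using assms by (intro sum.cong refl evaluate_pairs) auto
  finally show ?thesis .
qed

lemma evaluate_diff:
  assumes "Poly_Mapping.keys p \<subseteq> lists Sp_generators" "Poly_Mapping.keys r \<subseteq> lists Sp_generators"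
  shows "evaluate (p - r) = evaluate p - evaluate r"
proof -
  note C = complex_algebra_corner[OF unit_idem]
  have "evaluate p \<in> carrier (corner e)" "evaluate r \<in> carrier (corner e)"
    by (rule complex_algebra.linear_extension_closed[OF C _ word_Pi_corner], rule assms)+
  then show ?thesis
    using complex_algebra.linear_extension_diff[OF C assms word_Pi_corner] corner_minus[OF unit_idem] by simp
qed

lemma evaluate_empty: "evaluate (Poly_Mapping.single [] c) = c *\<^sub>C e"
  by (subst complex_algebra.linear_extension_single[OF complex_algebra_corner[OF unit_idem]]) (simp_all add: unit_idem)

lemma empty_keys: "Poly_Mapping.keys (Poly_Mapping.single [] c) \<subseteq> lists Sp_generators"
  by simp

lemma evaluate_relation:
  assumes q: "q \<noteq> 0" and r: "r \<in> Sp_relations q"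
  shows "evaluate r = 0"
  using r
proof (cases rule: Sp_relations_cases)
  case (RTT s t)
  have "evaluate (RTT_word q s t) =
      (\<Sum>x\<in>Sp_generators. R_matrix q s x *\<^sub>R square12 T x t) - (\<Sum>x\<in>Sp_generators. R_matrix q x t *\<^sub>R square21 T s x)"
    unfolding RTT_word_def evaluate_diff[OF RTT_word_keys[OF RTT(1,2)]]
    using RTT(1,2)
    by (subst (1 2) evaluate_pairs)
      (auto simp: Sp_generators_def square12_def square21_def sum.cartesian_product case_prod_unfold)
  with RTT T show ?thesis by (simp add: symplectic_matrix_def RTT_relations_def)
next
  case (row i j)
  have "evaluate (row_word q i j) =
      (\<Sum>k\<in>{1..4}. \<Sum>l\<in>{1..4}. \<Sum>m\<in>{1..4}. (C_matrix q k l * C_inverse q m j) *\<^sub>R (T i k * T m l)) - of_bool (i = j) *\<^sub>R e"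
    unfolding row_word_def evaluate_diff[OF symplectic_word_keys(1)[OF row(1)] empty_keys] evaluate_empty
    using row(1,2) by (subst evaluate_triples) (auto simp: Sp_generators_def)
  also have "(\<Sum>k\<in>{1..4}. \<Sum>l\<in>{1..4}. \<Sum>m\<in>{1..4}. (C_matrix q k l * C_inverse q m j) *\<^sub>R (T i k * T m l)) =
      (\<Sum>m\<in>{1..4}. C_inverse q m j *\<^sub>R (\<Sum>k\<in>{1..4}. \<Sum>l\<in>{1..4}. C_matrix q k l *\<^sub>R (T i k * T m l)))"
    by (simp add: scaleR_sum_right mult.commute) (subst sum.swap, subst sum.swap, simp)
  also have "\<dots> = (\<Sum>m\<in>{1..4}. (C_matrix q i m * C_inverse q m j) *\<^sub>R e)"
    using T row by (intro sum.cong) (auto simp: symplectic_matrix_def symplectic_relations_def mult.commute)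
  also have "\<dots> = of_bool (i = j) *\<^sub>R e"
    using C_matrix_C_inverse(1)[OF q row(1,2)] by (simp flip: scaleR_sum_left)
  finally show ?thesis using row by simp
next
  case (column i j)
  have "evaluate (column_word q i j) =
      (\<Sum>k\<in>{1..4}. \<Sum>l\<in>{1..4}. \<Sum>m\<in>{1..4}. (C_matrix q i k * C_inverse q l m) *\<^sub>R (T l k * T m j)) - of_bool (i = j) *\<^sub>R e"
    unfolding column_word_def evaluate_diff[OF symplectic_word_keys(2)[OF column(2)] empty_keys] evaluate_empty
    using column(1,2) by (subst evaluate_triples) (auto simp: Sp_generators_def)
  also have "(\<Sum>k\<in>{1..4}. \<Sum>l\<in>{1..4}. \<Sum>m\<in>{1..4}. (C_matrix q i k * C_inverse q l m) *\<^sub>R (T l k * T m j)) =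
      (\<Sum>k\<in>{1..4}. C_matrix q i k *\<^sub>R (\<Sum>l\<in>{1..4}. \<Sum>m\<in>{1..4}. C_inverse q l m *\<^sub>R (T l k * T m j)))"
    by (simp add: scaleR_sum_right)
  also have "\<dots> = (\<Sum>k\<in>{1..4}. (C_matrix q i k * C_inverse q k j) *\<^sub>R e)"
    using T column by (intro sum.cong) (auto simp: symplectic_matrix_def symplectic_relations_def mult.commute)
  also have "\<dots> = of_bool (i = j) *\<^sub>R e"
    using C_matrix_C_inverse(1)[OF q column(1,2)] by (simp flip: scaleR_sum_left)
  finally show ?thesis using column by simp
qed

text \<open>
  Representations of \<^const>\<open>A_Sp\<close> are the matrices with the symplectic quantum relations.
\<close>

lemma Sp_hom:
  assumes q: "q \<noteq> 0"
  shows "induced_hom (corner e) (\<lambda>(i, j). T i j) \<in> algebra_homs (A_Sp q) (corner e)"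
    and "i \<in> {1..4} \<Longrightarrow> j \<in> {1..4} \<Longrightarrow> induced_hom (corner e) (\<lambda>(i, j). T i j) (T_gen q i j) = T i j"
proof -
  have f: "(\<lambda>(i, j). T i j) \<in> Sp_generators \<rightarrow> carrier (corner e)" by (intro Pi_I entry_corner)
  have r: "evaluate r = \<zero>\<^bsub>corner e\<^esub>" if "r \<in> Sp_relations q" for r
    using evaluate_relation[OF q that] by simp
  note C = complex_algebra_corner[OF unit_idem]
  show "induced_hom (corner e) (\<lambda>(i, j). T i j) \<in> algebra_homs (A_Sp q) (corner e)"
    unfolding A_Sp_def by (rule presentation.induced_hom[OF presentation_Sp C f r])
  show "induced_hom (corner e) (\<lambda>(i, j). T i j) (T_gen q i j) = T i j" if "i \<in> {1..4}" "j \<in> {1..4}"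
    unfolding T_gen_def using that
    by (subst presentation.induced_hom_generator[OF presentation_Sp C f r]) (auto simp: Sp_generators_def)
qed

end

definition matrix_product :: "(nat \<Rightarrow> nat \<Rightarrow> 'r::ring) \<Rightarrow> (nat \<Rightarrow> nat \<Rightarrow> 'r) \<Rightarrow> nat \<Rightarrow> nat \<Rightarrow> 'r" where
  "matrix_product A B i j = (\<Sum>k\<in>{1..4}. A i k * B k j)"

text \<open>
  If the entries of \<open>A\<close> commute with those of \<open>B\<close>, then the tensor squares of matrices are multiplicative.
\<close>

lemma square_product:
  fixes A B :: "nat \<Rightarrow> nat \<Rightarrow> 'r::ring"
  assumes comm: "\<And>i j k l. i \<in> {1..4} \<Longrightarrow> j \<in> {1..4} \<Longrightarrow> k \<in> {1..4} \<Longrightarrow> l \<in> {1..4} \<Longrightarrow> B i j * A k l = A k l * B i j"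
    and rs: "r \<in> Sp_generators" "s \<in> Sp_generators"
  shows "square12 (matrix_product A B) r s = (\<Sum>t\<in>Sp_generators. square12 A r t * square12 B t s)"
    and "square21 (matrix_product A B) r s = (\<Sum>t\<in>Sp_generators. square21 A r t * square21 B t s)"
proof -
  have rs': "fst r \<in> {1..4}" "snd r \<in> {1..4}" "fst s \<in> {1..4}" "snd s \<in> {1..4}"
    using rs by (auto simp: Sp_generators_def)
  have "square12 (matrix_product A B) r s =
      (\<Sum>(k, l)\<in>{1..4} \<times> {1..4}. (A (fst r) k * B k (fst s)) * (A (snd r) l * B l (snd s)))"
    by (simp add: square12_def matrix_product_def sum_product sum.cartesian_product)
  also have "\<dots> = (\<Sum>t\<in>Sp_generators. square12 A r t * square12 B t s)"
    unfolding Sp_generators_def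
  proof (intro sum.cong refl, clarify)
    fix k l :: nat assume "k \<in> {1..4}" "l \<in> {1..4}"
    then have "A (fst r) k * (B k (fst s) * A (snd r) l) * B l (snd s) = A (fst r) k * (A (snd r) l * B k (fst s)) * B l (snd s)"
      using comm rs' by simp
    then show "(A (fst r) k * B k (fst s)) * (A (snd r) l * B l (snd s)) = square12 A r (k, l) * square12 B (k, l) s"
      by (simp add: square12_def mult.assoc)
  qed
  finally show "square12 (matrix_product A B) r s = (\<Sum>t\<in>Sp_generators. square12 A r t * square12 B t s)" .
  have "square21 (matrix_product A B) r s =
      (\<Sum>(l, k)\<in>{1..4} \<times> {1..4}. (A (snd r) l * B l (snd s)) * (A (fst r) k * B k (fst s)))"
    by (simp add: square21_def matrix_product_def sum_product sum.cartesian_product)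
  also have "\<dots> = (\<Sum>(k, l)\<in>{1..4} \<times> {1..4}. (A (snd r) l * B l (snd s)) * (A (fst r) k * B k (fst s)))"
    unfolding sum.cartesian_product[symmetric] by (rule sum.swap)
  also have "\<dots> = (\<Sum>t\<in>Sp_generators. square21 A r t * square21 B t s)"
    unfolding Sp_generators_def
  proof (intro sum.cong refl, clarify)
    fix k l :: nat assume "k \<in> {1..4}" "l \<in> {1..4}"
    then have "A (snd r) l * (B l (snd s) * A (fst r) k) * B k (fst s) = A (snd r) l * (A (fst r) k * B l (snd s)) * B k (fst s)"
      using comm rs' by simp
    then show "(A (snd r) l * B l (snd s)) * (A (fst r) k * B k (fst s)) = square21 A r (k, l) * square21 B (k, l) s"
      by (simp add: square21_def mult.assoc)
  qed
  finally show "square21 (matrix_product A B) r s = (\<Sum>t\<in>Sp_generators. square21 A r t * square21 B t s)" .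
qed

lemma symplectic_relations_square:
  "symplectic_relations q e T \<longleftrightarrow> (\<forall>r\<in>Sp_generators.
     (\<Sum>t\<in>Sp_generators. C_matrix q (fst t) (snd t) *\<^sub>R square12 T r t) = C_matrix q (fst r) (snd r) *\<^sub>R e \<and>
     (\<Sum>t\<in>Sp_generators. C_inverse q (fst t) (snd t) *\<^sub>R square12 T t r) = C_inverse q (fst r) (snd r) *\<^sub>R e)"
  by (simp add: symplectic_relations_def Sp_generators_def square12_def sum.cartesian_product case_prod_unfold)

text \<open>
  The relations say that \<open>R\<close> intertwines the two tensor squares of \<open>T\<close> and that \<open>C\<close> is fixed by one of them.
  Intertwining and fixing are inherited by products.
\<close>

lemma symplectic_matrix_product:
  assumes A: "symplectic_matrix q e A" and B: "symplectic_matrix q e B"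
    and comm: "\<And>i j k l. i \<in> {1..4} \<Longrightarrow> j \<in> {1..4} \<Longrightarrow> k \<in> {1..4} \<Longrightarrow> l \<in> {1..4} \<Longrightarrow> B i j * A k l = A k l * B i j"
  shows "symplectic_matrix q e (matrix_product A B)"
proof -
  let ?T = "matrix_product A B" and ?G = Sp_generators
  have sq: "square12 ?T r s = (\<Sum>t\<in>?G. square12 A r t * square12 B t s)"
      "square21 ?T r s = (\<Sum>t\<in>?G. square21 A r t * square21 B t s)" if "r \<in> ?G" "s \<in> ?G" for r s
    by (rule square_product[OF comm that]; assumption)+
  have e: "e * e = e" and eA: "\<And>i j. i \<in> {1..4} \<Longrightarrow> j \<in> {1..4} \<Longrightarrow> e * A i j = A i j"
    and eB: "\<And>i j. i \<in> {1..4} \<Longrightarrow> j \<in> {1..4} \<Longrightarrow> B i j * e = B i j"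
    and eA': "\<And>i j. i \<in> {1..4} \<Longrightarrow> j \<in> {1..4} \<Longrightarrow> A i j * e = A i j"
    and eB': "\<And>i j. i \<in> {1..4} \<Longrightarrow> j \<in> {1..4} \<Longrightarrow> e * B i j = B i j"
    and RA: "\<And>r s. r \<in> ?G \<Longrightarrow> s \<in> ?G \<Longrightarrow>
      (\<Sum>t\<in>?G. R_matrix q r t *\<^sub>R square12 A t s) = (\<Sum>t\<in>?G. R_matrix q t s *\<^sub>R square21 A r t)"
    and RB: "\<And>r s. r \<in> ?G \<Longrightarrow> s \<in> ?G \<Longrightarrow>
      (\<Sum>t\<in>?G. R_matrix q r t *\<^sub>R square12 B t s) = (\<Sum>t\<in>?G. R_matrix q t s *\<^sub>R square21 B r t)"
    and CA: "\<And>r. r \<in> ?G \<Longrightarrow> (\<Sum>t\<in>?G. C_matrix q (fst t) (snd t) *\<^sub>R square12 A r t) = C_matrix q (fst r) (snd r) *\<^sub>R e"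
       "\<And>r. r \<in> ?G \<Longrightarrow> (\<Sum>t\<in>?G. C_inverse q (fst t) (snd t) *\<^sub>R square12 A t r) = C_inverse q (fst r) (snd r) *\<^sub>R e"
    and CB: "\<And>r. r \<in> ?G \<Longrightarrow> (\<Sum>t\<in>?G. C_matrix q (fst t) (snd t) *\<^sub>R square12 B r t) = C_matrix q (fst r) (snd r) *\<^sub>R e"
       "\<And>r. r \<in> ?G \<Longrightarrow> (\<Sum>t\<in>?G. C_inverse q (fst t) (snd t) *\<^sub>R square12 B t r) = C_inverse q (fst r) (snd r) *\<^sub>R e"
    using A B unfolding symplectic_matrix_def RTT_relations_def symplectic_relations_square by blast+
  have sqe: "square12 A r p * e = square12 A r p" "e * square12 B r p = square12 B r p"
    if "r \<in> ?G" "p \<in> ?G" for r p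
    using that eA' eB' by (auto simp: square12_def mult.assoc Sp_generators_def) (simp add: mult.assoc[symmetric])
  have unit: "e * ?T i j = ?T i j \<and> ?T i j * e = ?T i j" if "i \<in> {1..4}" "j \<in> {1..4}" for i j
    unfolding matrix_product_def sum_distrib_left sum_distrib_right using that eA eB
    by (auto intro!: sum.cong simp: mult.assoc) (simp add: mult.assoc[symmetric])
  have "(\<Sum>t\<in>?G. R_matrix q r t *\<^sub>R square12 ?T t s) = (\<Sum>t\<in>?G. R_matrix q t s *\<^sub>R square21 ?T r t)"
    if r: "r \<in> ?G" and s: "s \<in> ?G" for r s
  proof -
    have "(\<Sum>t\<in>?G. R_matrix q r t *\<^sub>R square12 ?T t s) =
        (\<Sum>t\<in>?G. \<Sum>p\<in>?G. (R_matrix q r t *\<^sub>R square12 A t p) * square12 B p s)"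
      using s by (intro sum.cong refl) (simp add: sq scaleR_sum_right)
    also have "\<dots> = (\<Sum>p\<in>?G. (\<Sum>t\<in>?G. R_matrix q r t *\<^sub>R square12 A t p) * square12 B p s)"
      by (subst sum.swap) (simp add: sum_distrib_right)
    also have "\<dots> = (\<Sum>p\<in>?G. \<Sum>t\<in>?G. square21 A r t * (R_matrix q t p *\<^sub>R square12 B p s))"
      using r by (intro sum.cong refl) (simp add: RA sum_distrib_right)
    also have "\<dots> = (\<Sum>t\<in>?G. square21 A r t * (\<Sum>p\<in>?G. R_matrix q t p *\<^sub>R square12 B p s))"
      by (subst sum.swap) (simp add: sum_distrib_left)
    also have "\<dots> = (\<Sum>t\<in>?G. \<Sum>p\<in>?G. R_matrix q p s *\<^sub>R (square21 A r t * square21 B t p))"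
      using s by (intro sum.cong refl) (simp add: RB sum_distrib_left)
    also have "\<dots> = (\<Sum>p\<in>?G. R_matrix q p s *\<^sub>R (\<Sum>t\<in>?G. square21 A r t * square21 B t p))"
      by (subst sum.swap) (simp add: scaleR_sum_right)
    also have "\<dots> = (\<Sum>p\<in>?G. R_matrix q p s *\<^sub>R square21 ?T r p)"
      using r by (intro sum.cong refl) (simp add: sq)
    finally show ?thesis .
  qed
  moreover have "(\<Sum>t\<in>?G. C_matrix q (fst t) (snd t) *\<^sub>R square12 ?T r t) = C_matrix q (fst r) (snd r) *\<^sub>R e"
    if r: "r \<in> ?G" for r
  proof -
    have "(\<Sum>t\<in>?G. C_matrix q (fst t) (snd t) *\<^sub>R square12 ?T r t) =
        (\<Sum>t\<in>?G. \<Sum>p\<in>?G. square12 A r p * (C_matrix q (fst t) (snd t) *\<^sub>R square12 B p t))"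
      using r by (intro sum.cong refl) (simp add: sq scaleR_sum_right)
    also have "\<dots> = (\<Sum>p\<in>?G. square12 A r p * (\<Sum>t\<in>?G. C_matrix q (fst t) (snd t) *\<^sub>R square12 B p t))"
      by (subst sum.swap) (simp add: sum_distrib_left)
    also have "\<dots> = (\<Sum>p\<in>?G. C_matrix q (fst p) (snd p) *\<^sub>R square12 A r p)"
      using r by (intro sum.cong refl) (simp add: CB sqe)
    finally show ?thesis using CA r by simp
  qed
  moreover have "(\<Sum>t\<in>?G. C_inverse q (fst t) (snd t) *\<^sub>R square12 ?T t r) = C_inverse q (fst r) (snd r) *\<^sub>R e"
    if r: "r \<in> ?G" for r
  proof -
    have "(\<Sum>t\<in>?G. C_inverse q (fst t) (snd t) *\<^sub>R square12 ?T t r) =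
        (\<Sum>t\<in>?G. \<Sum>p\<in>?G. (C_inverse q (fst t) (snd t) *\<^sub>R square12 A t p) * square12 B p r)"
      using r by (intro sum.cong refl) (simp add: sq scaleR_sum_right)
    also have "\<dots> = (\<Sum>p\<in>?G. (\<Sum>t\<in>?G. C_inverse q (fst t) (snd t) *\<^sub>R square12 A t p) * square12 B p r)"
      by (subst sum.swap) (simp add: sum_distrib_right)
    also have "\<dots> = (\<Sum>p\<in>?G. C_inverse q (fst p) (snd p) *\<^sub>R square12 B p r)"
      using r by (intro sum.cong refl) (simp add: CA sqe)
    finally show ?thesis using CB r by simp
  qed
  ultimately show ?thesis
    unfolding symplectic_matrix_def RTT_relations_def symplectic_relations_square using e unit by blast
qed

subsection \<open>Entries of the R-matrix\<close>

lemma sum_pick: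
  fixes g :: "nat \<Rightarrow> nat \<Rightarrow> real"
  assumes "finite I" "a \<in> I" "c \<in> I"
    and h: "\<And>i j. i \<in> I \<Longrightarrow> j \<in> I \<Longrightarrow> P i j \<Longrightarrow> h i j = (if i = a \<and> j = c \<and> Q then g i j else 0)"
  shows "(\<Sum>i\<in>I. \<Sum>j\<in>{j\<in>I. P i j}. h i j) = (if P a c \<and> Q then g a c else 0)"
proof -
  have "(\<Sum>i\<in>I. \<Sum>j\<in>{j\<in>I. P i j}. h i j) =
      (\<Sum>i\<in>I. if i = a then (\<Sum>j\<in>{j\<in>I. P i j}. if j = c then (if Q then g a c else 0) else 0) else 0)"
    using h by (auto intro!: sum.cong sum.neutral)
  also have "\<dots> = (if P a c \<and> Q then g a c else 0)"
    using assms(1-3) by (simp add: sum.delta)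
  finally show ?thesis .
qed

text \<open>
  A closed form of the entries of \<open>R\<close>, by which the simplifier can expand the \<open>RTT\<close> relations.
\<close>

lemma R_matrix_entry:
  assumes "a \<in> {1..4}" "b \<in> {1..4}" "c \<in> {1..4}" "d \<in> {1..4}"
  shows "R_matrix q (a, b) (c, d) =
    (if c = a \<and> d = b then (if a = b then q else if a + b = 5 then inverse q else 1) else 0)
    + (if c < a \<and> b = c \<and> d = a then q - inverse q else 0)
    - (if c < a \<and> a + b = 5 \<and> c + d = 5 then (q - inverse q) * (q powi (rho a - rho c) * eps a * eps c) else 0)"
proof -
  note I = finite_atLeastAtMost[of 1 "4::nat"]
  have dual: "a = dual_ix b \<longleftrightarrow> a + b = 5" "b = dual_ix a \<longleftrightarrow> a + b = 5" "d = dual_ix c \<longleftrightarrow> c + d = 5"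
    using assms by (auto simp: dual_ix_def)
  have odd: "x + x \<noteq> 5" for x :: nat by presburger
  have 1: "(\<Sum>i\<in>{1..4}. unit_tensor i i i i (a, b) (c, d)) = of_bool (c = a \<and> d = b \<and> a = b)"
  proof -
    have "(\<Sum>i\<in>{1..4}. unit_tensor i i i i (a, b) (c, d)) =
        (\<Sum>i\<in>{1..4}. if i = b then of_bool (c = a \<and> d = b \<and> a = b) else 0)"
      using assms by (intro sum.cong) (auto simp: unit_tensor_def)
    then show ?thesis using assms by simp
  qed
  have 2: "(\<Sum>i\<in>{1..4}. \<Sum>j\<in>{j\<in>{1..4}. i \<noteq> j \<and> i \<noteq> dual_ix j}. unit_tensor i i j j (a, b) (c, d)) =
      (if (a \<noteq> b \<and> a \<noteq> dual_ix b) \<and> (c = a \<and> d = b) then 1 else 0)"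
    using assms by (intro sum_pick I) (auto simp: unit_tensor_def)
  have 3: "(\<Sum>i\<in>{1..4}. unit_tensor (dual_ix i) (dual_ix i) i i (a, b) (c, d)) = of_bool (c = a \<and> d = b \<and> a + b = 5)"
  proof -
    have "(\<Sum>i\<in>{1..4}. unit_tensor (dual_ix i) (dual_ix i) i i (a, b) (c, d)) =
        (\<Sum>i\<in>{1..4}. if i = b then of_bool (c = a \<and> d = b \<and> a + b = 5) else 0)"
      using assms by (intro sum.cong) (auto simp: unit_tensor_def dual_ix_def)
    then show ?thesis using assms by simp
  qed
  have 4: "(\<Sum>i\<in>{1..4}. \<Sum>j\<in>{j\<in>{1..4}. i > j}. unit_tensor i j j i (a, b) (c, d)) =
      (if a > c \<and> (b = c \<and> d = a) then 1 else 0)"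
    using assms by (intro sum_pick I) (auto simp: unit_tensor_def)
  have 5: "(\<Sum>i\<in>{1..4}. \<Sum>j\<in>{j\<in>{1..4}. i > j}.
         q powi (rho i - rho j) * eps i * eps j * unit_tensor i j (dual_ix i) (dual_ix j) (a, b) (c, d)) =
      (if a > c \<and> (b = dual_ix a \<and> d = dual_ix c) then q powi (rho a - rho c) * eps a * eps c else 0)"
    by (rule sum_pick[where g = "\<lambda>i j. q powi (rho i - rho j) * eps i * eps j"])
      (use assms in \<open>simp_all add: unit_tensor_def of_bool_def, argo?\<close>)
  show ?thesis
    unfolding R_matrix_def 1 2 3 4 5 dual
    by (cases "c = a \<and> d = b"; cases "a = b"; cases "a + b = 5")
      (use odd in auto)
qed

text \<open>
  The group \<open>Sp(2)\<close> contains one copy of \<open>SL\<^sub>2\<close> for the short root, acting on the first two coordinates and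
  dually on the last two, and one for the long root, acting on the two middle coordinates. Their quantum
  versions have the parameters \<open>q\<close> and \<open>q\<^sup>2\<close>, the squared lengths of the roots being \<open>1 : 2\<close>.
\<close>

definition short_root_matrix :: "(nat \<Rightarrow> nat \<Rightarrow> 'r::ring) \<Rightarrow> nat \<Rightarrow> nat \<Rightarrow> 'r" where
  "short_root_matrix u i j =
     [[u 1 1, u 1 2, 0, 0], [u 2 1, u 2 2, 0, 0], [0, 0, u 1 1, - u 1 2], [0, 0, - u 2 1, u 2 2]] ! (i - 1) ! (j - 1)"

definition long_root_matrix :: "'r \<Rightarrow> (nat \<Rightarrow> nat \<Rightarrow> 'r::ring) \<Rightarrow> nat \<Rightarrow> nat \<Rightarrow> 'r" where
  "long_root_matrix e u i j =
     [[e, 0, 0, 0], [0, u 1 1, u 1 2, 0], [0, u 2 1, u 2 2, 0], [0, 0, 0, e]] ! (i - 1) ! (j - 1)"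

context
  fixes u :: "nat \<Rightarrow> nat \<Rightarrow> 'r::complex_ring" and q s :: real and e :: 'r and a b c d p
  assumes q: "q \<noteq> 0" and e: "e * e = e" and u: "quantum_SL2 (corner e) s u"
  defines "a \<equiv> u 1 1" and "b \<equiv> u 1 2" and "c \<equiv> u 2 1" and "d \<equiv> u 2 2" and "p \<equiv> inverse q"
begin

lemma inverse_param: "inverse q = p" "q * p = 1" "p * q = 1" "q * (p * x) = x" "p * (q * x) = x"
  using q by (auto simp: p_def)

lemma unit_rel: "e * a = a" "e * b = b" "e * c = c" "e * d = d" "a * e = a" "b * e = b" "c * e = c" "d * e = d" "e * e = e"
  using u e unfolding quantum_SL2_corner a_def b_def c_def d_def by simp_all

lemma short_eq: "short_root_matrix u =
    (\<lambda>i j. [[a, b, 0, 0], [c, d, 0, 0], [0, 0, a, - b], [0, 0, - c, d]] ! (i - 1) ! (j - 1))"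
  by (simp add: short_root_matrix_def fun_eq_iff a_def b_def c_def d_def)

lemma long_eq: "long_root_matrix e u =
    (\<lambda>i j. [[e, 0, 0, 0], [0, a, b, 0], [0, c, d, 0], [0, 0, 0, e]] ! (i - 1) ! (j - 1))"
  by (simp add: long_root_matrix_def fun_eq_iff a_def b_def c_def d_def)

lemma short_rel:
  assumes "s = q"
  shows "b * a = p *\<^sub>R (a * b)" "c * a = p *\<^sub>R (a * c)" "d * b = p *\<^sub>R (b * d)" "d * c = p *\<^sub>R (c * d)"
     "c * b = b * c" "a * d = q *\<^sub>R (b * c) + e" "d * a = p *\<^sub>R (b * c) + e"
  using u inverse_param unfolding quantum_SL2_corner a_def b_def c_def d_def assms by simp_all

lemma long_rel:
  assumes "s = q\<^sup>2"
  shows "b * a = (p * p) *\<^sub>R (a * b)" "c * a = (p * p) *\<^sub>R (a * c)" "d * b = (p * p) *\<^sub>R (b * d)"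
     "d * c = (p * p) *\<^sub>R (c * d)"
     "c * b = b * c" "a * d = (q * q) *\<^sub>R (b * c) + e" "d * a = (p * p) *\<^sub>R (b * c) + e"
  using u inverse_param unfolding quantum_SL2_corner a_def b_def c_def d_def assms
  by (simp_all add: power2_eq_square mult.assoc inverse_param(4,5))

text \<open>
  For matrices this sparse the \<open>RTT\<close> relations can be checked entry by entry, all 256 of them.
\<close>

lemma short_root_RTT: "s = q \<Longrightarrow> RTT_relations q (short_root_matrix u)"
  unfolding RTT_relations_def short_eq square12_def square21_def Sp_generators_def atLeastAtMost_1_4
  by (simp add: R_matrix_entry split del: if_split)
    (simp add: short_rel inverse_param rho_def eps_def numeral_eq_Suc power_int_def,
     simp add: algebra_simps inverse_param)

lemma long_root_RTT: "s = q\<^sup>2 \<Longrightarrow> RTT_relations q (long_root_matrix e u)"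
  unfolding RTT_relations_def long_eq square12_def square21_def Sp_generators_def atLeastAtMost_1_4
  by (simp add: R_matrix_entry split del: if_split)
    (simp add: long_rel unit_rel inverse_param rho_def eps_def numeral_eq_Suc power_int_def,
     simp add: algebra_simps inverse_param)

lemma short_root_symplectic: "s = q \<Longrightarrow> symplectic_relations q e (short_root_matrix u)"
  unfolding symplectic_relations_def short_eq atLeastAtMost_1_4
  by (simp add: C_matrix_def C_inverse_def dual_ix_def split del: if_split)
    (simp add: short_rel inverse_param rho_def eps_def numeral_eq_Suc power_int_def,
     simp add: algebra_simps inverse_param)

lemma long_root_symplectic: "s = q\<^sup>2 \<Longrightarrow> symplectic_relations q e (long_root_matrix e u)"
  unfolding symplectic_relations_def long_eq atLeastAtMost_1_4
  by (simp add: C_matrix_def C_inverse_def dual_ix_def split del: if_split)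
    (simp add: long_rel unit_rel inverse_param rho_def eps_def numeral_eq_Suc power_int_def,
     simp add: algebra_simps inverse_param)

lemma symplectic_short_root: "s = q \<Longrightarrow> symplectic_matrix q e (short_root_matrix u)"
  unfolding symplectic_matrix_def using short_root_RTT short_root_symplectic e
  by (auto simp: atLeastAtMost_1_4 short_eq unit_rel)

lemma symplectic_long_root: "s = q\<^sup>2 \<Longrightarrow> symplectic_matrix q e (long_root_matrix e u)"
  unfolding symplectic_matrix_def using long_root_RTT long_root_symplectic e
  by (auto simp: atLeastAtMost_1_4 long_eq unit_rel)

end

text \<open>
  The product of the two rank-one subgroups. Its last column is a point of the sphere with \<open>x\<^sub>1 = 0\<close>; these
  points form a ball whose boundary is the fibre \<open>x\<^sub>1 = x\<^sub>2 = 0\<close> of the base point.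
\<close>

definition rank_one_product :: "'r \<Rightarrow> (nat \<Rightarrow> nat \<Rightarrow> 'r::ring) \<Rightarrow> (nat \<Rightarrow> nat \<Rightarrow> 'r) \<Rightarrow> nat \<Rightarrow> nat \<Rightarrow> 'r" where
  "rank_one_product e w u = matrix_product (long_root_matrix e w) (short_root_matrix u)"

lemma symplectic_rank_one_product:
  fixes u w :: "nat \<Rightarrow> nat \<Rightarrow> 'r::complex_ring"
  assumes q: "q \<noteq> 0" and e: "e * e = e" and u: "quantum_SL2 (corner e) q u" and w: "quantum_SL2 (corner e) (q\<^sup>2) w"
    and comm: "\<And>i j k l. i \<in> {1, 2} \<Longrightarrow> j \<in> {1, 2} \<Longrightarrow> k \<in> {1, 2} \<Longrightarrow> l \<in> {1, 2} \<Longrightarrow> u i j * w k l = w k l * u i j"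
  shows "symplectic_matrix q e (rank_one_product e w u)"
  unfolding rank_one_product_def
proof (rule symplectic_matrix_product)
  show "symplectic_matrix q e (long_root_matrix e w)"
    by (rule symplectic_long_root[OF q e w refl])
  show "symplectic_matrix q e (short_root_matrix u)"
    by (rule symplectic_short_root[OF q e u refl])
  fix i j k l :: nat
  assume "i \<in> {1..4}" "j \<in> {1..4}" "k \<in> {1..4}" "l \<in> {1..4}"
  then show "short_root_matrix u i j * long_root_matrix e w k l = long_root_matrix e w k l * short_root_matrix u i j"
    using comm u unfolding atLeastAtMost_1_4 short_root_matrix_def long_root_matrix_def quantum_SL2_corner
    by auto
qed

lemma rank_one_product_entries:
  assumes u: "quantum_SL2 (corner e) q u"
  shows "rank_one_product e w u 1 1 = u 1 1" "rank_one_product e w u 2 1 = w 1 1 * u 2 1"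
    "rank_one_product e w u 3 1 = w 2 1 * u 2 1" "rank_one_product e w u 4 1 = 0"
    "rank_one_product e w u 1 4 = 0" "rank_one_product e w u 2 4 = - (w 1 2 * u 1 2)"
    "rank_one_product e w u 3 4 = - (w 2 2 * u 1 2)" "rank_one_product e w u 4 4 = u 2 2"
  using u unfolding quantum_SL2_corner
  by (simp_all add: rank_one_product_def matrix_product_def atLeastAtMost_1_4 short_root_matrix_def long_root_matrix_def)

section \<open>The quantum seven-sphere\<close>

lemma complex_algebra_S7: "complex_algebra (A_S7 q)"
  unfolding A_S7_def by (rule complex_algebra.complex_algebra_subalgebra[OF complex_algebra_Sp])

lemma S7_simps [simp]:
  "mult (A_S7 q) = mult (A_Sp q)" "one (A_S7 q) = one (A_Sp q)" "zero (A_S7 q) = zero (A_Sp q)"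
  "add (A_S7 q) = add (A_Sp q)" "smult (A_S7 q) = smult (A_Sp q)"
  by (simp_all add: A_S7_def)

lemma S7_subset_Sp: "carrier (A_S7 q) \<subseteq> carrier (A_Sp q)"
  using complex_algebra.algebra_span_closed[OF complex_algebra_Sp]
  by (force simp: A_S7_def subalgebra_generated_def)

lemma restrict_hom: "f \<in> algebra_homs (A_Sp q) U \<Longrightarrow> f \<in> algebra_homs (A_S7 q) U"
  by (intro algebra_homsI) (simp_all add: algebra_homsD S7_subset_Sp[THEN subsetD])

lemma x_gen_closed [simp]: "i \<in> {1..4} \<Longrightarrow> x_gen q i \<in> carrier (A_S7 q)"
  by (auto simp: A_S7_def subalgebra_generated_def x_gen_def intro!: algebra_span.incl)

lemma x_bar_closed [simp]: "i \<in> {1..4} \<Longrightarrow> x_bar q i \<in> carrier (A_S7 q)"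
proof -
  interpret complex_algebra "A_Sp q" by (rule complex_algebra_Sp)
  assume i: "i \<in> {1..4}"
  have "x_bar q i \<in> carrier (A_Sp q)"
    unfolding x_bar_def antipode_T_def
    by (rule smult_closed, rule T_gen_closed) (use i in \<open>auto simp: dual_ix_def\<close>)
  with i show ?thesis
    by (auto simp: A_S7_def subalgebra_generated_def intro!: algebra_span.incl)
qed

lemma dual_ix_simps: "dual_ix 1 = 4" "dual_ix 2 = 3" "dual_ix 3 = 2" "dual_ix 4 = 1"
  by (simp_all add: dual_ix_def)

text \<open>A property of all elements of the sphere algebra is checked on the coordinates.\<close>

lemma S7_induct [consumes 1, case_names one x x_bar add mult smult]:
  assumes "p \<in> carrier (A_S7 q)"
    and "P \<one>\<^bsub>A_S7 q\<^esub>" "\<And>i. i \<in> {1..4} \<Longrightarrow> P (x_gen q i)" "\<And>i. i \<in> {1..4} \<Longrightarrow> P (x_bar q i)"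
    and "\<And>x y. x \<in> carrier (A_S7 q) \<Longrightarrow> y \<in> carrier (A_S7 q) \<Longrightarrow> P x \<Longrightarrow> P y \<Longrightarrow> P (x \<oplus>\<^bsub>A_S7 q\<^esub> y)"
    and "\<And>x y. x \<in> carrier (A_S7 q) \<Longrightarrow> y \<in> carrier (A_S7 q) \<Longrightarrow> P x \<Longrightarrow> P y \<Longrightarrow> P (x \<otimes>\<^bsub>A_S7 q\<^esub> y)"
    and "\<And>c x. x \<in> carrier (A_S7 q) \<Longrightarrow> P x \<Longrightarrow> P (c \<odot>\<^bsub>A_S7 q\<^esub> x)"
  shows "P p"
proof -
  have eq: "carrier (A_S7 q) = algebra_span (A_Sp q) (carrier (A_Sp q) \<inter> (x_gen q ` {1..4} \<union> x_bar q ` {1..4}))"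
    by (simp add: A_S7_def subalgebra_generated_def)
  from assms(1)[unfolded eq] show ?thesis
  proof (induction rule: algebra_span.induct)
    case (incl s)
    then show ?case using assms(3,4) by blast
  next
    case (add x y)
    then show ?case using assms(5)[of x y] by (simp add: eq)
  next
    case (mult x y)
    then show ?case using assms(6)[of x y] by (simp add: eq)
  next
    case (smult x c)
    then show ?case using assms(7)[of x c] by (simp add: eq)
  qed (use assms(2) in simp)
qed

lemma v_matrix_simps [simp]:
  "v_matrix q 1 1 = complex_of_real (q powi -3) \<odot>\<^bsub>A_Sp q\<^esub> x_gen q 1"
  "v_matrix q 1 2 = complex_of_real (q powi -2) \<odot>\<^bsub>A_Sp q\<^esub> x_gen q 2"
  "v_matrix q 2 1 = complex_of_real (- (q powi -1)) \<odot>\<^bsub>A_Sp q\<^esub> x_bar q 2"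
  "v_matrix q 2 2 = complex_of_real (q powi -1) \<odot>\<^bsub>A_Sp q\<^esub> x_bar q 1"
  "v_matrix q 3 1 = complex_of_real (q powi -1) \<odot>\<^bsub>A_Sp q\<^esub> x_gen q 3"
  "v_matrix q 3 2 = complex_of_real (- 1) \<odot>\<^bsub>A_Sp q\<^esub> x_gen q 4"
  "v_matrix q 4 1 = complex_of_real (- 1) \<odot>\<^bsub>A_Sp q\<^esub> x_bar q 4"
  "v_matrix q 4 2 = complex_of_real (- 1) \<odot>\<^bsub>A_Sp q\<^esub> x_bar q 3"
  by (simp_all add: v_matrix_def Let_def)

lemma v_matrix_closed: "i \<in> {1..4} \<Longrightarrow> j \<in> {1, 2} \<Longrightarrow> v_matrix q i j \<in> carrier (A_S7 q)"
proof -
  interpret complex_algebra "A_S7 q" by (rule complex_algebra_S7)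
  note cl = smult_closed[simplified]
  assume "i \<in> {1..4}" "j \<in> {1, 2}"
  then show ?thesis unfolding atLeastAtMost_1_4 by (auto intro!: cl)
qed

subsection \<open>Homomorphisms on the sphere\<close>

definition sphere_hom :: "real \<Rightarrow> 'r \<Rightarrow> (nat \<Rightarrow> nat \<Rightarrow> 'r) \<Rightarrow> (nat \<Rightarrow> nat \<Rightarrow> 'r::complex_ring) \<Rightarrow> (nat \<times> nat) presented \<Rightarrow> 'r" where
  "sphere_hom q e w u = induced_hom (corner e) (\<lambda>(i, j). rank_one_product e w u i j)"

context
  fixes q :: real and e :: "'r::complex_ring" and u w
  assumes q: "q \<noteq> 0" and e: "e * e = e" and u: "quantum_SL2 (corner e) q u" and w: "quantum_SL2 (corner e) (q\<^sup>2) w"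
    and comm: "\<And>i j k l. i \<in> {1, 2} \<Longrightarrow> j \<in> {1, 2} \<Longrightarrow> k \<in> {1, 2} \<Longrightarrow> l \<in> {1, 2} \<Longrightarrow> u i j * w k l = w k l * u i j"
begin

lemma sphere_hom_Sp: "sphere_hom q e w u \<in> algebra_homs (A_Sp q) (corner e)"
  unfolding sphere_hom_def by (rule Sp_hom(1)[OF symplectic_rank_one_product[OF q e u w comm] q])

lemma sphere_hom: "sphere_hom q e w u \<in> algebra_homs (A_S7 q) (corner e)"
  by (rule restrict_hom[OF sphere_hom_Sp])

lemma sphere_hom_T:
  assumes "i \<in> {1..4}" "j \<in> {1..4}"
  shows "sphere_hom q e w u (T_gen q i j) = rank_one_product e w u i j"
  unfolding sphere_hom_def by (rule Sp_hom(2)[OF symplectic_rank_one_product[OF q e u w comm] q assms])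

lemma sphere_hom_values:
  "sphere_hom q e w u (x_gen q 1) = 0"
  "sphere_hom q e w u (x_gen q 2) = - (w 1 2 * u 1 2)"
  "sphere_hom q e w u (x_gen q 3) = - (w 2 2 * u 1 2)"
  "sphere_hom q e w u (x_gen q 4) = u 2 2"
  "sphere_hom q e w u (x_bar q 1) = 0"
  "sphere_hom q e w u (x_bar q 2) = - (q ^ 3) *\<^sub>R (w 2 1 * u 2 1)"
  "sphere_hom q e w u (x_bar q 3) = q *\<^sub>R (w 1 1 * u 2 1)"
  "sphere_hom q e w u (x_bar q 4) = u 1 1"
proof -
  have s: "sphere_hom q e w u (c \<odot>\<^bsub>A_Sp q\<^esub> T_gen q i j) = c *\<^sub>C rank_one_product e w u i j"
    if "i \<in> {1..4}" "j \<in> {1..4}" for c i j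
    using algebra_homsD(4)[OF sphere_hom_Sp, of "T_gen q i j" c] sphere_hom_T that by simp
  have r: "complex_of_real r *\<^sub>C x = r *\<^sub>R x" for r and x :: 'r by (rule cscale_of_real)
  show "sphere_hom q e w u (x_gen q 1) = 0"
    "sphere_hom q e w u (x_gen q 2) = - (w 1 2 * u 1 2)"
    "sphere_hom q e w u (x_gen q 3) = - (w 2 2 * u 1 2)"
    "sphere_hom q e w u (x_gen q 4) = u 2 2"
    by (simp_all add: x_gen_def sphere_hom_T rank_one_product_entries[OF u])
  have "q powi 3 = q ^ 3" using power_int_of_nat[of q 3] by simp
  then show "sphere_hom q e w u (x_bar q 1) = 0"
    "sphere_hom q e w u (x_bar q 2) = - (q ^ 3) *\<^sub>R (w 2 1 * u 2 1)"
    "sphere_hom q e w u (x_bar q 3) = q *\<^sub>R (w 1 1 * u 2 1)"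
    "sphere_hom q e w u (x_bar q 4) = u 1 1"
    using q by (simp_all add: x_bar_def antipode_T_def s dual_ix_simps rank_one_product_entries[OF u] rho_def eps_def r
        del: of_real_mult of_real_minus of_real_power of_real_power_int)
qed

end

text \<open>The classical point of the sphere at which \<open>x\<^sub>4 = 1\<close> and the other coordinates vanish.\<close>

definition base_point :: "real \<Rightarrow> (nat \<times> nat) presented \<Rightarrow> complex" where
  "base_point q = sphere_hom q 1 (\<lambda>i j. of_bool (i = j)) (\<lambda>i j. of_bool (i = j))"

lemma identity_SL2: "quantum_SL2 (corner (1 :: complex)) q (\<lambda>i j. of_bool (i = j))"
  unfolding quantum_SL2_corner by simp

lemma
  assumes q: "q \<noteq> 0"
  shows base_point: "base_point q \<in> algebra_homs (A_S7 q) complex_numbers"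
    and base_point_v: "j \<in> {1, 2} \<Longrightarrow> base_point q (v_matrix q 1 j) = 0" "j \<in> {1, 2} \<Longrightarrow> base_point q (v_matrix q 2 j) = 0"
      "base_point q (v_matrix q 3 1) = 0" "base_point q (v_matrix q 3 2) = - 1"
      "base_point q (v_matrix q 4 1) = - 1" "base_point q (v_matrix q 4 2) = 0"
proof -
  let ?d = "\<lambda>i j. of_bool (i = j) :: complex"
  have comm: "i \<in> {1, 2} \<Longrightarrow> j \<in> {1, 2} \<Longrightarrow> k \<in> {1, 2} \<Longrightarrow> l \<in> {1, 2} \<Longrightarrow> ?d i j * ?d k l = ?d k l * ?d i j" for i j k l :: nat
    by simp
  have hom: "base_point q \<in> algebra_homs (A_S7 q) (corner 1)"
    unfolding base_point_def by (rule sphere_hom[OF q _ identity_SL2 identity_SL2 comm]; simp)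
  then show "base_point q \<in> algebra_homs (A_S7 q) complex_numbers"
    by (simp add: complex_numbers_corner)
  have val: "base_point q (x_gen q 1) = 0" "base_point q (x_gen q 2) = 0" "base_point q (x_gen q 3) = 0"
    "base_point q (x_gen q 4) = 1" "base_point q (x_bar q 1) = 0" "base_point q (x_bar q 2) = 0"
    "base_point q (x_bar q 3) = 0" "base_point q (x_bar q 4) = 1"
    unfolding base_point_def
    by (simp_all add: sphere_hom_values[OF q _ identity_SL2 identity_SL2] mult.commute)
  note sm = algebra_homsD(4)[OF hom, simplified]
  show "j \<in> {1, 2} \<Longrightarrow> base_point q (v_matrix q 1 j) = 0" "j \<in> {1, 2} \<Longrightarrow> base_point q (v_matrix q 2 j) = 0"
      "base_point q (v_matrix q 3 1) = 0" "base_point q (v_matrix q 3 2) = - 1"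
      "base_point q (v_matrix q 4 1) = - 1" "base_point q (v_matrix q 4 2) = 0"
    by (auto simp: sm val cscale_complex_def)
qed


lemma tensor_product_S7_SU: "tensor_product (A_S7 q) (A_SU q)"
  by (intro tensor_product.intro complex_algebra_S7 complex_algebra_SU)

lemma (in complex_algebra) scalar_hom:
  assumes "c \<in> algebra_homs B complex_numbers"
  shows "(\<lambda>x. c x \<odot> \<one>) \<in> algebra_homs B A"
  using algebra_homsD[OF assms]
  by (intro algebra_homsI) (auto simp: smult_l_distr smult_smult smult_mult_left smult_mult_right mult.commute)

text \<open>
  The map \<open>(f \<otimes> g) \<circ> \<delta>\<close>, which is a homomorphism if the images of \<open>f\<close> and \<open>g\<close> commute.
\<close>

definition coaction_map where
  "coaction_map U f g \<delta> p = tensor_lift U (\<lambda>a b. f a \<otimes>\<^bsub>U\<^esub> g b) (\<delta> p)"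

context
  fixes q :: real and \<delta> and U :: "'u calg" and f g
  assumes \<delta>: "is_coaction_R q \<delta>" and U: "complex_algebra U"
    and f: "f \<in> algebra_homs (A_S7 q) U" and g: "g \<in> algebra_homs (A_SU q) U"
    and comm: "\<And>v w. v \<in> carrier (A_S7 q) \<Longrightarrow> w \<in> carrier (A_SU q) \<Longrightarrow> f v \<otimes>\<^bsub>U\<^esub> g w = g w \<otimes>\<^bsub>U\<^esub> f v"
begin

lemma coaction_map_hom: "coaction_map U f g \<delta> \<in> algebra_homs (A_S7 q) U"
proof -
  have d: "\<delta> \<in> algebra_homs (A_S7 q) (tensor_algebra (A_S7 q) (A_SU q))"
    using \<delta> by (simp add: is_coaction_R_def Let_def)
  have l: "tensor_lift U (\<lambda>a b. f a \<otimes>\<^bsub>U\<^esub> g b) \<in> algebra_homs (tensor_algebra (A_S7 q) (A_SU q)) U"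
    by (rule tensor_product.tensor_lift_hom[OF tensor_product_S7_SU U f g comm])
  show ?thesis
    unfolding coaction_map_def
    using algebra_homsD[OF d] algebra_homsD[OF l] by (intro algebra_homsI) simp_all
qed

lemma coaction_map_value:
  assumes "\<delta> x = pure_tensor (A_S7 q) (A_SU q) a b \<oplus>\<^bsub>tensor_algebra (A_S7 q) (A_SU q)\<^esub> pure_tensor (A_S7 q) (A_SU q) a' b'"
    "a \<in> carrier (A_S7 q)" "a' \<in> carrier (A_S7 q)" "b \<in> carrier (A_SU q)" "b' \<in> carrier (A_SU q)"
  shows "coaction_map U f g \<delta> x = f a \<otimes>\<^bsub>U\<^esub> g b \<oplus>\<^bsub>U\<^esub> f a' \<otimes>\<^bsub>U\<^esub> g b'"
proof -
  note l = tensor_product.tensor_lift_hom[OF tensor_product_S7_SU U f g comm]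
  note p = tensor_product.tensor_lift_hom_pure[OF tensor_product_S7_SU U f g]
  note c = tensor_product.pure_closed[OF tensor_product_S7_SU]
  show ?thesis
    using algebra_homsD(3)[OF l c[OF assms(2,4)] c[OF assms(3,5)]] p assms
    by (simp add: coaction_map_def)
qed

lemma coaction_map_v:
  assumes "i \<in> {1..4}" "j \<in> {1, 2}"
  shows "coaction_map U f g \<delta> (v_matrix q i j) =
    f (v_matrix q i 1) \<otimes>\<^bsub>U\<^esub> g (u_matrix q 1 j) \<oplus>\<^bsub>U\<^esub> f (v_matrix q i 2) \<otimes>\<^bsub>U\<^esub> g (u_matrix q 2 j)"
proof (rule coaction_map_value)
  interpret tensor_product "A_S7 q" "A_SU q" by (rule tensor_product_S7_SU)
  have u: "u_matrix q k j \<in> carrier (A_SU q)" if "k \<in> {1, 2}" for k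
    using that assms(2) W.smult_closed by auto
  show "u_matrix q 1 j \<in> carrier (A_SU q)" "u_matrix q 2 j \<in> carrier (A_SU q)" using u by auto
  show "v_matrix q i 1 \<in> carrier (A_S7 q)" "v_matrix q i 2 \<in> carrier (A_S7 q)"
    using assms(1) v_matrix_closed by auto
  have "j \<in> {1..2}" using assms(2) by auto
  then have "\<delta> (v_matrix q i j) = (\<Oplus>\<^bsub>tensor_algebra (A_S7 q) (A_SU q)\<^esub> k \<in> {1..2}.
      pure_tensor (A_S7 q) (A_SU q) (v_matrix q i k) (u_matrix q k j))"
    using \<delta> assms(1) by (simp add: is_coaction_R_def Let_def)
  also have "\<dots> = pure (v_matrix q i 1) (u_matrix q 1 j) \<oplus>\<^bsub>tensor_algebra (A_S7 q) (A_SU q)\<^esub>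
      pure (v_matrix q i 2) (u_matrix q 2 j)"
    using u assms(1) v_matrix_closed by (intro tensor.finsum_pair) auto
  finally show "\<delta> (v_matrix q i j) = pure (v_matrix q i 1) (u_matrix q 1 j) \<oplus>\<^bsub>tensor_algebra (A_S7 q) (A_SU q)\<^esub>
      pure (v_matrix q i 2) (u_matrix q 2 j)" .
qed

end

subsection \<open>The matrices of a cleaving map\<close>

lemma (in complex_algebra) scalar_pair_product:
  assumes "x1 \<in> carrier A" "x2 \<in> carrier A" "y1 \<in> carrier A" "y2 \<in> carrier A"
  shows "(c1 \<odot> x1 \<oplus> c2 \<odot> x2) \<otimes> (d1 \<odot> y1 \<oplus> d2 \<odot> y2) =
    ((c1 * d1) \<odot> (x1 \<otimes> y1) \<oplus> (c2 * d2) \<odot> (x2 \<otimes> y2)) \<oplus>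
    ((c1 * d2) \<odot> (x1 \<otimes> y2) \<oplus> (c2 * d1) \<odot> (x2 \<otimes> y1))"
  using assms by (simp add: l_distr r_distr smult_r_distr smult_mult_left smult_mult_right smult_smult a_ac mult.commute)

definition mutually_inverse :: "'a calg \<Rightarrow> (nat \<Rightarrow> nat \<Rightarrow> 'a) \<Rightarrow> (nat \<Rightarrow> nat \<Rightarrow> 'a) \<Rightarrow> bool" where
  "mutually_inverse U F G \<longleftrightarrow> (\<forall>i\<in>{1, 2}. \<forall>j\<in>{1, 2}. F i j \<in> carrier U \<and> G i j \<in> carrier U \<and>
     F i 1 \<otimes>\<^bsub>U\<^esub> G 1 j \<oplus>\<^bsub>U\<^esub> F i 2 \<otimes>\<^bsub>U\<^esub> G 2 j = of_bool (i = j) \<odot>\<^bsub>U\<^esub> \<one>\<^bsub>U\<^esub> \<and>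
     G i 1 \<otimes>\<^bsub>U\<^esub> F 1 j \<oplus>\<^bsub>U\<^esub> G i 2 \<otimes>\<^bsub>U\<^esub> F 2 j = of_bool (i = j) \<odot>\<^bsub>U\<^esub> \<one>\<^bsub>U\<^esub>)"

lemma (in complex_algebra) mutually_inverse_conjugate:
  assumes FG: "mutually_inverse A F G" and MN: "mutually_inverse complex_numbers M N"
  shows "mutually_inverse A (\<lambda>i j. N i 1 \<odot> F 1 j \<oplus> N i 2 \<odot> F 2 j) (\<lambda>i j. M 1 j \<odot> G i 1 \<oplus> M 2 j \<odot> G i 2)"
  unfolding mutually_inverse_def
proof (intro ballI conjI)
  fix i j :: nat assume ij: "i \<in> {1, 2}" "j \<in> {1, 2}"
  have FGij: "F i 1 \<otimes> G 1 j \<oplus> F i 2 \<otimes> G 2 j = of_bool (i = j) \<odot> \<one>"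
    "G i 1 \<otimes> F 1 j \<oplus> G i 2 \<otimes> F 2 j = of_bool (i = j) \<odot> \<one>" if "i \<in> {1, 2}" "j \<in> {1, 2}" for i j
    using FG that unfolding mutually_inverse_def by blast+
  have MNij: "M i 1 * N 1 j + M i 2 * N 2 j = of_bool (i = j)"
    "N i 1 * M 1 j + N i 2 * M 2 j = of_bool (i = j)" if "i \<in> {1, 2}" "j \<in> {1, 2}" for i j
    using MN that unfolding mutually_inverse_def by auto
  have cl: "F i j \<in> carrier A" "G i j \<in> carrier A" if "i \<in> {1, 2}" "j \<in> {1, 2}" for i j
    using FG that unfolding mutually_inverse_def by blast+
  have [simp]: "F 1 1 \<in> carrier A" "F 1 2 \<in> carrier A" "F 2 1 \<in> carrier A" "F 2 2 \<in> carrier A"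
    "G 1 1 \<in> carrier A" "G 1 2 \<in> carrier A" "G 2 1 \<in> carrier A" "G 2 2 \<in> carrier A"
    "F 1 j \<in> carrier A" "F 2 j \<in> carrier A" "G i 1 \<in> carrier A" "G i 2 \<in> carrier A"
    using cl ij by auto
  show "N i 1 \<odot> F 1 j \<oplus> N i 2 \<odot> F 2 j \<in> carrier A" "M 1 j \<odot> G i 1 \<oplus> M 2 j \<odot> G i 2 \<in> carrier A"
    by simp_all
  have "(N i 1 \<odot> F 1 1 \<oplus> N i 2 \<odot> F 2 1) \<otimes> (M 1 j \<odot> G 1 1 \<oplus> M 2 j \<odot> G 1 2) \<oplus>
      (N i 1 \<odot> F 1 2 \<oplus> N i 2 \<odot> F 2 2) \<otimes> (M 1 j \<odot> G 2 1 \<oplus> M 2 j \<odot> G 2 2) =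
      ((N i 1 * M 1 j) \<odot> (F 1 1 \<otimes> G 1 1 \<oplus> F 1 2 \<otimes> G 2 1) \<oplus> (N i 2 * M 2 j) \<odot> (F 2 1 \<otimes> G 1 2 \<oplus> F 2 2 \<otimes> G 2 2)) \<oplus>
      ((N i 1 * M 2 j) \<odot> (F 1 1 \<otimes> G 1 2 \<oplus> F 1 2 \<otimes> G 2 2) \<oplus> (N i 2 * M 1 j) \<odot> (F 2 1 \<otimes> G 1 1 \<oplus> F 2 2 \<otimes> G 2 1))"
    by (simp add: scalar_pair_product smult_r_distr a_ac)
  also have "\<dots> = (N i 1 * M 1 j + N i 2 * M 2 j) \<odot> \<one>"
    by (simp add: FGij smult_l_distr)
  finally show "(N i 1 \<odot> F 1 1 \<oplus> N i 2 \<odot> F 2 1) \<otimes> (M 1 j \<odot> G 1 1 \<oplus> M 2 j \<odot> G 1 2) \<oplus>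
      (N i 1 \<odot> F 1 2 \<oplus> N i 2 \<odot> F 2 2) \<otimes> (M 1 j \<odot> G 2 1 \<oplus> M 2 j \<odot> G 2 2) = of_bool (i = j) \<odot> \<one>"
    by (simp only: MNij(2)[OF ij])
  have "(M 1 1 \<odot> G i 1 \<oplus> M 2 1 \<odot> G i 2) \<otimes> (N 1 1 \<odot> F 1 j \<oplus> N 1 2 \<odot> F 2 j) \<oplus>
      (M 1 2 \<odot> G i 1 \<oplus> M 2 2 \<odot> G i 2) \<otimes> (N 2 1 \<odot> F 1 j \<oplus> N 2 2 \<odot> F 2 j) =
    ((M 1 1 * N 1 1 + M 1 2 * N 2 1) \<odot> (G i 1 \<otimes> F 1 j) \<oplus> (M 2 1 * N 1 2 + M 2 2 * N 2 2) \<odot> (G i 2 \<otimes> F 2 j)) \<oplus>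
    ((M 1 1 * N 1 2 + M 1 2 * N 2 2) \<odot> (G i 1 \<otimes> F 2 j) \<oplus> (M 2 1 * N 1 1 + M 2 2 * N 2 1) \<odot> (G i 2 \<otimes> F 1 j))"
    by (simp add: scalar_pair_product smult_l_distr a_ac)
  also have "\<dots> = G i 1 \<otimes> F 1 j \<oplus> G i 2 \<otimes> F 2 j"
    by (simp add: MNij)
  finally show "(M 1 1 \<odot> G i 1 \<oplus> M 2 1 \<odot> G i 2) \<otimes> (N 1 1 \<odot> F 1 j \<oplus> N 1 2 \<odot> F 2 j) \<oplus>
      (M 1 2 \<odot> G i 1 \<oplus> M 2 2 \<odot> G i 2) \<otimes> (N 2 1 \<odot> F 1 j \<oplus> N 2 2 \<odot> F 2 j) = of_bool (i = j) \<odot> \<one>"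
    by (simp only: FGij(2)[OF ij])
qed

lemma hom_mutually_inverse:
  assumes f: "f \<in> algebra_homs A U" and A: "complex_algebra A" and FG: "mutually_inverse A F G"
  shows "mutually_inverse U (\<lambda>i j. f (F i j)) (\<lambda>i j. f (G i j))"
  unfolding mutually_inverse_def
proof (intro ballI conjI)
  interpret complex_algebra A by fact
  fix i j :: nat assume ij: "i \<in> {1, 2}" "j \<in> {1, 2}"
  have cl: "F i j \<in> carrier A" "G i j \<in> carrier A" if "i \<in> {1, 2}" "j \<in> {1, 2}" for i j
    using FG that unfolding mutually_inverse_def by blast+
  have c: "F i 1 \<in> carrier A" "F i 2 \<in> carrier A" "F 1 j \<in> carrier A" "F 2 j \<in> carrier A"
     "G i 1 \<in> carrier A" "G i 2 \<in> carrier A" "G 1 j \<in> carrier A" "G 2 j \<in> carrier A"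
    using cl ij by auto
  note D = algebra_homsD[OF f]
  show "f (F i j) \<in> carrier U" "f (G i j) \<in> carrier U" using D(1) cl ij by auto
  have "f (F i 1 \<otimes>\<^bsub>A\<^esub> G 1 j \<oplus>\<^bsub>A\<^esub> F i 2 \<otimes>\<^bsub>A\<^esub> G 2 j) = f (of_bool (i = j) \<odot>\<^bsub>A\<^esub> \<one>\<^bsub>A\<^esub>)"
    "f (G i 1 \<otimes>\<^bsub>A\<^esub> F 1 j \<oplus>\<^bsub>A\<^esub> G i 2 \<otimes>\<^bsub>A\<^esub> F 2 j) = f (of_bool (i = j) \<odot>\<^bsub>A\<^esub> \<one>\<^bsub>A\<^esub>)"
    using FG[unfolded mutually_inverse_def, rule_format, OF ij] by (auto intro: arg_cong[where f = f])
  then show "f (F i 1) \<otimes>\<^bsub>U\<^esub> f (G 1 j) \<oplus>\<^bsub>U\<^esub> f (F i 2) \<otimes>\<^bsub>U\<^esub> f (G 2 j) = of_bool (i = j) \<odot>\<^bsub>U\<^esub> \<one>\<^bsub>U\<^esub>"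
    "f (G i 1) \<otimes>\<^bsub>U\<^esub> f (F 1 j) \<oplus>\<^bsub>U\<^esub> f (G i 2) \<otimes>\<^bsub>U\<^esub> f (F 2 j) = of_bool (i = j) \<odot>\<^bsub>U\<^esub> \<one>\<^bsub>U\<^esub>"
    using c by (simp_all add: D)
qed

lemma tensor_lift_comult:
  fixes U :: "'u calg" and q :: real
  assumes q: "q \<noteq> 0" and ij: "i \<in> {1, 2}" "j \<in> {1, 2}" and U: "complex_algebra U"
    and b: "\<And>v w. v \<in> carrier (A_SU q) \<Longrightarrow> w \<in> carrier (A_SU q) \<Longrightarrow> b v w \<in> carrier U"
    "\<And>v v' w. v \<in> carrier (A_SU q) \<Longrightarrow> v' \<in> carrier (A_SU q) \<Longrightarrow> w \<in> carrier (A_SU q) \<Longrightarrow>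
      b (v \<oplus>\<^bsub>A_SU q\<^esub> v') w = b v w \<oplus>\<^bsub>U\<^esub> b v' w"
    "\<And>v w w'. v \<in> carrier (A_SU q) \<Longrightarrow> w \<in> carrier (A_SU q) \<Longrightarrow> w' \<in> carrier (A_SU q) \<Longrightarrow>
      b v (w \<oplus>\<^bsub>A_SU q\<^esub> w') = b v w \<oplus>\<^bsub>U\<^esub> b v w'"
    "\<And>c v w. v \<in> carrier (A_SU q) \<Longrightarrow> w \<in> carrier (A_SU q) \<Longrightarrow> b (c \<odot>\<^bsub>A_SU q\<^esub> v) w = c \<odot>\<^bsub>U\<^esub> b v w"
    "\<And>c v w. v \<in> carrier (A_SU q) \<Longrightarrow> w \<in> carrier (A_SU q) \<Longrightarrow> b v (c \<odot>\<^bsub>A_SU q\<^esub> w) = c \<odot>\<^bsub>U\<^esub> b v w"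
  shows "tensor_lift U b (SU_comult q (u_matrix q i j)) =
      b (u_matrix q i 1) (u_matrix q 1 j) \<oplus>\<^bsub>U\<^esub> b (u_matrix q i 2) (u_matrix q 2 j)"
proof -
  interpret HH: tensor_product "A_SU q" "A_SU q" by (rule tensor_product_SU)
  have u: "u_matrix q i j \<in> carrier (A_SU q)" if "i \<in> {1, 2}" "j \<in> {1, 2}" for i j
    using that HH.V.smult_closed by auto
  show ?thesis
    unfolding SU_comult_hom(2)[OF q ij]
    using linear_mapsD(2)[OF HH.tensor_lift_linear[OF U b] HH.pure_closed[OF u u] HH.pure_closed[OF u u]]
      HH.tensor_lift_pure[OF U b u u] ij by simp
qed

text \<open>
  What a cleaving map \<open>\<Phi>\<close> leaves behind: the matrix \<open>F\<close> with entries \<open>\<Phi>(u\<^sub>i\<^sub>j)\<close> is invertible over the sphere and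
  transforms like \<open>u\<close>, that is \<open>\<delta>(F) = F u\<close>; it is normalised to be the identity at the base point.
\<close>

definition cleaving_matrices where
  "cleaving_matrices q \<delta> F G \<longleftrightarrow> mutually_inverse (A_S7 q) F G \<and>
     (\<forall>i\<in>{1, 2}. \<forall>j\<in>{1, 2}. base_point q (F i j) = of_bool (i = j) \<and>
       \<delta> (F i j) = pure_tensor (A_S7 q) (A_SU q) (F i 1) (u_matrix q 1 j) \<oplus>\<^bsub>tensor_algebra (A_S7 q) (A_SU q)\<^esub>
         pure_tensor (A_S7 q) (A_SU q) (F i 2) (u_matrix q 2 j))"

lemma cleaving_matricesD:
  assumes "cleaving_matrices q \<delta> F G"
  shows "mutually_inverse (A_S7 q) F G"
    and "i \<in> {1, 2} \<Longrightarrow> j \<in> {1, 2} \<Longrightarrow> F i j \<in> carrier (A_S7 q)"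
    and "i \<in> {1, 2} \<Longrightarrow> j \<in> {1, 2} \<Longrightarrow> G i j \<in> carrier (A_S7 q)"
    and "i \<in> {1, 2} \<Longrightarrow> j \<in> {1, 2} \<Longrightarrow> base_point q (F i j) = of_bool (i = j)"
    and "i \<in> {1, 2} \<Longrightarrow> j \<in> {1, 2} \<Longrightarrow> \<delta> (F i j) =
       pure_tensor (A_S7 q) (A_SU q) (F i 1) (u_matrix q 1 j) \<oplus>\<^bsub>tensor_algebra (A_S7 q) (A_SU q)\<^esub>
       pure_tensor (A_S7 q) (A_SU q) (F i 2) (u_matrix q 2 j)"
  using assms unfolding cleaving_matrices_def mutually_inverse_def by blast+

text \<open>
  Because \<open>\<Delta>(u) = u \<otimes> u\<close> as matrices, the convolution inverse of \<open>\<Phi>\<close> provides the inverse matrix, and the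
  colinearity of \<open>\<Phi>\<close> provides the equivariance. Equivariance and invertibility survive multiplication from the
  left by an invertible scalar matrix, here the inverse of the value at the base point.
\<close>

lemma cleft_matrices:
  assumes q: "q \<noteq> 0" and \<delta>: "is_coaction_R q \<delta>"
    and cleft: "cleft_extension (A_SU q) (SU_comult q) (SU_counit q) B (A_S7 q) \<delta>"
  obtains F G where "cleaving_matrices q \<delta> F G"
proof -
  interpret P: complex_algebra "A_S7 q" by (rule complex_algebra_S7)
  interpret H: complex_algebra "A_SU q" by (rule complex_algebra_SU)
  interpret HH: tensor_product "A_SU q" "A_SU q" by (rule tensor_product_SU)
  interpret PH: tensor_product "A_S7 q" "A_SU q" by (rule tensor_product_S7_SU)
  let ?P = "A_S7 q" and ?H = "A_SU q" and ?PH = "tensor_algebra (A_S7 q) (A_SU q)"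
  obtain \<Phi> \<Psi> where \<Phi>: "\<Phi> \<in> linear_maps ?H ?P" and \<Psi>: "\<Psi> \<in> linear_maps ?H ?P"
    and comodule: "\<And>h. h \<in> carrier ?H \<Longrightarrow> \<delta> (\<Phi> h) =
      tensor_lift ?PH (\<lambda>a b. pure_tensor ?P ?H (\<Phi> a) b) (SU_comult q h)"
    and conv: "\<And>h. h \<in> carrier ?H \<Longrightarrow> convolution (SU_comult q) ?P \<Phi> \<Psi> h = SU_counit q h \<odot>\<^bsub>?P\<^esub> \<one>\<^bsub>?P\<^esub>"
      "\<And>h. h \<in> carrier ?H \<Longrightarrow> convolution (SU_comult q) ?P \<Psi> \<Phi> h = SU_counit q h \<odot>\<^bsub>?P\<^esub> \<one>\<^bsub>?P\<^esub>"
    using cleft unfolding cleft_extension_def comodule_maps_def convolution_invertible_def by blast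
  note \<Phi>D = linear_mapsD[OF \<Phi>] and \<Psi>D = linear_mapsD[OF \<Psi>]
  have u: "u_matrix q i j \<in> carrier ?H" if "i \<in> {1, 2}" "j \<in> {1, 2}" for i j using that H.smult_closed by auto
  note lift = tensor_lift_comult[OF q]
  note u_matrix_simps [simp del]
  let ?F = "\<lambda>i j. \<Phi> (u_matrix q i j)" and ?G = "\<lambda>i j. \<Psi> (u_matrix q i j)"
  have FG: "mutually_inverse ?P ?F ?G"
    unfolding mutually_inverse_def
  proof (intro ballI conjI)
    fix i j :: nat assume ij: "i \<in> {1, 2}" "j \<in> {1, 2}"
    show "?F i j \<in> carrier ?P" "?G i j \<in> carrier ?P" using u ij \<Phi>D(1) \<Psi>D(1) by auto
    show "?F i 1 \<otimes>\<^bsub>?P\<^esub> ?G 1 j \<oplus>\<^bsub>?P\<^esub> ?F i 2 \<otimes>\<^bsub>?P\<^esub> ?G 2 j = of_bool (i = j) \<odot>\<^bsub>?P\<^esub> \<one>\<^bsub>?P\<^esub>"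
      unfolding SU_counit_u_matrix[OF q ij, symmetric] conv(1)[OF u[OF ij], symmetric] convolution_def
      by (subst lift[OF ij P.complex_algebra_axioms])
        (simp_all del: S7_simps add: \<Phi>D \<Psi>D P.l_distr P.r_distr P.smult_mult_left P.smult_mult_right)
    show "?G i 1 \<otimes>\<^bsub>?P\<^esub> ?F 1 j \<oplus>\<^bsub>?P\<^esub> ?G i 2 \<otimes>\<^bsub>?P\<^esub> ?F 2 j = of_bool (i = j) \<odot>\<^bsub>?P\<^esub> \<one>\<^bsub>?P\<^esub>"
      unfolding SU_counit_u_matrix[OF q ij, symmetric] conv(2)[OF u[OF ij], symmetric] convolution_def
      by (subst lift[OF ij P.complex_algebra_axioms])
        (simp_all del: S7_simps add: \<Phi>D \<Psi>D P.l_distr P.r_distr P.smult_mult_left P.smult_mult_right)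
  qed
  have \<delta>F: "\<delta> (?F i j) = PH.pure (?F i 1) (u_matrix q 1 j) \<oplus>\<^bsub>?PH\<^esub> PH.pure (?F i 2) (u_matrix q 2 j)"
    if ij: "i \<in> {1, 2}" "j \<in> {1, 2}" for i j
    unfolding comodule[OF u[OF ij]]
    by (subst lift[OF ij PH.tensor.complex_algebra_axioms])
      (simp_all del: S7_simps add: \<Phi>D PH.pure_add_left PH.pure_add_right PH.pure_smult_left PH.pure_smult_right)
  let ?M = "\<lambda>i j. base_point q (?F i j)" and ?N = "\<lambda>i j. base_point q (?G i j)"
  have MN: "mutually_inverse complex_numbers ?M ?N"
    by (rule hom_mutually_inverse[OF base_point[OF q] P.complex_algebra_axioms FG])
  let ?F' = "\<lambda>i j. ?N i 1 \<odot>\<^bsub>?P\<^esub> ?F 1 j \<oplus>\<^bsub>?P\<^esub> ?N i 2 \<odot>\<^bsub>?P\<^esub> ?F 2 j"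
  have F: "?F i j \<in> carrier ?P" if "i \<in> {1, 2}" "j \<in> {1, 2}" for i j
    using FG that unfolding mutually_inverse_def by blast
  have d: "\<delta> \<in> algebra_homs ?P ?PH" using \<delta> by (simp add: is_coaction_R_def Let_def)
  show ?thesis
  proof (rule that, unfold cleaving_matrices_def, intro conjI ballI)
    show "mutually_inverse ?P ?F' (\<lambda>i j. ?M 1 j \<odot>\<^bsub>?P\<^esub> ?G i 1 \<oplus>\<^bsub>?P\<^esub> ?M 2 j \<odot>\<^bsub>?P\<^esub> ?G i 2)"
      by (rule P.mutually_inverse_conjugate[OF FG MN])
  next
    fix i j :: nat assume ij: "i \<in> {1, 2}" "j \<in> {1, 2}"
    have c: "?F 1 j \<in> carrier ?P" "?F 2 j \<in> carrier ?P" using F ij by auto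
    have "base_point q (?F' i j) = ?N i 1 * ?M 1 j + ?N i 2 * ?M 2 j"
      using algebra_homsD(3)[OF base_point[OF q] P.smult_closed[OF c(1)] P.smult_closed[OF c(2)]]
        algebra_homsD(4)[OF base_point[OF q] c(1)] algebra_homsD(4)[OF base_point[OF q] c(2)] by simp
    also have "\<dots> = of_bool (i = j)"
      using MN ij unfolding mutually_inverse_def by auto
    finally show "base_point q (?F' i j) = of_bool (i = j)" .
    have c': "?F 1 1 \<in> carrier ?P" "?F 1 2 \<in> carrier ?P" "?F 2 1 \<in> carrier ?P" "?F 2 2 \<in> carrier ?P" 
      "u_matrix q 1 j \<in> carrier ?H" "u_matrix q 2 j \<in> carrier ?H"
      using F u ij by auto
    have "\<delta> (?F' i j) = ?N i 1 \<odot>\<^bsub>?PH\<^esub> \<delta> (?F 1 j) \<oplus>\<^bsub>?PH\<^esub> ?N i 2 \<odot>\<^bsub>?PH\<^esub> \<delta> (?F 2 j)"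
      using algebra_homsD(3)[OF d P.smult_closed[OF c(1)] P.smult_closed[OF c(2)]]
        algebra_homsD(4)[OF d c(1)] algebra_homsD(4)[OF d c(2)] by simp
    also have "\<dots> = PH.pure (?F' i 1) (u_matrix q 1 j) \<oplus>\<^bsub>?PH\<^esub> PH.pure (?F' i 2) (u_matrix q 2 j)"
      using c' \<delta>F[of 1 j] \<delta>F[of 2 j] ij(2)
      by (simp del: S7_simps add: PH.pure_add_left PH.pure_smult_left PH.tensor.smult_r_distr PH.tensor.a_ac)
    finally show "\<delta> (?F' i j) = PH.pure (?F' i 1) (u_matrix q 1 j) \<oplus>\<^bsub>?PH\<^esub> PH.pure (?F' i 2) (u_matrix q 2 j)" .
  qed
qed

section \<open>Weighted shifts and their trace\<close>

type_synonym lattice = "int \<times> int"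

lift_definition weighted_shift :: "lattice \<Rightarrow> (lattice \<Rightarrow> complex) \<Rightarrow> lattice linop" is
  "\<lambda>k a f i. a i * f (i + k)"
  by (auto simp: fun_eq_iff algebra_simps)

lemma apply_weighted_shift [simp]: "apply_op (weighted_shift k a) f i = a i * f (i + k)"
  by (simp add: weighted_shift.rep_eq)

lemma weighted_shift_mult: "weighted_shift k a * weighted_shift l b = weighted_shift (k + l) (\<lambda>i. a i * b (i + k))"
  by (rule linop_eqI) (simp add: mult.assoc add.assoc)

lemma weighted_shift_scaleR: "r *\<^sub>R weighted_shift k a = weighted_shift k (\<lambda>i. of_real r * a i)"
  by (rule linop_eqI) (simp add: mult.assoc)

lemma weighted_shift_cscale: "r *\<^sub>C weighted_shift k a = weighted_shift k (\<lambda>i. r * a i)"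
  by (rule linop_eqI) (simp add: mult.assoc)

lemma weighted_shift_add: "weighted_shift k a + weighted_shift k b = weighted_shift k (\<lambda>i. a i + b i)"
  by (rule linop_eqI) (simp add: algebra_simps)

lemma weighted_shift_diff: "weighted_shift k a - weighted_shift k b = weighted_shift k (\<lambda>i. a i - b i)"
  by (rule linop_eqI) (simp add: algebra_simps)

text \<open>
  Finite sums of weighted shifts. With bounded weights they form an algebra and with summable weights an ideal
  of it; they replace the bounded and the trace class operators on \<open>\<ell>\<^sup>2\<close>.
\<close>

inductive_set shift_span :: "(lattice \<Rightarrow> complex) set \<Rightarrow> lattice linop set" for A where
  zero: "0 \<in> shift_span A"
| step: "a \<in> A \<Longrightarrow> X \<in> shift_span A \<Longrightarrow> weighted_shift k a + X \<in> shift_span A"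

lemma shift_span_base: "a \<in> A \<Longrightarrow> weighted_shift k a \<in> shift_span A"
  using shift_span.step[OF _ shift_span.zero, of a A k] by simp

lemma shift_span_add: "X \<in> shift_span A \<Longrightarrow> Y \<in> shift_span A \<Longrightarrow> X + Y \<in> shift_span A"
  by (induction rule: shift_span.induct) (auto simp: add.assoc intro: shift_span.step)

lemma shift_span_cscale:
  assumes "\<And>a. a \<in> A \<Longrightarrow> (\<lambda>i. c * a i) \<in> A"
  shows "X \<in> shift_span A \<Longrightarrow> c *\<^sub>C X \<in> shift_span A"
  by (induction rule: shift_span.induct)
    (auto simp: cscale_add_right weighted_shift_cscale intro: shift_span.intros assms)

lemma shift_span_mult:
  assumes AB: "\<And>a b k. a \<in> A \<Longrightarrow> b \<in> B \<Longrightarrow> (\<lambda>i. a i * b (i + k)) \<in> C"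
  assumes X: "X \<in> shift_span A" and Y: "Y \<in> shift_span B"
  shows "X * Y \<in> shift_span C"
  using X
proof (induction rule: shift_span.induct)
  case (step a X k)
  have "weighted_shift k a * Y \<in> shift_span C"
    using Y
  proof (induction rule: shift_span.induct)
    case (step b Y l)
    then show ?case
      using AB[OF \<open>a \<in> A\<close> step(1), of k] by (simp add: distrib_left weighted_shift_mult shift_span.step)
  qed (simp add: shift_span.zero)
  with step show ?case by (simp add: distrib_right shift_span_add)
qed (simp add: shift_span.zero)

definition bounded_weights :: "(lattice \<Rightarrow> complex) set" where
  "bounded_weights = {a. \<exists>C. \<forall>i. norm (a i) \<le> C}"

definition summable_weights :: "(lattice \<Rightarrow> complex) set" where
  "summable_weights = {a. (\<lambda>i. norm (a i)) summable_on UNIV}"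

abbreviation bounded_ops :: "lattice linop set" where "bounded_ops \<equiv> shift_span bounded_weights"
abbreviation trace_ops :: "lattice linop set" where "trace_ops \<equiv> shift_span summable_weights"

lemma bij_translation: "bij_betw (\<lambda>i :: lattice. i + k) UNIV UNIV"
  by (rule bij_betwI[where g = "\<lambda>i. i - k"]) auto

lemma summable_translate: "a \<in> summable_weights \<Longrightarrow> (\<lambda>i. a (i + k)) \<in> summable_weights"
  unfolding summable_weights_def mem_Collect_eq
  using summable_on_reindex_bij_betw[OF bij_translation[of k], of "\<lambda>i. norm (a i)"] by simp

lemma summable_mult_bounded:
  assumes "a \<in> summable_weights" "b \<in> bounded_weights"
  shows "(\<lambda>i. a i * b (i + k)) \<in> summable_weights" "(\<lambda>i. b i * a (i + k)) \<in> summable_weights"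
proof -
  obtain C where C: "\<And>i. norm (b i) \<le> C" using assms(2) by (auto simp: bounded_weights_def)
  have *: "(\<lambda>i. x i * y i) \<in> summable_weights" if "x \<in> summable_weights" "\<And>i. norm (y i) \<le> C" for x y
  proof -
    have "(\<lambda>i. norm (x i) * C) summable_on UNIV"
      using that(1) by (intro summable_on_cmult_left) (simp add: summable_weights_def)
    then have "(\<lambda>i. norm (x i * y i)) summable_on UNIV"
      by (rule summable_on_comparison_test) (auto simp: norm_mult intro!: mult_left_mono that)
    then show ?thesis by (simp add: summable_weights_def)
  qed
  show "(\<lambda>i. a i * b (i + k)) \<in> summable_weights" by (rule *[OF assms(1)]) (rule C)
  show "(\<lambda>i. b i * a (i + k)) \<in> summable_weights"
    using *[OF summable_translate[OF assms(1), of k], of b] C by (simp add: mult.commute)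
qed

lemma bounded_weights_mult:
  assumes "a \<in> bounded_weights" "b \<in> bounded_weights"
  shows "(\<lambda>i. a i * b (i + k)) \<in> bounded_weights"
proof -
  obtain C D where "\<And>i. norm (a i) \<le> C" "\<And>i. norm (b i) \<le> D"
    using assms by (auto simp: bounded_weights_def)
  then have "norm (a i * b (i + k)) \<le> C * D" for i
    unfolding norm_mult by (intro mult_mono) (auto intro: order_trans[OF norm_ge_zero])
  then show ?thesis by (auto simp: bounded_weights_def)
qed

lemma bounded_weights_cmult: "a \<in> bounded_weights \<Longrightarrow> (\<lambda>i. c * a i) \<in> bounded_weights"
proof -
  assume "a \<in> bounded_weights"
  then obtain C where "\<And>i. norm (a i) \<le> C" by (auto simp: bounded_weights_def)
  then have "norm (c * a i) \<le> norm c * C" for i by (simp add: norm_mult mult_left_mono)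
  then show ?thesis by (auto simp: bounded_weights_def)
qed

lemma summable_weights_cmult: "a \<in> summable_weights \<Longrightarrow> (\<lambda>i. c * a i) \<in> summable_weights"
  by (simp add: summable_weights_def norm_mult summable_on_cmult_right)

lemma bounded_ops_mult: "X \<in> bounded_ops \<Longrightarrow> Y \<in> bounded_ops \<Longrightarrow> X * Y \<in> bounded_ops"
  by (rule shift_span_mult[OF bounded_weights_mult])

lemma trace_ops_mult:
  "X \<in> trace_ops \<Longrightarrow> Y \<in> bounded_ops \<Longrightarrow> X * Y \<in> trace_ops"
  "Y \<in> bounded_ops \<Longrightarrow> X \<in> trace_ops \<Longrightarrow> Y * X \<in> trace_ops"
  by (rule shift_span_mult; use summable_mult_bounded in blast)+

lemma bounded_ops_cscale: "X \<in> bounded_ops \<Longrightarrow> c *\<^sub>C X \<in> bounded_ops"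
  by (rule shift_span_cscale[OF bounded_weights_cmult])

lemma trace_ops_cscale: "X \<in> trace_ops \<Longrightarrow> c *\<^sub>C X \<in> trace_ops"
  by (rule shift_span_cscale[OF summable_weights_cmult])

lemma trace_ops_scaleR: "X \<in> trace_ops \<Longrightarrow> r *\<^sub>R X \<in> trace_ops"
  using trace_ops_cscale[of X "of_real r"] by (simp add: cscale_of_real)

lemma trace_ops_uminus: "X \<in> trace_ops \<Longrightarrow> - X \<in> trace_ops"
  using trace_ops_scaleR[of X "- 1"] by simp

lemma trace_ops_diff: "X \<in> trace_ops \<Longrightarrow> Y \<in> trace_ops \<Longrightarrow> X - Y \<in> trace_ops"
  using shift_span_add[OF _ trace_ops_uminus, of X Y] by simp

lemma trace_bounded: "X \<in> trace_ops \<Longrightarrow> X \<in> bounded_ops"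
proof (induction rule: shift_span.induct)
  case (step a X k)
  have "norm (a i) \<le> infsum (\<lambda>i. norm (a i)) UNIV" for i
    using step(1) infsum_mono_neutral[of "\<lambda>i. norm (a i)" "{i}" "\<lambda>i. norm (a i)" UNIV]
    by (simp add: summable_weights_def)
  then have "a \<in> bounded_weights" by (auto simp: bounded_weights_def)
  with step show ?case by (intro shift_span.step)
qed (rule shift_span.zero)

subsection \<open>The trace\<close>

definition diagonal :: "lattice linop \<Rightarrow> lattice \<Rightarrow> complex" where
  "diagonal X i = apply_op X (\<lambda>j. of_bool (j = i)) i"

definition op_trace :: "lattice linop \<Rightarrow> complex" where
  "op_trace X = (\<Sum>\<^sub>\<infinity>i. diagonal X i)"

lemma diagonal_simps [simp]:
  "diagonal (X + Y) i = diagonal X i + diagonal Y i" "diagonal (X - Y) i = diagonal X i - diagonal Y i"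
  "diagonal (r *\<^sub>R X) i = of_real r * diagonal X i" "diagonal 0 i = 0"
  "diagonal (weighted_shift k a) i = (if k = 0 then a i else 0)"
  by (simp_all add: diagonal_def)

lemma diagonal_fun:
  "diagonal (X + Y) = (\<lambda>i. diagonal X i + diagonal Y i)" "diagonal (r *\<^sub>R X) = (\<lambda>i. of_real r * diagonal X i)"
  "diagonal 0 = (\<lambda>i. 0)" "diagonal (weighted_shift k a) = (\<lambda>i. if k = 0 then a i else 0)"
  by (rule ext; simp)+

lemma diagonal_summable: "X \<in> trace_ops \<Longrightarrow> diagonal X summable_on UNIV"
proof (induction rule: shift_span.induct)
  case (step a X k)
  have "(\<lambda>i. norm (a i)) summable_on UNIV"
    using step(1) unfolding summable_weights_def by blast
  then have a: "a summable_on UNIV" by (rule abs_summable_summable)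
  have "(\<lambda>i. if k = 0 then a i else 0) summable_on UNIV"
  proof (cases "k = 0")
    case True
    then show ?thesis using a by simp
  qed simp
  moreover have "diagonal (weighted_shift k a + X) = (\<lambda>i. (if k = 0 then a i else 0) + diagonal X i)"
    by (rule ext) simp
  ultimately show ?case using step(3) by (simp only: summable_on_add)
next
  case zero
  have "diagonal 0 = (\<lambda>i. 0)" by (rule ext) simp
  then show ?case by simp
qed

lemma op_trace_add: "X \<in> trace_ops \<Longrightarrow> Y \<in> trace_ops \<Longrightarrow> op_trace (X + Y) = op_trace X + op_trace Y"
  unfolding op_trace_def diagonal_fun by (intro infsum_add diagonal_summable)

lemma op_trace_scaleR: "op_trace (r *\<^sub>R X) = of_real r * op_trace X"
  unfolding op_trace_def diagonal_fun by (rule infsum_cmult_right')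

lemma op_trace_diff: "X \<in> trace_ops \<Longrightarrow> Y \<in> trace_ops \<Longrightarrow> op_trace (X - Y) = op_trace X - op_trace Y"
  using op_trace_add[OF _ trace_ops_scaleR, of X Y "- 1"] op_trace_scaleR[of "- 1" Y] by simp

lemma op_trace_zero [simp]: "op_trace 0 = 0"
  by (simp add: op_trace_def diagonal_fun)

lemma op_trace_weighted_shift: "op_trace (weighted_shift k a) = (if k = 0 then (\<Sum>\<^sub>\<infinity>i. a i) else 0)"
  by (simp add: op_trace_def diagonal_fun)

text \<open>
  Only products of opposite shifts reach the diagonal, and there the two sums differ by a translation of the
  index.
\<close>

lemma op_trace_commute:
  assumes X: "X \<in> trace_ops" and Y: "Y \<in> bounded_ops"
  shows "op_trace (X * Y) = op_trace (Y * X)"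
  using X
proof (induction rule: shift_span.induct)
  case (step a X k)
  have "op_trace (weighted_shift k a * Y) = op_trace (Y * weighted_shift k a)"
    using Y
  proof (induction rule: shift_span.induct)
    case (step b Y l)
    have "op_trace (weighted_shift k a * weighted_shift l b) = op_trace (weighted_shift l b * weighted_shift k a)"
    proof (cases "l = - k")
      case True
      have "(\<Sum>\<^sub>\<infinity>i. b i * a (i + l)) = (\<Sum>\<^sub>\<infinity>i. b (i + k) * a (i + k + l))"
        using infsum_reindex_bij_betw[OF bij_translation[of k], of "\<lambda>i. b i * a (i + l)"] by simp
      then show ?thesis
        using True by (simp add: weighted_shift_mult op_trace_weighted_shift mult.commute)
    next
      case False
      then have "k + l \<noteq> 0" "l + k \<noteq> 0" by (auto simp: add_eq_0_iff)
      then show ?thesis by (simp add: weighted_shift_mult op_trace_weighted_shift)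
    qed
    moreover have a: "weighted_shift k a \<in> trace_ops" by (rule shift_span_base) fact
    moreover have b: "weighted_shift l b \<in> bounded_ops" by (rule shift_span_base) fact
    ultimately show ?case
      using step trace_ops_mult(1)[OF a b] trace_ops_mult(2)[OF b a] trace_ops_mult(1)[OF a step(2)]
        trace_ops_mult(2)[OF step(2) a]
      by (simp add: distrib_left distrib_right op_trace_add)
  qed simp
  moreover have a: "weighted_shift k a \<in> trace_ops" by (rule shift_span_base) fact
  ultimately show ?case
    using step trace_ops_mult(1)[OF a Y] trace_ops_mult(2)[OF Y a] trace_ops_mult(1)[OF step(2) Y]
      trace_ops_mult(2)[OF Y step(2)]
    by (simp add: distrib_left distrib_right op_trace_add)
qed simp

text \<open>
  The trace of a commutator of two bounded operators, provided that it exists, depends on the operators only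
  modulo the trace class: the correction terms are commutators with a trace class operator.
\<close>

lemma trace_commutator:
  assumes "X \<in> bounded_ops" "X' \<in> bounded_ops" "i \<in> trace_ops" "j \<in> trace_ops"
  shows "((X + i) * (X' + j) - (X' + j) * (X + i)) - (X * X' - X' * X) \<in> trace_ops"
    and "op_trace (((X + i) * (X' + j) - (X' + j) * (X + i)) - (X * X' - X' * X)) = 0"
proof -
  have eq: "((X + i) * (X' + j) - (X' + j) * (X + i)) - (X * X' - X' * X) =
      (i * X' - X' * i) + (X * j - j * X) + (i * j - j * i)"
    by (simp add: algebra_simps)
  note t = trace_ops_mult(1)[OF assms(3,2)] trace_ops_mult(2)[OF assms(2,3)] trace_ops_mult(1)[OF assms(4,1)]
    trace_ops_mult(2)[OF assms(1,4)] trace_ops_mult(1)[OF assms(3) trace_bounded[OF assms(4)]]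
    trace_ops_mult(1)[OF assms(4) trace_bounded[OF assms(3)]]
  show "((X + i) * (X' + j) - (X' + j) * (X + i)) - (X * X' - X' * X) \<in> trace_ops"
    unfolding eq by (intro shift_span_add trace_ops_diff t)
  show "op_trace (((X + i) * (X' + j) - (X' + j) * (X + i)) - (X * X' - X' * X)) = 0"
    unfolding eq using t op_trace_commute[OF assms(3,2)] op_trace_commute[OF assms(4,1)]
      op_trace_commute[OF assms(3) trace_bounded[OF assms(4)]]
    by (simp add: op_trace_add op_trace_diff shift_span_add trace_ops_diff)
qed

section \<open>Restriction to the fibre of the base point\<close>

text \<open>
  The coaction followed by evaluation at the base point in the first factor is the restriction of functions
  to the fibre through the base point, which is a copy of quantum \<open>SU(2)\<close> represented here by \<open>u\<close>.
\<close>

definition fibre_hom where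
  "fibre_hom q \<delta> e u = coaction_map (corner e) (\<lambda>p. base_point q p *\<^sub>C e)
     (induced_hom (corner e) (SU_assignment (corner e) q u)) \<delta>"

context
  fixes q :: real and \<delta> and e :: "'r::complex_ring" and u
  assumes q: "q \<noteq> 0" and \<delta>: "is_coaction_R q \<delta>" and e: "e * e = e" and u: "quantum_SL2 (corner e) q u"
begin

lemma scalar_base: "(\<lambda>p. base_point q p *\<^sub>C e) \<in> algebra_homs (A_S7 q) (corner e)"
  using complex_algebra.scalar_hom[OF complex_algebra_corner[OF e] base_point[OF q]] by simp

lemma fibre_comm:
  assumes "w \<in> carrier (A_SU q)"
  shows "(base_point q v *\<^sub>C e) \<otimes>\<^bsub>corner e\<^esub> induced_hom (corner e) (SU_assignment (corner e) q u) w =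
    induced_hom (corner e) (SU_assignment (corner e) q u) w \<otimes>\<^bsub>corner e\<^esub> (base_point q v *\<^sub>C e)"
  using algebra_homsD(1)[OF SU_hom[OF q complex_algebra_corner[OF e] u] assms]
  by (simp add: cscale_mult_left cscale_mult_right)

lemma fibre_hom: "fibre_hom q \<delta> e u \<in> algebra_homs (A_S7 q) (corner e)"
  unfolding fibre_hom_def
  by (rule coaction_map_hom[OF \<delta> complex_algebra_corner[OF e] scalar_base
        SU_hom[OF q complex_algebra_corner[OF e] u] fibre_comm])

lemma u_corner: "i \<in> {1, 2} \<Longrightarrow> j \<in> {1, 2} \<Longrightarrow> e * u i j = u i j"
  using u unfolding quantum_SL2_corner by blast

text \<open>
  The rows of \<open>v\<close> at the base point are multiplied by \<open>u\<close>, so the coordinates on the fibre are entries of \<open>u\<close>.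
\<close>

lemma fibre_hom_v:
  assumes "i \<in> {1..4}" "j \<in> {1, 2}"
  shows "fibre_hom q \<delta> e u (v_matrix q i j) =
    base_point q (v_matrix q i 1) *\<^sub>C u 1 j + base_point q (v_matrix q i 2) *\<^sub>C u 2 j"
proof -
  have g: "induced_hom (corner e) (SU_assignment (corner e) q u) (u_matrix q k j) = u k j" if "k \<in> {1, 2}" for k
    by (rule SU_hom_u_matrix[OF q complex_algebra_corner[OF e] u that assms(2)])
  have "fibre_hom q \<delta> e u (v_matrix q i j) =
      (base_point q (v_matrix q i 1) *\<^sub>C e) \<otimes>\<^bsub>corner e\<^esub> induced_hom (corner e) (SU_assignment (corner e) q u) (u_matrix q 1 j)
      \<oplus>\<^bsub>corner e\<^esub>
      (base_point q (v_matrix q i 2) *\<^sub>C e) \<otimes>\<^bsub>corner e\<^esub> induced_hom (corner e) (SU_assignment (corner e) q u) (u_matrix q 2 j)"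
    unfolding fibre_hom_def
    by (rule coaction_map_v[OF \<delta> complex_algebra_corner[OF e] scalar_base
        SU_hom[OF q complex_algebra_corner[OF e] u] fibre_comm assms])
  then show ?thesis
    using g[of 1] g[of 2] u_corner[of 1 j] u_corner[of 2 j] assms(2) by (simp add: cscale_mult_left)
qed

lemma fibre_hom_values:
  "fibre_hom q \<delta> e u (x_gen q 1) = 0" "fibre_hom q \<delta> e u (x_gen q 2) = 0"
  "fibre_hom q \<delta> e u (x_gen q 3) = - q *\<^sub>R u 2 1" "fibre_hom q \<delta> e u (x_gen q 4) = u 2 2"
  "fibre_hom q \<delta> e u (x_bar q 1) = 0" "fibre_hom q \<delta> e u (x_bar q 2) = 0"
  "fibre_hom q \<delta> e u (x_bar q 3) = u 1 2" "fibre_hom q \<delta> e u (x_bar q 4) = u 1 1"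
proof -
  have s: "fibre_hom q \<delta> e u (complex_of_real c \<odot>\<^bsub>A_Sp q\<^esub> x) = c *\<^sub>R fibre_hom q \<delta> e u x"
    if "x \<in> carrier (A_S7 q)" for c x
    using algebra_homsD(4)[OF fibre_hom that, of "complex_of_real c"] by (simp add: cscale_of_real)
  have m: "(- 1) *\<^sub>C x = - x" for x :: 'r
    using cscale_of_real[of "- 1" x] by simp
  have v: "fibre_hom q \<delta> e u (v_matrix q 1 1) = 0" "fibre_hom q \<delta> e u (v_matrix q 1 2) = 0"
    "fibre_hom q \<delta> e u (v_matrix q 2 1) = 0" "fibre_hom q \<delta> e u (v_matrix q 2 2) = 0"
    "fibre_hom q \<delta> e u (v_matrix q 3 1) = - u 2 1" "fibre_hom q \<delta> e u (v_matrix q 3 2) = - u 2 2"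
    "fibre_hom q \<delta> e u (v_matrix q 4 1) = - u 1 1" "fibre_hom q \<delta> e u (v_matrix q 4 2) = - u 1 2"
    by (simp_all add: fibre_hom_v base_point_v[OF q] m del: v_matrix_simps)
  have inj: "c \<noteq> 0 \<Longrightarrow> c *\<^sub>R x = y \<Longrightarrow> x = inverse c *\<^sub>R y" for c and x y :: 'r by auto
  have z: "c \<noteq> 0 \<Longrightarrow> c *\<^sub>R x = 0 \<Longrightarrow> x = 0" for c and x :: 'r by simp
  have 1: "q powi -3 *\<^sub>R fibre_hom q \<delta> e u (x_gen q 1) = 0"
    using v(1) s[OF x_gen_closed[of 1 q], of "q powi -3"] unfolding v_matrix_simps by simp
  have 2: "q powi -2 *\<^sub>R fibre_hom q \<delta> e u (x_gen q 2) = 0"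
    using v(2) s[OF x_gen_closed[of 2 q], of "q powi -2"] unfolding v_matrix_simps by simp
  have 3: "- (q powi -1) *\<^sub>R fibre_hom q \<delta> e u (x_bar q 2) = 0"
    using v(3) s[OF x_bar_closed[of 2 q], of "- (q powi -1)"] unfolding v_matrix_simps by simp
  have 4: "q powi -1 *\<^sub>R fibre_hom q \<delta> e u (x_bar q 1) = 0"
    using v(4) s[OF x_bar_closed[of 1 q], of "q powi -1"] unfolding v_matrix_simps by simp
  have 5: "q powi -1 *\<^sub>R fibre_hom q \<delta> e u (x_gen q 3) = - u 2 1"
    using v(5) s[OF x_gen_closed[of 3 q], of "q powi -1"] unfolding v_matrix_simps by simp
  have 6: "- 1 *\<^sub>R fibre_hom q \<delta> e u (x_gen q 4) = - u 2 2"
    using v(6) s[OF x_gen_closed[of 4 q], of "- 1"] unfolding v_matrix_simps by simp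
  have 7: "- 1 *\<^sub>R fibre_hom q \<delta> e u (x_bar q 4) = - u 1 1"
    using v(7) s[OF x_bar_closed[of 4 q], of "- 1"] unfolding v_matrix_simps by simp
  have 8: "- 1 *\<^sub>R fibre_hom q \<delta> e u (x_bar q 3) = - u 1 2"
    using v(8) s[OF x_bar_closed[of 3 q], of "- 1"] unfolding v_matrix_simps by simp
  show "fibre_hom q \<delta> e u (x_gen q 1) = 0" "fibre_hom q \<delta> e u (x_gen q 2) = 0"
    "fibre_hom q \<delta> e u (x_bar q 1) = 0" "fibre_hom q \<delta> e u (x_bar q 2) = 0"
    using 1 2 3 4 q by simp_all
  show "fibre_hom q \<delta> e u (x_gen q 3) = - q *\<^sub>R u 2 1"
    using inj[OF _ 5] q by (simp add: power_int_minus)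
  show "fibre_hom q \<delta> e u (x_gen q 4) = u 2 2"
    "fibre_hom q \<delta> e u (x_bar q 3) = u 1 2" "fibre_hom q \<delta> e u (x_bar q 4) = u 1 1"
    using 6 7 8 by simp_all
qed

text \<open>An equivariant matrix is determined on the fibre by its value at the base point.\<close>

lemma fibre_hom_equivariant:
  assumes FG: "cleaving_matrices q \<delta> F G"
    and ij: "i \<in> {1, 2}" "j \<in> {1, 2}"
  shows "fibre_hom q \<delta> e u (F i j) = u i j"
proof -
  note F = cleaving_matricesD(2)[OF FG] and base = cleaving_matricesD(4)[OF FG] and \<delta>F = cleaving_matricesD(5)[OF FG]
  have g: "induced_hom (corner e) (SU_assignment (corner e) q u) (u_matrix q k j) = u k j" if "k \<in> {1, 2}" for k
    by (rule SU_hom_u_matrix[OF q complex_algebra_corner[OF e] u that ij(2)])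
  have um: "u_matrix q k j \<in> carrier (A_SU q)" if "k \<in> {1, 2}" for k
    using that ij(2) complex_algebra.smult_closed[OF complex_algebra_SU] by auto
  have F': "F i 1 \<in> carrier (A_S7 q)" "F i 2 \<in> carrier (A_S7 q)" using F ij(1) by auto
  have um': "u_matrix q 1 j \<in> carrier (A_SU q)" "u_matrix q 2 j \<in> carrier (A_SU q)" using um by auto
  have "fibre_hom q \<delta> e u (F i j) = base_point q (F i 1) *\<^sub>C u 1 j + base_point q (F i 2) *\<^sub>C u 2 j"
    unfolding fibre_hom_def
    by (subst coaction_map_value[OF \<delta> complex_algebra_corner[OF e] scalar_base
        SU_hom[OF q complex_algebra_corner[OF e] u] fibre_comm \<delta>F[OF ij] F' um'], assumption)
      (use g[of 1] g[of 2] u_corner[of 1 j] u_corner[of 2 j] ij(2) in \<open>simp add: cscale_mult_left\<close>)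
  then show ?thesis using base[of i 1] base[of i 2] ij(1) by auto
qed

end

section \<open>The index obstruction\<close>

lemma matrix_one_entries:
  "mutually_inverse (corner e) X X' \<Longrightarrow> i \<in> {1, 2} \<Longrightarrow> j \<in> {1, 2} \<Longrightarrow>
     X i 1 * X' 1 j + X i 2 * X' 2 j = of_bool (i = j) *\<^sub>R e \<and> X' i 1 * X 1 j + X' i 2 * X 2 j = of_bool (i = j) *\<^sub>R e"
  unfolding mutually_inverse_def using cscale_of_real[of "of_bool (i = j)" e] by auto

text \<open>
  The operators \<open>u\<close> and \<open>w\<close> represent the functions on the ball \<open>x\<^sub>1 = 0\<close> and \<open>h\<close> those on its boundary, the fibre. As
  for Toeplitz operators, the former are compressions of the latter by the projection \<open>e\<close> up to a trace class
  error, and \<open>e\<close> commutes with the latter up to such an error. The coordinate \<open>x\<^sub>2\<close> and its conjugate, which vanish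
  on the boundary, are trace class on the ball.
\<close>

context
  fixes q :: real and \<delta> and e f :: "lattice linop" and u w h
  assumes q: "q \<noteq> 0" and \<delta>: "is_coaction_R q \<delta>"
    and e: "e * e = e" and f: "f * f = f" and ef: "e * f = e" "f * e = e"
    and u: "quantum_SL2 (corner e) q u" and w: "quantum_SL2 (corner e) (q\<^sup>2) w" and h: "quantum_SL2 (corner f) q h"
    and comm: "\<And>i j k l. i \<in> {1, 2} \<Longrightarrow> j \<in> {1, 2} \<Longrightarrow> k \<in> {1, 2} \<Longrightarrow> l \<in> {1, 2} \<Longrightarrow> u i j * w k l = w k l * u i j"
    and bounded: "e \<in> bounded_ops" "f \<in> bounded_ops"
      "\<And>i j. i \<in> {1, 2} \<Longrightarrow> j \<in> {1, 2} \<Longrightarrow> u i j \<in> bounded_ops \<and> w i j \<in> bounded_ops \<and> h i j \<in> bounded_ops"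
    and boundary: "\<And>i j. i \<in> {1, 2} \<Longrightarrow> j \<in> {1, 2} \<Longrightarrow> e * h i j - h i j * e \<in> trace_ops"
    and limit: "u 1 1 - e * h 1 1 * e \<in> trace_ops" "q *\<^sub>R (w 1 1 * u 2 1) - e * h 1 2 * e \<in> trace_ops"
      "inverse q *\<^sub>R (w 2 2 * u 1 2) - e * h 2 1 * e \<in> trace_ops" "u 2 2 - e * h 2 2 * e \<in> trace_ops"
    and vanish: "w 1 2 * u 1 2 \<in> trace_ops" "w 2 1 * u 2 1 \<in> trace_ops"
begin

abbreviation "ball_hom \<equiv> sphere_hom q e w u"
abbreviation "boundary_hom \<equiv> fibre_hom q \<delta> f h"

lemma ball_hom_values:
  "ball_hom (x_gen q 1) = 0" "ball_hom (x_gen q 2) = - (w 1 2 * u 1 2)"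
  "ball_hom (x_gen q 3) = - (w 2 2 * u 1 2)" "ball_hom (x_gen q 4) = u 2 2"
  "ball_hom (x_bar q 1) = 0" "ball_hom (x_bar q 2) = - (q ^ 3) *\<^sub>R (w 2 1 * u 2 1)"
  "ball_hom (x_bar q 3) = q *\<^sub>R (w 1 1 * u 2 1)" "ball_hom (x_bar q 4) = u 1 1"
  by (rule sphere_hom_values[OF q e u w comm]; assumption)+

lemma ball_hom: "ball_hom \<in> algebra_homs (A_S7 q) (corner e)"
  by (rule sphere_hom[OF q e u w comm])

definition "compatible X Y \<longleftrightarrow> X \<in> bounded_ops \<and> Y \<in> bounded_ops \<and> e * X = X \<and> X * e = X \<and>
   e * Y - Y * e \<in> trace_ops \<and> X - e * Y * e \<in> trace_ops"

lemma compatible_add: "compatible X Y \<Longrightarrow> compatible X' Y' \<Longrightarrow> compatible (X + X') (Y + Y')"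
proof -
  assume a: "compatible X Y" "compatible X' Y'"
  have eq: "e * (Y + Y') - (Y + Y') * e = (e * Y - Y * e) + (e * Y' - Y' * e)"
    "X + X' - e * (Y + Y') * e = (X - e * Y * e) + (X' - e * Y' * e)"
    "e * (X + X') = e * X + e * X'" "(X + X') * e = X * e + X' * e"
    by (simp_all add: algebra_simps)
  show ?thesis
    using a unfolding compatible_def eq by (intro conjI shift_span_add) simp_all
qed

lemma compatible_cscale: "compatible X Y \<Longrightarrow> compatible (c *\<^sub>C X) (c *\<^sub>C Y)"
proof -
  assume a: "compatible X Y"
  have d: "c *\<^sub>C (A - B) = c *\<^sub>C A - c *\<^sub>C B" for A B :: "lattice linop"
    using cscale_add_right[of c "A - B" B] by simp
  have eq: "e * (c *\<^sub>C Y) - (c *\<^sub>C Y) * e = c *\<^sub>C (e * Y - Y * e)"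
    "c *\<^sub>C X - e * (c *\<^sub>C Y) * e = c *\<^sub>C (X - e * Y * e)"
    "e * (c *\<^sub>C X) = c *\<^sub>C (e * X)" "(c *\<^sub>C X) * e = c *\<^sub>C (X * e)"
    by (simp_all add: d cscale_mult_left cscale_mult_right)
  show ?thesis
    using a unfolding compatible_def eq by (intro conjI bounded_ops_cscale trace_ops_cscale) simp_all
qed

lemma compatible_mult:
  assumes a: "compatible X Y" and b: "compatible X' Y'"
  shows "compatible (X * X') (Y * Y')"
proof -
  have B: "X \<in> bounded_ops" "Y \<in> bounded_ops" "X' \<in> bounded_ops" "Y' \<in> bounded_ops"
    and E: "e * X = X" "X * e = X" "e * X' = X'" "X' * e = X'"
    and K: "e * Y - Y * e \<in> trace_ops" "e * Y' - Y' * e \<in> trace_ops"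
    and D: "X - e * Y * e \<in> trace_ops" "X' - e * Y' * e \<in> trace_ops"
    using a b unfolding compatible_def by auto
  have 1: "e * (Y * Y') - Y * Y' * e = (e * Y - Y * e) * Y' + Y * (e * Y' - Y' * e)"
    by (simp add: algebra_simps)
  have 2: "e * (X * X') = X * X'" "X * X' * e = X * X'"
    by (simp_all add: mult.assoc[symmetric] E) (simp add: mult.assoc E)
  have "e * Y * e * (e * Y' * e) - e * (Y * Y') * e = e * (Y * ((e * Y' - Y' * e) * e))"
  proof -
    have "e * (Y * ((e * Y' - Y' * e) * e)) = e * Y * e * Y' * e - e * (Y * Y') * (e * e)"
      by (simp add: algebra_simps)
    moreover have "e * Y * e * (e * Y' * e) = e * Y * (e * e) * Y' * e" by (simp add: mult.assoc)
    ultimately show ?thesis by (simp add: e mult.assoc)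
  qed
  then have 3: "X * X' - e * (Y * Y') * e =
      X * (X' - e * Y' * e) + (X - e * Y * e) * (e * Y' * e) + e * (Y * ((e * Y' - Y' * e) * e))"
    by (simp add: algebra_simps)
  show ?thesis
    unfolding compatible_def 1 3 2
    by (intro conjI refl shift_span_add bounded_ops_mult B trace_ops_mult(1)[OF K(1) B(4)]
        trace_ops_mult(2)[OF B(2) K(2)] trace_ops_mult(2)[OF B(1) D(2)]
        trace_ops_mult(1)[OF D(1) bounded_ops_mult[OF bounded_ops_mult[OF bounded(1) B(4)] bounded(1)]]
        trace_ops_mult(2)[OF bounded(1) trace_ops_mult(2)[OF B(2) trace_ops_mult(1)[OF K(2) bounded(1)]]])
qed

text \<open>
  Being a compression up to trace class is preserved by sums and products, so it is enough that it holds for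
  the coordinates.
\<close>

lemma compatible_homs: "p \<in> carrier (A_S7 q) \<Longrightarrow> compatible (ball_hom p) (boundary_hom p)"
proof (induction rule: S7_induct)
  note bh = algebra_homsD[OF ball_hom] and fh = algebra_homsD[OF fibre_hom[OF q \<delta> f h]]
  have u': "e * u i j = u i j" "u i j * e = u i j" "e * w i j = w i j" if "i \<in> {1, 2}" "j \<in> {1, 2}" for i j
    using u w that unfolding quantum_SL2_corner by blast+
  have t0: "0 \<in> trace_ops" "0 \<in> bounded_ops" by (rule shift_span.zero)+
  have ub: "u i j \<in> bounded_ops" "w i j \<in> bounded_ops" "h i j \<in> bounded_ops" if "i \<in> {1, 2}" "j \<in> {1, 2}" for i j
    using bounded(3) that by auto
  have wu: "compatible 0 0"
    unfolding compatible_def using t0 by simp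
  have prod: "e * (w i j * u k l) = w i j * u k l" "w i j * u k l * e = w i j * u k l" "w i j * u k l \<in> bounded_ops"
    if "i \<in> {1, 2}" "j \<in> {1, 2}" "k \<in> {1, 2}" "l \<in> {1, 2}" for i j k l
    using u'(3)[OF that(1,2)] u'(2)[OF that(3,4)] bounded_ops_mult[OF ub(2)[OF that(1,2)] ub(1)[OF that(3,4)]]
    by (simp_all add: mult.assoc) (simp add: mult.assoc[symmetric])
  have neg: "compatible X Y \<Longrightarrow> compatible (r *\<^sub>R X) (r *\<^sub>R Y)" for X Y r
    using compatible_cscale[of X Y "of_real r"] by (simp add: cscale_of_real)
  have prod0: "compatible (w i j * u k l) 0"
    if "i \<in> {1, 2}" "j \<in> {1, 2}" "k \<in> {1, 2}" "l \<in> {1, 2}" "w i j * u k l \<in> trace_ops" for i j k l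
    unfolding compatible_def using prod[OF that(1-4)] t0 that(5) by simp
  {
    case one
    show ?case
      using bh(5) fh(5) e f ef bounded t0 by (simp add: compatible_def)
  next
    case (x i)
    then consider "i = 1" | "i = 2" | "i = 3" | "i = 4" by (auto simp: atLeastAtMost_1_4)
    then show ?case
    proof cases
      case 1 then show ?thesis by (simp add: ball_hom_values fibre_hom_values[OF q \<delta> f h] wu)
    next
      case 2
      show ?thesis
        using neg[OF prod0[OF _ _ _ _ vanish(1)], of "- 1"]
        by (simp add: 2 ball_hom_values fibre_hom_values[OF q \<delta> f h])
    next
      case 3
      have "compatible (inverse q *\<^sub>R (w 2 2 * u 1 2)) (h 2 1)"
        unfolding compatible_def
        using prod[of 2 2 1 2] ub(3)[of 2 1] boundary[of 2 1] limit(3)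
          bounded_ops_cscale[of "w 2 2 * u 1 2" "of_real (inverse q)", unfolded cscale_of_real] by simp
      from neg[OF this, of "- q"] show ?thesis
        using q by (simp add: 3 ball_hom_values fibre_hom_values[OF q \<delta> f h])
    next
      case 4
      then show ?thesis
        using u'[of 2 2] ub[of 2 2] boundary[of 2 2] limit(4)
        by (simp add: ball_hom_values fibre_hom_values[OF q \<delta> f h] compatible_def)
    qed
  next
    case (x_bar i)
    then consider "i = 1" | "i = 2" | "i = 3" | "i = 4" by (auto simp: atLeastAtMost_1_4)
    then show ?case
    proof cases
      case 1 then show ?thesis by (simp add: ball_hom_values fibre_hom_values[OF q \<delta> f h] wu)
    next
      case 2
      show ?thesis
        using neg[OF prod0[OF _ _ _ _ vanish(2)], of "- (q ^ 3)"]
        by (simp add: 2 ball_hom_values fibre_hom_values[OF q \<delta> f h])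
    next
      case 3
      show ?thesis
        unfolding 3 compatible_def ball_hom_values fibre_hom_values[OF q \<delta> f h]
        using prod[of 1 1 2 1] ub(3)[of 1 2] boundary[of 1 2] limit(2)
          bounded_ops_cscale[of "w 1 1 * u 2 1" "of_real q", unfolded cscale_of_real] by simp
    next
      case 4
      then show ?thesis
        using u'[of 1 1] ub[of 1 1] boundary[of 1 1] limit(1)
        by (simp add: ball_hom_values fibre_hom_values[OF q \<delta> f h] compatible_def)
    qed
  next
    case (add x y)
    then show ?case using compatible_add bh(3) fh(3) by simp
  next
    case (mult x y)
    then show ?case using compatible_mult bh(2) fh(2) by simp
  next
    case (smult c x)
    then show ?case using compatible_cscale bh(4) fh(4) by simp
  }
qed


text \<open>
  On the boundary \<open>F\<close> is \<open>h\<close>, so on the ball the matrices \<open>X\<close> of \<open>F\<close> and \<open>X'\<close> of its inverse agree modulo the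
  trace class with any lifts of \<open>h\<close> and of \<open>h\<^sup>-\<^sup>1\<close>. The sum of the diagonal entries of \<open>X X' - X' X\<close> is a sum of
  commutators of entries, so its trace is the same as for the lifts. It is zero because \<open>X X' = X' X = 1\<close>, while the
  lifts built from \<open>u\<close> and \<open>w\<close> give \<open>- (q - q\<^sup>-\<^sup>1) (q\<^sup>2 - q\<^sup>-\<^sup>2)\<close> times the trace of \<open>w\<^sub>1\<^sub>2 w\<^sub>2\<^sub>1 u\<^sub>1\<^sub>2 u\<^sub>2\<^sub>1\<close>.
\<close>

lemma index_vanishes:
  assumes cleaving: "cleaving_matrices q \<delta> F G"
  shows "(q - inverse q) * (q\<^sup>2 - inverse q ^ 2) = 0 \<or> op_trace (w 1 2 * w 2 1 * (u 1 2 * u 2 1)) = 0"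
proof -
  let ?X = "\<lambda>i j. ball_hom (F i j)" and ?X' = "\<lambda>i j. ball_hom (G i j)" and ?Y' = "\<lambda>i j. boundary_hom (G i j)"
  note FG = cleaving_matricesD(1)[OF cleaving] and F = cleaving_matricesD(2,3)[OF cleaving]
  have Y: "boundary_hom (F i j) = h i j" if "i \<in> {1, 2}" "j \<in> {1, 2}" for i j
    by (rule fibre_hom_equivariant[OF q \<delta> f h cleaving that])
  have XX: "?X i 1 * ?X' 1 j + ?X i 2 * ?X' 2 j = of_bool (i = j) *\<^sub>R e"
    "?X' i 1 * ?X 1 j + ?X' i 2 * ?X 2 j = of_bool (i = j) *\<^sub>R e" if "i \<in> {1, 2}" "j \<in> {1, 2}" for i j
    using matrix_one_entries[OF hom_mutually_inverse[OF ball_hom complex_algebra_S7 FG] that] by auto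
  have YY: "?Y' i 1 * h 1 j + ?Y' i 2 * h 2 j = of_bool (i = j) *\<^sub>R f" if "i \<in> {1, 2}" "j \<in> {1, 2}" for i j
    using matrix_one_entries[OF hom_mutually_inverse[OF fibre_hom[OF q \<delta> f h] complex_algebra_S7 FG] that] Y that
    by auto
  have Yf: "?Y' i j * f = ?Y' i j" if "i \<in> {1, 2}" "j \<in> {1, 2}" for i j
    using algebra_homsD(1)[OF fibre_hom[OF q \<delta> f h] F(2)[OF that]] by simp
  have hf: "f * h i j = h i j" if "i \<in> {1, 2}" "j \<in> {1, 2}" for i j
    using h that unfolding quantum_SL2_corner by blast
  have h_rel: "h 1 1 * h 1 2 = q *\<^sub>R (h 1 2 * h 1 1)" "h 2 1 * h 2 2 = q *\<^sub>R (h 2 2 * h 2 1)"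
    "h 2 1 * h 1 2 = h 1 2 * h 2 1"
    "h 1 1 * h 2 2 = q *\<^sub>R (h 1 2 * h 2 1) + f" "h 2 2 * h 1 1 = inverse q *\<^sub>R (h 1 2 * h 2 1) + f"
    using h unfolding quantum_SL2_corner by blast+
  have solve: "?Y' i j = x" if ij: "i \<in> {1, 2}" "j \<in> {1, 2}" 
      and x: "x = of_bool (i = 1) *\<^sub>R y + of_bool (i = 2) *\<^sub>R z" and fy: "f * y = y" "f * z = z"
      and hy: "h 1 1 * y + h 1 2 * z = of_bool (j = 1) *\<^sub>R f" "h 2 1 * y + h 2 2 * z = of_bool (j = 2) *\<^sub>R f"
    for i j x y z
  proof -
    have "?Y' i 1 * (h 1 1 * y + h 1 2 * z) + ?Y' i 2 * (h 2 1 * y + h 2 2 * z) =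
        (?Y' i 1 * h 1 1 + ?Y' i 2 * h 2 1) * y + (?Y' i 1 * h 1 2 + ?Y' i 2 * h 2 2) * z"
      by (simp add: algebra_simps)
    also have "\<dots> = x" using ij(1) YY[of i 1] YY[of i 2] x fy by auto
    finally show ?thesis using hy ij Yf[of i 1] Yf[of i 2] by auto
  qed
  \<comment> \<open>The inverse of \<open>h\<close> is its antipode.\<close>
  have Y': "?Y' 1 1 = h 2 2" "?Y' 2 1 = - q *\<^sub>R h 2 1" "?Y' 1 2 = - inverse q *\<^sub>R h 1 2" "?Y' 2 2 = h 1 1"
    by (rule solve[where y = "h 2 2" and z = "- q *\<^sub>R h 2 1"]; use q h_rel hf in simp)
      (rule solve[where y = "h 2 2" and z = "- q *\<^sub>R h 2 1"] solve[where y = "- inverse q *\<^sub>R h 1 2" and z = "h 1 1"];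
        use q h_rel hf in simp)+
  have FX: "?X i j - e * h i j * e \<in> trace_ops" "?X i j \<in> bounded_ops"
    and GX: "?X' i j - e * ?Y' i j * e \<in> trace_ops" "?X' i j \<in> bounded_ops" if "i \<in> {1, 2}" "j \<in> {1, 2}" for i j
    using compatible_homs[OF F(1)[OF that]] compatible_homs[OF F(2)[OF that]] Y[OF that]
    unfolding compatible_def by auto
  have sub: "A - X \<in> trace_ops" if "A - Z \<in> trace_ops" "X - Z \<in> trace_ops" for A X Z :: "lattice linop"
    using trace_ops_diff[OF that] by simp
  \<comment> \<open>The lifts of the off-diagonal entries of \<open>h\<close>; those of the diagonal entries are \<open>u 1 1\<close> and \<open>u 2 2\<close>.\<close>
  let ?l12 = "q *\<^sub>R (w 1 1 * u 2 1)" and ?l21 = "inverse q *\<^sub>R (w 2 2 * u 1 2)"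
  have L: "u 1 1 - ?X 1 1 \<in> trace_ops" "?l12 - ?X 1 2 \<in> trace_ops" "?l21 - ?X 2 1 \<in> trace_ops" "u 2 2 - ?X 2 2 \<in> trace_ops"
    by (rule sub[OF limit(1) FX(1)] sub[OF limit(2) FX(1)] sub[OF limit(3) FX(1)] sub[OF limit(4) FX(1)]; simp)+
  have "- (w 1 1 * u 2 1) - e * ?Y' 1 2 * e = - inverse q *\<^sub>R (?l12 - e * h 1 2 * e)"
    "- (w 2 2 * u 1 2) - e * ?Y' 2 1 * e = - q *\<^sub>R (?l21 - e * h 2 1 * e)"
    unfolding Y' using q by (simp_all add: algebra_simps)
  then have "- (w 1 1 * u 2 1) - e * ?Y' 1 2 * e \<in> trace_ops" "- (w 2 2 * u 1 2) - e * ?Y' 2 1 * e \<in> trace_ops"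
    using trace_ops_scaleR[OF limit(2), of "- inverse q"] trace_ops_scaleR[OF limit(3), of "- q"] by simp_all
  then have L': "u 2 2 - ?X' 1 1 \<in> trace_ops" "- (w 1 1 * u 2 1) - ?X' 1 2 \<in> trace_ops"
    "- (w 2 2 * u 1 2) - ?X' 2 1 \<in> trace_ops" "u 1 1 - ?X' 2 2 \<in> trace_ops"
    using sub[OF _ GX(1)] limit(1,4) Y'(1,4) by simp_all
  define C where "C A B = A * B - B * A" for A B :: "lattice linop"
  have cancel: "C A B - C X X' \<in> trace_ops \<and> op_trace (C A B - C X X') = 0"
    if "X \<in> bounded_ops" "X' \<in> bounded_ops" "A - X \<in> trace_ops" "B - X' \<in> trace_ops" for A B X X'
    using trace_commutator[OF that] by (simp add: C_def)
  have c11: "C (u 1 1) (u 2 2) - C (?X 1 1) (?X' 1 1) \<in> trace_ops \<and> op_trace (C (u 1 1) (u 2 2) - C (?X 1 1) (?X' 1 1)) = 0"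
    by (rule cancel[OF FX(2) GX(2) L(1) L'(1)]; simp)
  have c12: "C ?l12 (- (w 2 2 * u 1 2)) - C (?X 1 2) (?X' 2 1) \<in> trace_ops \<and>
      op_trace (C ?l12 (- (w 2 2 * u 1 2)) - C (?X 1 2) (?X' 2 1)) = 0"
    by (rule cancel[OF FX(2) GX(2) L(2) L'(3)]; simp)
  have c21: "C ?l21 (- (w 1 1 * u 2 1)) - C (?X 2 1) (?X' 1 2) \<in> trace_ops \<and>
      op_trace (C ?l21 (- (w 1 1 * u 2 1)) - C (?X 2 1) (?X' 1 2)) = 0"
    by (rule cancel[OF FX(2) GX(2) L(3) L'(2)]; simp)
  have c22: "C (u 2 2) (u 1 1) - C (?X 2 2) (?X' 2 2) \<in> trace_ops \<and> op_trace (C (u 2 2) (u 1 1) - C (?X 2 2) (?X' 2 2)) = 0"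
    by (rule cancel[OF FX(2) GX(2) L(4) L'(4)]; simp)
  have "C (?X 1 1) (?X' 1 1) + C (?X 1 2) (?X' 2 1) + C (?X 2 1) (?X' 1 2) + C (?X 2 2) (?X' 2 2) =
      (?X 1 1 * ?X' 1 1 + ?X 1 2 * ?X' 2 1) + (?X 2 1 * ?X' 1 2 + ?X 2 2 * ?X' 2 2)
      - (?X' 1 1 * ?X 1 1 + ?X' 1 2 * ?X 2 1) - (?X' 2 1 * ?X 1 2 + ?X' 2 2 * ?X 2 2)"
    by (simp add: C_def)
  also have "\<dots> = 0"
    using XX[of 1 1] XX[of 2 2] by simp
  finally have zero: "C (?X 1 1) (?X' 1 1) + C (?X 1 2) (?X' 2 1) + C (?X 2 1) (?X' 1 2) + C (?X 2 2) (?X' 2 2) = 0" .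
  have w_rel: "w 1 1 * w 2 2 = q\<^sup>2 *\<^sub>R (w 1 2 * w 2 1) + e" "w 2 2 * w 1 1 = inverse (q\<^sup>2) *\<^sub>R (w 1 2 * w 2 1) + e"
    and u_rel: "u 2 1 * u 1 2 = u 1 2 * u 2 1" and eu: "e * u 1 2 = u 1 2"
    using w u unfolding quantum_SL2_corner by auto
  have uw: "w 2 2 * u 1 2 * (w 1 1 * u 2 1) = w 2 2 * w 1 1 * (u 1 2 * u 2 1)"
    "w 1 1 * u 2 1 * (w 2 2 * u 1 2) = w 1 1 * w 2 2 * (u 1 2 * u 2 1)"
  proof -
    have "w 2 2 * u 1 2 * (w 1 1 * u 2 1) = w 2 2 * (u 1 2 * w 1 1) * u 2 1" by (simp add: mult.assoc)
    then show "w 2 2 * u 1 2 * (w 1 1 * u 2 1) = w 2 2 * w 1 1 * (u 1 2 * u 2 1)"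
      using comm[of 1 2 1 1] by (simp add: mult.assoc)
    have "w 1 1 * u 2 1 * (w 2 2 * u 1 2) = w 1 1 * (u 2 1 * w 2 2) * u 1 2" by (simp add: mult.assoc)
    then show "w 1 1 * u 2 1 * (w 2 2 * u 1 2) = w 1 1 * w 2 2 * (u 1 2 * u 2 1)"
      using comm[of 2 1 2 2] by (simp add: mult.assoc u_rel)
  qed
  have "C (u 1 1) (u 2 2) + C ?l12 (- (w 2 2 * u 1 2)) + C ?l21 (- (w 1 1 * u 2 1)) + C (u 2 2) (u 1 1) =
      (q - inverse q) *\<^sub>R (w 2 2 * u 1 2 * (w 1 1 * u 2 1) - w 1 1 * u 2 1 * (w 2 2 * u 1 2))"
    by (simp add: C_def algebra_simps)
  also have "\<dots> = (q - inverse q) *\<^sub>R ((w 2 2 * w 1 1 - w 1 1 * w 2 2) * (u 1 2 * u 2 1))"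
    by (simp add: uw left_diff_distrib)
  also have "\<dots> = - ((q - inverse q) * (q\<^sup>2 - inverse q ^ 2)) *\<^sub>R (w 1 2 * w 2 1 * (u 1 2 * u 2 1))"
    unfolding w_rel by (simp add: algebra_simps power_inverse)
  finally have val: "C (u 1 1) (u 2 2) + C ?l12 (- (w 2 2 * u 1 2)) + C ?l21 (- (w 1 1 * u 2 1)) + C (u 2 2) (u 1 1) =
      - ((q - inverse q) * (q\<^sup>2 - inverse q ^ 2)) *\<^sub>R (w 1 2 * w 2 1 * (u 1 2 * u 2 1))" .
  have "op_trace ((C (u 1 1) (u 2 2) - C (?X 1 1) (?X' 1 1)) + (C ?l12 (- (w 2 2 * u 1 2)) - C (?X 1 2) (?X' 2 1)) +
      (C ?l21 (- (w 1 1 * u 2 1)) - C (?X 2 1) (?X' 1 2)) + (C (u 2 2) (u 1 1) - C (?X 2 2) (?X' 2 2))) = 0"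
    using c11 c12 c21 c22 by (simp add: op_trace_add shift_span_add)
  also have "(C (u 1 1) (u 2 2) - C (?X 1 1) (?X' 1 1)) + (C ?l12 (- (w 2 2 * u 1 2)) - C (?X 1 2) (?X' 2 1)) +
      (C ?l21 (- (w 1 1 * u 2 1)) - C (?X 2 1) (?X' 1 2)) + (C (u 2 2) (u 1 1) - C (?X 2 2) (?X' 2 2)) =
      (C (u 1 1) (u 2 2) + C ?l12 (- (w 2 2 * u 1 2)) + C ?l21 (- (w 1 1 * u 2 1)) + C (u 2 2) (u 1 1)) -
      (C (?X 1 1) (?X' 1 1) + C (?X 1 2) (?X' 2 1) + C (?X 2 1) (?X' 1 2) + C (?X 2 2) (?X' 2 2))"
    by (simp only: add_diff_eq diff_add_eq diff_diff_eq2 diff_diff_eq add.assoc add.commute add.left_commute)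
  finally have "op_trace (- ((q - inverse q) * (q\<^sup>2 - inverse q ^ 2)) *\<^sub>R (w 1 2 * w 2 1 * (u 1 2 * u 2 1))) = 0"
    unfolding zero val by simp
  then show ?thesis unfolding op_trace_scaleR by (auto simp flip: of_real_mult of_real_diff)
qed

end

section \<open>Parameters of absolute value one\<close>

lemma S7_hom_eqI:
  assumes f: "f \<in> algebra_homs (A_S7 q) U" and g: "g \<in> algebra_homs (A_S7 q) U"
    and x: "\<And>i. i \<in> {1..4} \<Longrightarrow> f (x_gen q i) = g (x_gen q i)" "\<And>i. i \<in> {1..4} \<Longrightarrow> f (x_bar q i) = g (x_bar q i)"
    and p: "p \<in> carrier (A_S7 q)"
  shows "f p = g p"
  using p
proof (induction rule: S7_induct)
  case one
  show ?case using algebra_homsD(5)[OF f] algebra_homsD(5)[OF g] by simp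
next
  case (add x y)
  then show ?case using algebra_homsD(3)[OF f] algebra_homsD(3)[OF g] by simp
next
  case (mult x y)
  then show ?case using algebra_homsD(2)[OF f] algebra_homsD(2)[OF g] by simp
next
  case (smult c x)
  then show ?case using algebra_homsD(4)[OF f] algebra_homsD(4)[OF g] by simp
qed (rule x, assumption)+

lemma S7_hom_eqI_v:
  assumes q: "q \<noteq> 0" and U: "complex_algebra U"
    and f: "f \<in> algebra_homs (A_S7 q) U" and g: "g \<in> algebra_homs (A_S7 q) U"
    and v: "\<And>i j. i \<in> {1..4} \<Longrightarrow> j \<in> {1, 2} \<Longrightarrow> f (v_matrix q i j) = g (v_matrix q i j)"
    and p: "p \<in> carrier (A_S7 q)"
  shows "f p = g p"
proof -
  interpret complex_algebra U by fact
  have cancel: "f y = g y" if "y \<in> carrier (A_S7 q)" "f (complex_of_real c \<odot>\<^bsub>A_Sp q\<^esub> y) = g (complex_of_real c \<odot>\<^bsub>A_Sp q\<^esub> y)" "c \<noteq> 0" for c y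
  proof (rule smult_cancel)
    show "of_real c \<odot>\<^bsub>U\<^esub> f y = of_real c \<odot>\<^bsub>U\<^esub> g y"
      using that(2) algebra_homsD(4)[OF f that(1)] algebra_homsD(4)[OF g that(1)] by simp
  qed (use that algebra_homsD(1)[OF f] algebra_homsD(1)[OF g] in auto)
  have x: "f (x_gen q i) = g (x_gen q i)" "f (x_bar q i) = g (x_bar q i)" if "i \<in> {1..4}" for i
  proof -
    have i: "i = 1 \<or> i = 2 \<or> i = 3 \<or> i = 4" using that by auto
    show "f (x_gen q i) = g (x_gen q i)"
      using cancel[OF x_gen_closed[OF that], of "q powi -3"] cancel[OF x_gen_closed[OF that], of "q powi -2"]
        cancel[OF x_gen_closed[OF that], of "q powi -1"] cancel[OF x_gen_closed[OF that], of "-1"]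
        v[of 1 1] v[of 1 2] v[of 3 1] v[of 3 2] i q
      by (elim disjE) auto
    show "f (x_bar q i) = g (x_bar q i)"
      using cancel[OF x_bar_closed[OF that], of "- (q powi -1)"] cancel[OF x_bar_closed[OF that], of "q powi -1"]
        cancel[OF x_bar_closed[OF that], of "-1"]
        v[of 2 1] v[of 2 2] v[of 4 1] v[of 4 2] i q
      by (elim disjE) auto
  qed
  show ?thesis by (rule S7_hom_eqI[OF f g x p])
qed

subsection \<open>Two by two matrices\<close>

lift_definition off_diagonal :: "complex \<Rightarrow> complex \<Rightarrow> bool linop" is "\<lambda>a b f i. if i then a * f False else b * f True"
  by (auto simp: fun_eq_iff algebra_simps)

text \<open>
  Conjugation with this operator is the grading of two by two matrices for which the off-diagonal ones are odd.
\<close>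

lift_definition parity_op :: "bool linop" is "\<lambda>f i. if i then f True else - f False"
  by (auto simp: fun_eq_iff algebra_simps)

lemma parity_off_diagonal: "parity_op * parity_op = 1" "parity_op * off_diagonal a b * parity_op = - off_diagonal a b"
  by (rule linop_eqI; simp add: parity_op.rep_eq off_diagonal.rep_eq)+

definition entry :: "bool linop \<Rightarrow> bool \<Rightarrow> bool \<Rightarrow> complex" where
  "entry X i j = apply_op X (\<lambda>k. of_bool (k = j)) i"

lemma apply_op_entry: "apply_op X f i = entry X i True * f True + entry X i False * f False"
proof -
  have "f = (\<lambda>k. f True * of_bool (k = True) + f False * of_bool (k = False))"
    by (auto simp: fun_eq_iff)
  then have "apply_op X f = apply_op X (\<lambda>k. f True * of_bool (k = True) + f False * of_bool (k = False))" by metis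
  then show ?thesis unfolding apply_op_add apply_op_scale entry_def by (simp add: mult.commute)
qed

lemma entry_simps [simp]:
  "entry (X + Y) i j = entry X i j + entry Y i j" "entry (- X) i j = - entry X i j"
  "entry (X * Y) i j = entry X i True * entry Y True j + entry X i False * entry Y False j"
  "entry (c *\<^sub>C X) i j = c * entry X i j" "entry (r *\<^sub>R X) i j = of_real r * entry X i j"
  "entry 1 i j = of_bool (i = j)" "entry 0 i j = 0"
  "entry (off_diagonal a b) i j = (if i = j then 0 else if i then a else b)"
  "entry parity_op i j = (if i = j then if i then 1 else - 1 else 0)"
  by (auto simp: entry_def apply_op_entry[of X "apply_op Y f" for f] off_diagonal.rep_eq parity_op.rep_eq)

lemma entry_eqI: "(\<And>i j. entry X i j = entry Y i j) \<Longrightarrow> X = Y"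
  by (rule linop_eqI) (simp add: apply_op_entry)

subsection \<open>Representations on a ball\<close>

text \<open>
  For \<open>q\<^sup>2 = 1\<close> the quantum \<open>SL\<^sub>2\<close> with parameter \<open>q\<^sup>2\<close> is classical, so \<open>w\<close> can be a rotation with complex entries.
  It takes the unit vector \<open>(0, 1)\<close> to \<open>(t, z\<^sub>3 / g)\<close>, where \<open>g = (1 - |z\<^sub>4|\<^sup>2)\<^sup>1\<^sup>/\<^sup>2\<close>. For \<open>g = 0\<close> any rotation will do, as
  \<open>u\<close> is then diagonal and the coordinates \<open>x\<^sub>2\<close> and \<open>x\<^sub>3\<close> vanish.
\<close>

definition long_rotation :: "complex \<times> complex \<Rightarrow> nat \<Rightarrow> nat \<Rightarrow> bool linop" where
  "long_rotation z i j = (let g = sqrt (1 - (norm (snd z))\<^sup>2); a = fst z / complex_of_real g;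
      t = complex_of_real (sqrt (1 - (norm a)\<^sup>2)) in
     if g = 0 then of_bool (i = j)
     else (if i = 1 \<and> j = 1 then cnj a else if i = 2 \<and> j = 2 then a else if i = 1 then t else - t) *\<^sub>C 1)"

text \<open>
  With \<open>X = off_diagonal 1 1\<close> and \<open>Y = off_diagonal q 1\<close>, which satisfy \<open>X Y = q Y X\<close>, \<open>X\<^sup>2 = 1\<close> and \<open>Y\<^sup>2 = q\<close>, this is the
  rotation with diagonal entries \<open>cnj z\<^sub>4 X\<close>, \<open>z\<^sub>4 X\<close> and off-diagonal entries \<open>- g Y\<close>, \<open>g Y\<close>. The same matrices serve
  \<open>q = 1\<close> and \<open>q = - 1\<close>, and in both cases every entry is odd.
\<close>

definition short_rotation :: "real \<Rightarrow> complex \<times> complex \<Rightarrow> nat \<Rightarrow> nat \<Rightarrow> bool linop" where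
  "short_rotation q z i j = (let g = complex_of_real (sqrt (1 - (norm (snd z))\<^sup>2)) in
     if i = 1 \<and> j = 1 then off_diagonal (cnj (snd z)) (cnj (snd z))
     else if i = 2 \<and> j = 2 then off_diagonal (snd z) (snd z)
     else if i = 1 then off_diagonal (- g * complex_of_real q) (- g) else off_diagonal (g * complex_of_real q) g)"

definition rotation_rep :: "real \<Rightarrow> complex \<times> complex \<Rightarrow> (nat \<times> nat) presented \<Rightarrow> bool linop" where
  "rotation_rep q z = sphere_hom q 1 (long_rotation z) (short_rotation q z)"

text \<open>
  The point of the fibre at which \<open>x\<^sub>3 = z\<^sub>3 Y\<close> and \<open>x\<^sub>4 = z\<^sub>4 X\<close>, for \<open>z\<close> on the unit sphere.
\<close>

definition fibre_rotation :: "real \<Rightarrow> complex \<times> complex \<Rightarrow> nat \<Rightarrow> nat \<Rightarrow> bool linop" where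
  "fibre_rotation q z i j =
     (if i = 1 \<and> j = 1 then off_diagonal (cnj (snd z)) (cnj (snd z))
     else if i = 2 \<and> j = 2 then off_diagonal (snd z) (snd z)
     else if i = 1 then off_diagonal (cnj (fst z)) (complex_of_real q * cnj (fst z)) else off_diagonal (- fst z) (- complex_of_real q * fst z))"

context
  fixes q :: real
  assumes q2: "q * q = 1"
begin

lemma q0: "q \<noteq> 0" "inverse q = q" 
  using q2 inverse_unique[OF q2] by auto

lemma cq: "complex_of_real q * complex_of_real q = 1" "complex_of_real q * (complex_of_real q * x) = x"
  using q2 by (metis of_real_mult of_real_1, metis of_real_mult of_real_1 mult.assoc mult_1)

lemma norm_le: "norm z \<le> 1 \<Longrightarrow> (norm (fst z))\<^sup>2 + (norm (snd z))\<^sup>2 \<le> 1" for z :: "complex \<times> complex"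
  by (simp add: norm_prod_def power_le_one_iff)

lemma sqrt_one_minus_norm:
  assumes "(norm a)\<^sup>2 \<le> 1"
  shows "complex_of_real (sqrt (1 - (norm a)\<^sup>2)) * complex_of_real (sqrt (1 - (norm a)\<^sup>2)) = 1 - a * cnj a"
proof -
  have "sqrt (1 - (norm a)\<^sup>2) * sqrt (1 - (norm a)\<^sup>2) = 1 - (norm a)\<^sup>2" using assms by simp
  then show ?thesis
    by (simp only: of_real_mult[symmetric] of_real_diff of_real_1 complex_norm_square)
qed

lemma SL2_short_rotation:
  assumes "norm z \<le> 1"
  shows "quantum_SL2 (corner 1) q (short_rotation q z)"
proof -
  let ?g = "complex_of_real (sqrt (1 - (norm (snd z))\<^sup>2))"
  have "(norm (snd z))\<^sup>2 \<le> 1" using norm_le[OF assms] zero_le_power2[of "norm (fst z)"] by linarith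
  note g = sqrt_one_minus_norm[OF this]
  show ?thesis
    unfolding quantum_SL2_corner
    by (intro conjI ballI; (simp; fail)?; rule entry_eqI; use g in
        \<open>simp add: short_rotation_def Let_def cq q0(2) algebra_simps\<close>)
qed

lemma SL2_long_rotation:
  assumes "norm z \<le> 1"
  shows "quantum_SL2 (corner 1) (q\<^sup>2) (long_rotation z)"
proof -
  let ?g = "sqrt (1 - (norm (snd z))\<^sup>2)"
  let ?a = "fst z / complex_of_real ?g"
  let ?t = "sqrt (1 - (norm ?a)\<^sup>2)"
  have "?g \<noteq> 0 \<Longrightarrow> (norm ?a)\<^sup>2 \<le> 1"
  proof -
    assume g: "?g \<noteq> 0"
    have "0 \<le> 1 - (norm (snd z))\<^sup>2" "(norm (fst z))\<^sup>2 \<le> 1 - (norm (snd z))\<^sup>2"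
      using norm_le[OF assms] zero_le_power2[of "norm (fst z)"] by linarith+
    then show ?thesis using g by (simp add: norm_divide power_divide divide_simps)
  qed
  then have t: "?g \<noteq> 0 \<Longrightarrow> complex_of_real ?t * complex_of_real ?t = 1 - ?a * cnj ?a"
    by (rule sqrt_one_minus_norm)
  have q: "q\<^sup>2 = 1" using q2 by (simp add: power2_eq_square)
  show ?thesis
    unfolding quantum_SL2_corner q
    by (cases "?g = 0") (intro conjI ballI; (simp; fail)?; rule entry_eqI; use t in
        \<open>simp add: long_rotation_def Let_def algebra_simps\<close>)+
qed

lemma rotation_commute:
  "i \<in> {1, 2} \<Longrightarrow> j \<in> {1, 2} \<Longrightarrow> k \<in> {1, 2} \<Longrightarrow> l \<in> {1, 2} \<Longrightarrow>
    short_rotation q z i j * long_rotation z k l = long_rotation z k l * short_rotation q z i j"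
  by (rule entry_eqI) (auto simp: long_rotation_def Let_def)

lemma rotation_rep:
  assumes "norm z \<le> 1"
  shows "rotation_rep q z \<in> algebra_homs (A_S7 q) (corner 1)"
  unfolding rotation_rep_def
  by (rule sphere_hom[OF q0(1) _ SL2_short_rotation[OF assms] SL2_long_rotation[OF assms] rotation_commute]; simp)

text \<open>
  The ball \<open>x\<^sub>1 = 0\<close> in the sphere: its points are given by \<open>x\<^sub>3\<close> and \<open>x\<^sub>4\<close>, and \<open>x\<^sub>2\<close> is the nonnegative
  \<open>(1 - |z|\<^sup>2)\<^sup>1\<^sup>/\<^sup>2\<close> times \<open>Y\<close>. These values depend continuously on \<open>z\<close>, although \<^const>\<open>long_rotation\<close> does not.
\<close>

lemma rotation_rep_values:
  assumes z: "norm z \<le> 1"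
  defines "r \<equiv> complex_of_real (sqrt (1 - (norm z)\<^sup>2))"
  shows "rotation_rep q z (x_gen q 1) = 0"
    "rotation_rep q z (x_gen q 2) = off_diagonal (r * of_real q) r"
    "rotation_rep q z (x_gen q 3) = off_diagonal (fst z * of_real q) (fst z)"
    "rotation_rep q z (x_gen q 4) = off_diagonal (snd z) (snd z)"
    "rotation_rep q z (x_bar q 1) = 0"
    "rotation_rep q z (x_bar q 2) = off_diagonal r (of_real q * r)"
    "rotation_rep q z (x_bar q 3) = off_diagonal (cnj (fst z)) (of_real q * cnj (fst z))"
    "rotation_rep q z (x_bar q 4) = off_diagonal (cnj (snd z)) (cnj (snd z))"
proof -
  let ?w = "long_rotation z" and ?u = "short_rotation q z"
  have v: "rotation_rep q z (x_gen q 1) = 0" "rotation_rep q z (x_gen q 2) = - (?w 1 2 * ?u 1 2)"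
    "rotation_rep q z (x_gen q 3) = - (?w 2 2 * ?u 1 2)" "rotation_rep q z (x_gen q 4) = ?u 2 2"
    "rotation_rep q z (x_bar q 1) = 0" "rotation_rep q z (x_bar q 2) = - (q ^ 3) *\<^sub>R (?w 2 1 * ?u 2 1)"
    "rotation_rep q z (x_bar q 3) = q *\<^sub>R (?w 1 1 * ?u 2 1)" "rotation_rep q z (x_bar q 4) = ?u 1 1"
    unfolding rotation_rep_def
    by (rule sphere_hom_values[OF q0(1) _ SL2_short_rotation[OF z] SL2_long_rotation[OF z] rotation_commute];
      (assumption | rule mult_1))+
  let ?g = "sqrt (1 - (norm (snd z))\<^sup>2)"
  have nz: "(norm z)\<^sup>2 = (norm (fst z))\<^sup>2 + (norm (snd z))\<^sup>2" by (simp add: norm_prod_def)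
  have ge: "0 \<le> 1 - (norm (snd z))\<^sup>2" using norm_le[OF z] zero_le_power2[of "norm (fst z)"] by linarith
  have g0: "fst z = 0" "r = 0" if "?g = 0"
  proof -
    have "(norm (snd z))\<^sup>2 = 1" using that by simp
    moreover from this have "norm (fst z) = 0" using norm_le[OF z] by simp
    ultimately show "fst z = 0" "r = 0" by (simp_all add: r_def nz)
  qed
  have t: "sqrt (1 - (norm (fst z / complex_of_real ?g))\<^sup>2) * ?g = sqrt (1 - (norm z)\<^sup>2)" if "?g \<noteq> 0"
  proof -
    have "(1 - (norm (fst z / complex_of_real ?g))\<^sup>2) * (1 - (norm (snd z))\<^sup>2) = 1 - (norm z)\<^sup>2"
      using that ge by (simp add: norm_divide power_divide nz field_simps)
    then show ?thesis by (simp only: real_sqrt_mult[symmetric])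
  qed
  have t': "complex_of_real (sqrt (1 - (norm (fst z / complex_of_real ?g))\<^sup>2)) * complex_of_real ?g = r" if "?g \<noteq> 0"
    using t[OF that] unfolding r_def by (simp only: of_real_mult[symmetric])
  have t'': "complex_of_real (sqrt (1 - (norm (fst z / complex_of_real ?g))\<^sup>2)) * (complex_of_real ?g * y) = r * y" if "?g \<noteq> 0" for y
    using t'[OF that] by (simp only: mult.assoc[symmetric])
  have c: "complex_of_real ?g \<noteq> 0" if "?g \<noteq> 0" using that by (simp only: of_real_eq_0_iff not_False_eq_True)
  have q3: "complex_of_real q ^ 3 * y = of_real q * y" "q ^ 3 = q" for y
    using q2 by (simp_all add: power3_eq_cube cq flip: of_real_power)
  show "rotation_rep q z (x_gen q 1) = 0" "rotation_rep q z (x_bar q 1) = 0" 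
    by (simp_all add: v)
  show "rotation_rep q z (x_gen q 4) = off_diagonal (snd z) (snd z)"
    "rotation_rep q z (x_bar q 4) = off_diagonal (cnj (snd z)) (cnj (snd z))"
    by (simp_all add: v short_rotation_def Let_def)
  show "rotation_rep q z (x_gen q 2) = off_diagonal (r * of_real q) r"
    "rotation_rep q z (x_bar q 2) = off_diagonal r (of_real q * r)"
    by (simp_all add: v; rule entry_eqI; cases "?g = 0";
      simp add: g0 t' t'' long_rotation_def short_rotation_def Let_def q3 cq mult.assoc mult.left_commute[of "complex_of_real q"] del: real_sqrt_eq_zero_cancel_iff)+
  show "rotation_rep q z (x_gen q 3) = off_diagonal (fst z * of_real q) (fst z)"
    "rotation_rep q z (x_bar q 3) = off_diagonal (cnj (fst z)) (of_real q * cnj (fst z))"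
    by (simp_all add: v; rule entry_eqI; cases "?g = 0";
      simp add: g0 c long_rotation_def short_rotation_def Let_def q3 cq mult.assoc mult.left_commute[of "complex_of_real q"] del: real_sqrt_eq_zero_cancel_iff)+
qed

lemma SL2_fibre_rotation:
  assumes "norm z = 1"
  shows "quantum_SL2 (corner 1) q (fibre_rotation q z)"
proof -
  have "(norm (fst z))\<^sup>2 + (norm (snd z))\<^sup>2 = 1" using assms by (simp add: norm_prod_def)
  then have "complex_of_real ((norm (fst z))\<^sup>2 + (norm (snd z))\<^sup>2) = 1" by simp
  then have z: "fst z * cnj (fst z) = 1 - snd z * cnj (snd z)"
    unfolding of_real_add complex_norm_square by (simp add: algebra_simps)
  show ?thesis
    unfolding quantum_SL2_corner
    by (intro conjI ballI; (simp; fail)?; rule entry_eqI; use z in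
        \<open>simp add: fibre_rotation_def cq q0(2) algebra_simps\<close>)
qed

lemma rotation_rep_boundary:
  assumes \<delta>: "is_coaction_R q \<delta>" and z: "norm z = 1" and p: "p \<in> carrier (A_S7 q)"
  shows "rotation_rep q z p = fibre_hom q \<delta> 1 (fibre_rotation q z) p"
proof (rule S7_hom_eqI[OF _ _ _ _ p])
  note h = SL2_fibre_rotation[OF z]
  show "rotation_rep q z \<in> algebra_homs (A_S7 q) (corner 1)" using rotation_rep z by simp
  show "fibre_hom q \<delta> 1 (fibre_rotation q z) \<in> algebra_homs (A_S7 q) (corner 1)"
    by (rule fibre_hom[OF q0(1) \<delta> _ h]) simp
  fix i :: nat assume "i \<in> {1..4}"
  then have i: "i = 1 \<or> i = 2 \<or> i = 3 \<or> i = 4" by auto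
  have v: "fibre_hom q \<delta> 1 (fibre_rotation q z) (x_gen q 1) = 0" "fibre_hom q \<delta> 1 (fibre_rotation q z) (x_gen q 2) = 0"
    "fibre_hom q \<delta> 1 (fibre_rotation q z) (x_gen q 3) = - q *\<^sub>R fibre_rotation q z 2 1"
    "fibre_hom q \<delta> 1 (fibre_rotation q z) (x_gen q 4) = fibre_rotation q z 2 2"
    "fibre_hom q \<delta> 1 (fibre_rotation q z) (x_bar q 1) = 0" "fibre_hom q \<delta> 1 (fibre_rotation q z) (x_bar q 2) = 0"
    "fibre_hom q \<delta> 1 (fibre_rotation q z) (x_bar q 3) = fibre_rotation q z 1 2"
    "fibre_hom q \<delta> 1 (fibre_rotation q z) (x_bar q 4) = fibre_rotation q z 1 1"
    by (rule fibre_hom_values[OF q0(1) \<delta> _ h]; simp)+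
  have z': "norm z \<le> 1" using z by simp
  have o: "off_diagonal 0 0 = 0" by (rule entry_eqI) simp
  have three: "- q *\<^sub>R fibre_rotation q z 2 1 = off_diagonal (fst z * complex_of_real q) (fst z)"
    "fibre_rotation q z 1 2 = off_diagonal (cnj (fst z)) (complex_of_real q * cnj (fst z))"
    by (rule entry_eqI; simp add: fibre_rotation_def cq)+
  have four: "fibre_rotation q z 2 2 = off_diagonal (snd z) (snd z)"
    "fibre_rotation q z 1 1 = off_diagonal (cnj (snd z)) (cnj (snd z))"
    by (simp_all add: fibre_rotation_def)
  show "rotation_rep q z (x_gen q i) = fibre_hom q \<delta> 1 (fibre_rotation q z) (x_gen q i)"
    using i by (elim disjE; hypsubst) (simp_all add: rotation_rep_values[OF z'] v three four z o del: scaleR_minus_left)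
  show "rotation_rep q z (x_bar q i) = fibre_hom q \<delta> 1 (fibre_rotation q z) (x_bar q i)"
    using i by (elim disjE; hypsubst) (simp_all add: rotation_rep_values[OF z'] v three four z o)
qed

lemma rotation_rep_continuous:
  assumes "p \<in> carrier (A_S7 q)"
  shows "continuous_on (cball 0 1) (\<lambda>z. entry (rotation_rep q z p) i j)"
proof -
  have le: "norm z \<le> 1" if "z \<in> cball 0 1" for z :: "complex \<times> complex" using that by simp
  note hom = algebra_homsD[OF rotation_rep[OF le]]
  have cong: "continuous_on (cball 0 1) f" if "continuous_on (cball 0 1) g" "\<And>z. z \<in> cball 0 1 \<Longrightarrow> f z = g z"
    for f g :: "complex \<times> complex \<Rightarrow> complex"
    by (rule continuous_on_eq[OF that(1)]) (rule that(2)[symmetric])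
  have off: "continuous_on (cball 0 1) (\<lambda>z. entry (off_diagonal (a z) (b z)) i j)"
    if "continuous_on (cball 0 1) a" "continuous_on (cball 0 1) b" for a b :: "complex \<times> complex \<Rightarrow> complex" and i j
    using that by (cases "i = j"; cases i) auto
  have "\<forall>i j. continuous_on (cball 0 1) (\<lambda>z. entry (rotation_rep q z p) i j)"
    using assms
  proof (induction rule: S7_induct)
    case one
    show ?case by (intro allI, rule cong[of "\<lambda>z. of_bool (_ = _)"]) (use hom(5) in simp_all)
  next
    case (x i)
    then have i: "i = 1 \<or> i = 2 \<or> i = 3 \<or> i = 4" by auto
    note r = rotation_rep_values[OF le]
    show ?case
    proof (intro allI)
      fix k l
      have "continuous_on (cball 0 1) (\<lambda>z. entry (rotation_rep q z (x_gen q 1)) k l)"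
        by (rule cong[OF continuous_on_const[of _ 0]]) (simp add: r)
      moreover have "continuous_on (cball 0 1) (\<lambda>z. entry (rotation_rep q z (x_gen q 2)) k l)"
        by (rule cong[OF off]) (auto simp: r intro!: continuous_intros)
      moreover have "continuous_on (cball 0 1) (\<lambda>z. entry (rotation_rep q z (x_gen q 3)) k l)"
        by (rule cong[OF off]) (auto simp: r intro!: continuous_intros)
      moreover have "continuous_on (cball 0 1) (\<lambda>z. entry (rotation_rep q z (x_gen q 4)) k l)"
        by (rule cong[OF off]) (auto simp: r intro!: continuous_intros)
      ultimately show "continuous_on (cball 0 1) (\<lambda>z. entry (rotation_rep q z (x_gen q i)) k l)" using i by metis
    qed
  next
    case (x_bar i)
    then have i: "i = 1 \<or> i = 2 \<or> i = 3 \<or> i = 4" by auto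
    note r = rotation_rep_values[OF le]
    show ?case
    proof (intro allI)
      fix k l
      have "continuous_on (cball 0 1) (\<lambda>z. entry (rotation_rep q z (x_bar q 1)) k l)"
        by (rule cong[OF continuous_on_const[of _ 0]]) (simp add: r)
      moreover have "continuous_on (cball 0 1) (\<lambda>z. entry (rotation_rep q z (x_bar q 2)) k l)"
        by (rule cong[OF off]) (auto simp: r intro!: continuous_intros)
      moreover have "continuous_on (cball 0 1) (\<lambda>z. entry (rotation_rep q z (x_bar q 3)) k l)"
        by (rule cong[OF off]) (auto simp: r intro!: continuous_intros)
      moreover have "continuous_on (cball 0 1) (\<lambda>z. entry (rotation_rep q z (x_bar q 4)) k l)"
        by (rule cong[OF off]) (auto simp: r intro!: continuous_intros)
      ultimately show "continuous_on (cball 0 1) (\<lambda>z. entry (rotation_rep q z (x_bar q i)) k l)" using i by metis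
    qed
  next
    case (add x y)
    show ?case
    proof (intro allI)
      fix k l
      show "continuous_on (cball 0 1) (\<lambda>z. entry (rotation_rep q z (x \<oplus>\<^bsub>A_S7 q\<^esub> y)) k l)"
        by (rule cong[where g = "\<lambda>z. entry (rotation_rep q z x) k l + entry (rotation_rep q z y) k l"])
          (use add hom(3)[OF _ add(1,2)] in \<open>auto intro!: continuous_intros\<close>)
    qed
  next
    case (mult x y)
    show ?case
    proof (intro allI)
      fix k l
      show "continuous_on (cball 0 1) (\<lambda>z. entry (rotation_rep q z (x \<otimes>\<^bsub>A_S7 q\<^esub> y)) k l)"
        by (rule cong[where g = "\<lambda>z. entry (rotation_rep q z x) k True * entry (rotation_rep q z y) True l +
             entry (rotation_rep q z x) k False * entry (rotation_rep q z y) False l"])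
          (use mult hom(2)[OF _ mult(1,2)] in \<open>auto intro!: continuous_intros\<close>)
    qed
  next
    case (smult c x)
    show ?case
    proof (intro allI)
      fix k l
      show "continuous_on (cball 0 1) (\<lambda>z. entry (rotation_rep q z (c \<odot>\<^bsub>A_S7 q\<^esub> x)) k l)"
        by (rule cong[where g = "\<lambda>z. c * entry (rotation_rep q z x) k l"])
          (use smult hom(4)[OF _ smult(1)] in \<open>auto intro!: continuous_intros\<close>)
    qed
  qed
  then show ?thesis by blast
qed

text \<open>
  The element \<open>- 1\<close> of \<open>SU(2)\<close> acts on the sphere by the sign change of all coordinates. In the representation
  this sign change is the conjugation with the parity operator, because all coordinates are odd there; and it
  changes the sign of the entries of an equivariant matrix. So these entries are odd as well.
\<close>

lemma rotation_rep_odd: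
  assumes \<delta>: "is_coaction_R q \<delta>" and z: "norm z \<le> 1" and p: "p \<in> carrier (A_S7 q)" "p' \<in> carrier (A_S7 q)" and j: "j \<in> {1, 2}"
    and \<delta>p: "\<delta> x = pure_tensor (A_S7 q) (A_SU q) p (u_matrix q 1 j) \<oplus>\<^bsub>tensor_algebra (A_S7 q) (A_SU q)\<^esub>
       pure_tensor (A_S7 q) (A_SU q) p' (u_matrix q 2 j)"
    and x: "x = (if j = 1 then p else p')" 
  shows "parity_op * rotation_rep q z x * parity_op = - rotation_rep q z x"
proof -
  let ?H = "\<lambda>i j. - of_bool (i = j) :: complex"
  define \<kappa> where "\<kappa> = (\<lambda>w. induced_hom complex_numbers (SU_assignment complex_numbers q ?H) w *\<^sub>C (1 :: bool linop))"
  have H: "quantum_SL2 complex_numbers q ?H"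
    unfolding complex_numbers_corner quantum_SL2_corner by simp
  have U: "complex_algebra (corner (1 :: bool linop))" by (rule complex_algebra_corner) simp
  have \<kappa>: "\<kappa> \<in> algebra_homs (A_SU q) (corner 1)"
    using complex_algebra.scalar_hom[OF U SU_hom[OF q0(1) complex_algebra_complex_numbers H]] unfolding \<kappa>_def by simp
  have \<kappa>u: "\<kappa> (u_matrix q i j) = - of_bool (i = j)" if "i \<in> {1, 2}" "j \<in> {1, 2}" for i j
    unfolding \<kappa>_def SU_hom_u_matrix[OF q0(1) complex_algebra_complex_numbers H that]
    by (rule entry_eqI) simp
  have comm: "rotation_rep q z v \<otimes>\<^bsub>corner 1\<^esub> \<kappa> w = \<kappa> w \<otimes>\<^bsub>corner 1\<^esub> rotation_rep q z v" for v w
    unfolding \<kappa>_def by (simp add: cscale_mult_left cscale_mult_right)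
  note map = \<delta> U rotation_rep[OF z] \<kappa> comm
  let ?m = "coaction_map (corner 1) (rotation_rep q z) \<kappa> \<delta>"
  have hom: "(\<lambda>p. parity_op * rotation_rep q z p * parity_op) \<in> algebra_homs (A_S7 q) (corner 1)"
    using algebra_homsD[OF rotation_rep[OF z]] parity_off_diagonal(1)
    by (intro algebra_homsI) (auto simp: cscale_mult_left cscale_mult_right algebra_simps, metis mult.assoc mult_1)
  have xp: "x \<in> carrier (A_S7 q)" using x p by auto
  have "parity_op * rotation_rep q z x * parity_op = ?m x"
  proof (rule S7_hom_eqI_v[OF q0(1) U hom _ _ xp])
    show "?m \<in> algebra_homs (A_S7 q) (corner 1)" by (rule coaction_map_hom[OF map])
    fix i j :: nat assume ij: "i \<in> {1..4}" "j \<in> {1, 2}"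
    have "?m (v_matrix q i j) = rotation_rep q z (v_matrix q i 1) * \<kappa> (u_matrix q 1 j) + rotation_rep q z (v_matrix q i 2) * \<kappa> (u_matrix q 2 j)"
      using coaction_map_v[OF map ij] by simp
    also have "\<dots> = - rotation_rep q z (v_matrix q i j)"
      using ij(2) \<kappa>u[of 1 j] \<kappa>u[of 2 j] by auto
    finally have m: "?m (v_matrix q i j) = - rotation_rep q z (v_matrix q i j)" .
    have ij': "(i = 1 \<or> i = 2 \<or> i = 3 \<or> i = 4) \<and> (j = 1 \<or> j = 2)" using ij by auto
    have s: "rotation_rep q z (c \<odot>\<^bsub>A_Sp q\<^esub> x) = c *\<^sub>C rotation_rep q z x" if "x \<in> carrier (A_S7 q)" for c x
      using algebra_homsD(4)[OF rotation_rep[OF z] that, of c] by simp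
    have c: "parity_op * (c *\<^sub>C off_diagonal a b) * parity_op = - (c *\<^sub>C off_diagonal a b)"
      "parity_op * (c *\<^sub>C 0) * parity_op = - (c *\<^sub>C 0)" for a b c
      by (rule entry_eqI; simp)+
    have cl: "x_gen q 1 \<in> carrier (A_S7 q)" "x_gen q 2 \<in> carrier (A_S7 q)" "x_gen q 3 \<in> carrier (A_S7 q)" "x_gen q 4 \<in> carrier (A_S7 q)"
      "x_bar q 1 \<in> carrier (A_S7 q)" "x_bar q 2 \<in> carrier (A_S7 q)" "x_bar q 3 \<in> carrier (A_S7 q)" "x_bar q 4 \<in> carrier (A_S7 q)"
      by simp_all
    show "parity_op * rotation_rep q z (v_matrix q i j) * parity_op = ?m (v_matrix q i j)"
      unfolding m using ij'
      by (elim conjE disjE; hypsubst) (simp_all only: v_matrix_simps s cl rotation_rep_values[OF z] c)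
  qed
  also have "?m x = rotation_rep q z p * \<kappa> (u_matrix q 1 j) + rotation_rep q z p' * \<kappa> (u_matrix q 2 j)"
    using coaction_map_value[OF map \<delta>p p] complex_algebra.smult_closed[OF complex_algebra_SU] j by auto
  also have "\<dots> = - rotation_rep q z x"
    using j \<kappa>u[of 1 j] \<kappa>u[of 2 j] x by auto
  finally show ?thesis .
qed

text \<open>
  The second row of \<open>F\<close> consists of odd matrices, and it has a right inverse, so the upper right corners of its
  two entries do not both vanish. They form a continuous map from the closed ball to \<open>\<complex>\<^sup>2 - {0}\<close>, which on the
  boundary is the identity up to a sign, as \<open>F\<close> is known there. This contradicts Brouwer's theorem.
\<close>

lemma no_cleaving_matrices_unit:
  assumes \<delta>: "is_coaction_R q \<delta>" and cleaving: "cleaving_matrices q \<delta> F G"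
  shows False
proof -
  note FG = cleaving_matricesD(1)[OF cleaving] and F = cleaving_matricesD(2)[OF cleaving]
    and \<delta>F = cleaving_matricesD(5)[OF cleaving]
  define h where "h z = (- entry (rotation_rep q z (F 2 1)) True False, entry (rotation_rep q z (F 2 2)) True False)" for z
  have cont: "continuous_on (cball 0 1) h"
    unfolding h_def by (intro continuous_intros rotation_rep_continuous F) auto
  have nz: "h z \<noteq> 0" if "z \<in> cball 0 1" for z
  proof
    assume "h z = 0"
    then have zero: "entry (rotation_rep q z (F 2 j)) True False = 0" if "j \<in> {1, 2}" for j
      using that by (auto simp: h_def zero_prod_def)
    have z: "norm z \<le> 1" using \<open>z \<in> cball 0 1\<close> by simp
    have diag: "entry (rotation_rep q z (F 2 j)) True True = 0" if j: "j \<in> {1, 2}" for j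
    proof -
      have "parity_op * rotation_rep q z (F 2 j) * parity_op = - rotation_rep q z (F 2 j)"
        by (rule rotation_rep_odd[OF \<delta> z F F j \<delta>F]) (use j in auto)
      then have "entry (parity_op * rotation_rep q z (F 2 j) * parity_op) True True = entry (- rotation_rep q z (F 2 j)) True True"
        by simp
      then show ?thesis by simp
    qed
    have "rotation_rep q z (F 2 1) * rotation_rep q z (G 1 2) + rotation_rep q z (F 2 2) * rotation_rep q z (G 2 2) = 1"
      using matrix_one_entries[OF hom_mutually_inverse[OF rotation_rep[OF z] complex_algebra_S7 FG], of 2 2] by simp
    then have "entry (rotation_rep q z (F 2 1) * rotation_rep q z (G 1 2) + rotation_rep q z (F 2 2) * rotation_rep q z (G 2 2)) True True = entry 1 True True"
      by simp
    then show False using zero diag by simp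
  qed
  have id: "h z = z" if "norm z = 1" for z
  proof -
    have "rotation_rep q z (F 2 j) = fibre_rotation q z 2 j" if "j \<in> {1, 2}" for j
      using rotation_rep_boundary[OF \<delta> \<open>norm z = 1\<close> F, of 2 j] that
        fibre_hom_equivariant[OF q0(1) \<delta> _ SL2_fibre_rotation[OF \<open>norm z = 1\<close>] cleaving, of 2 j] by simp
    then show ?thesis by (simp add: h_def fibre_rotation_def prod_eq_iff)
  qed
  have "(\<lambda>z. h z /\<^sub>R norm (h z)) \<in> cball 0 1 \<rightarrow> frontier (cball 0 1)"
    using nz by (auto simp: frontier_cball)
  moreover have "continuous_on (cball 0 1) (\<lambda>z. h z /\<^sub>R norm (h z))"
    using nz by (intro continuous_intros cont) auto
  ultimately have "frontier (cball (0 :: complex \<times> complex) 1) retract_of cball 0 1"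
    unfolding retract_of_def retraction_def using id
    by (intro exI[of _ "\<lambda>z. h z /\<^sub>R norm (h z)"]) (auto simp: frontier_cball)
  then show False using no_retraction_cball[OF zero_less_one] by blast
qed

end

section \<open>The case of a parameter off the unit circle\<close>

text \<open>
  The standard representation of quantum \<open>SL\<^sub>2\<close> with parameter \<open>t\<close> on the functions supported in \<open>D\<close>: the diagonal
  entries shift along \<open>k\<close>, in the direction of the coordinate \<open>x\<close>, and the off-diagonal ones are multiples of \<open>t\<^sup>x\<close>.
  The weight of the raising operator vanishes at \<open>x = 0\<close>.
\<close>

definition ladder :: "(lattice \<Rightarrow> bool) \<Rightarrow> real \<Rightarrow> (lattice \<Rightarrow> int) \<Rightarrow> lattice \<Rightarrow> nat \<Rightarrow> nat \<Rightarrow> lattice linop" where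
  "ladder D t x k i j =
     (if i = 1 \<and> j = 1 then weighted_shift k (\<lambda>p. of_bool (D p))
      else if i = 2 \<and> j = 2 then weighted_shift (- k) (\<lambda>p. of_bool (D p) * of_real (1 - t ^ (2 * nat (x p))))
      else if i = 2 \<and> j = 1 then weighted_shift 0 (\<lambda>p. of_bool (D p) * of_real (t ^ nat (x p)))
      else weighted_shift 0 (\<lambda>p. of_bool (D p) * of_real (- t * t ^ nat (x p))))"

text \<open>Exchanging the two diagonal entries inverts the parameter.\<close>

definition flip :: "(nat \<Rightarrow> nat \<Rightarrow> 'r) \<Rightarrow> nat \<Rightarrow> nat \<Rightarrow> 'r" where
  "flip u i j = (if i = j then u (3 - i) (3 - j) else u i j)"

abbreviation indicator_op :: "(lattice \<Rightarrow> bool) \<Rightarrow> lattice linop" where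
  "indicator_op D \<equiv> weighted_shift 0 (\<lambda>p. of_bool (D p))"

lemma flip_simps [simp]: "flip u 1 1 = u 2 2" "flip u 2 2 = u 1 1" "flip u 1 2 = u 1 2" "flip u 2 1 = u 2 1"
  by (simp_all add: flip_def One_nat_def)

lemma ladder_simps:
  "ladder D t x k 1 1 = weighted_shift k (\<lambda>p. of_bool (D p))"
  "ladder D t x k 2 2 = weighted_shift (- k) (\<lambda>p. of_bool (D p) * of_real (1 - t ^ (2 * nat (x p))))"
  "ladder D t x k 2 1 = weighted_shift 0 (\<lambda>p. of_bool (D p) * of_real (t ^ nat (x p)))"
  "ladder D t x k 1 2 = weighted_shift 0 (\<lambda>p. of_bool (D p) * of_real (- t * t ^ nat (x p)))"
  by (simp_all add: ladder_def)

lemma weighted_shift_cong: "(\<And>p. a p = b p) \<Longrightarrow> weighted_shift k a = weighted_shift k b"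
  by presburger

lemma quantum_SL2_flip:
  assumes "t \<noteq> 0" "quantum_SL2 (corner e) t u"
  shows "quantum_SL2 (corner e) (inverse t) (flip u)"
  using assms unfolding quantum_SL2_corner by simp

lemma quantum_SL2_ladder:
  assumes t: "t \<noteq> 0" and D: "\<And>p. D p \<Longrightarrow> 0 \<le> x p \<and> D (p + k)" "\<And>p. D p \<Longrightarrow> 0 < x p \<Longrightarrow> D (p - k)"
    and x: "\<And>p. x (p + k) = x p + 1" "\<And>p. x (p - k) = x p - 1"
  shows "quantum_SL2 (corner (indicator_op D)) t (ladder D t x k)"
proof -
  have eq: "weighted_shift l a = weighted_shift l b"
    if z: "\<And>p. D p \<Longrightarrow> D (p + k) \<Longrightarrow> x p = 0 \<Longrightarrow> a p = b p"
      and pos: "\<And>p m. D p \<Longrightarrow> D (p + k) \<Longrightarrow> D (p - k) \<Longrightarrow> x p = int (Suc m) \<Longrightarrow> a p = b p"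
      and out: "\<And>p. \<not> D p \<Longrightarrow> a p = b p" for a b l
  proof (rule weighted_shift_cong)
    fix p
    show "a p = b p"
    proof (cases "D p")
      case True
      then obtain n where n: "x p = int n" using D(1) nonneg_int_cases by metis
      show ?thesis
      proof (cases n)
        case 0
        then show ?thesis using True z D n by simp
      next
        case (Suc m)
        then show ?thesis using True pos[of p m] D n by simp
      qed
    qed (rule out)
  qed
  have nat: "nat (1 + int m) = Suc m" "nat (int m + 1) = Suc m" "nat (2 + int m) = Suc (Suc m)" "nat (int m + 2) = Suc (Suc m)"
    and double: "c ^ (m * 2) = c ^ m * c ^ m" for m and c :: complex
    by (auto simp: power_mult power2_eq_square power_mult_distrib)
  note simps = ladder_simps weighted_shift_mult weighted_shift_scaleR weighted_shift_add nat double x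
    power_add power2_eq_square field_simps
  show ?thesis
    unfolding quantum_SL2_corner
  proof (intro conjI ballI)
    fix i j :: nat assume "i \<in> {1, 2}" "j \<in> {1, 2}"
    then have ij: "(i = 1 \<and> j = 1) \<or> (i = 1 \<and> j = 2) \<or> (i = 2 \<and> j = 1) \<or> (i = 2 \<and> j = 2)" by auto
    show "indicator_op D * ladder D t x k i j = ladder D t x k i j"
      using ij by (elim disjE conjE) (auto simp: ladder_simps weighted_shift_mult intro!: eq)
    show "ladder D t x k i j * indicator_op D = ladder D t x k i j"
      using ij by (elim disjE conjE) (auto simp: ladder_simps weighted_shift_mult intro!: eq)
  qed (use t in \<open>auto simp: simps intro!: eq\<close>)
qed


text \<open>
  The off-diagonal entries \<open>b\<close>, \<open>c\<close> become \<open>q S c\<close> and \<open>q\<^sup>-\<^sup>1 S\<^sup>-\<^sup>1 b\<close>: the product \<open>b c\<close>, and with it the relations, is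
  unchanged if \<open>S\<close> commutes with the entries.
\<close>

definition twist :: "real \<Rightarrow> 'r \<Rightarrow> 'r \<Rightarrow> (nat \<Rightarrow> nat \<Rightarrow> 'r::complex_ring) \<Rightarrow> nat \<Rightarrow> nat \<Rightarrow> 'r" where
  "twist q S S' u i j = (if i = 1 \<and> j = 2 then q *\<^sub>R (S * u 2 1)
     else if i = 2 \<and> j = 1 then inverse q *\<^sub>R (S' * u 1 2) else u i j)"

lemma twist_simps [simp]: "twist q S S' u 1 1 = u 1 1" "twist q S S' u 2 2 = u 2 2"
  "twist q S S' u 1 2 = q *\<^sub>R (S * u 2 1)" "twist q S S' u 2 1 = inverse q *\<^sub>R (S' * u 1 2)"
  by (simp_all add: twist_def)

lemma quantum_SL2_twist:
  fixes u :: "nat \<Rightarrow> nat \<Rightarrow> 'r::complex_ring"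
  assumes q: "q \<noteq> 0" and u: "quantum_SL2 (corner f) q u"
    and S: "f * S = S" "f * S' = S'" "S * S' = f" "S' * S = f"
    and comm: "\<And>i j. i \<in> {1, 2} \<Longrightarrow> j \<in> {1, 2} \<Longrightarrow> u i j * S = S * u i j \<and> u i j * S' = S' * u i j"
  shows "quantum_SL2 (corner f) q (twist q S S' u)"
proof -
  have c: "u 1 1 * S = S * u 1 1" "u 1 1 * S' = S' * u 1 1" "u 1 2 * S = S * u 1 2" "u 1 2 * S' = S' * u 1 2"
    "u 2 1 * S = S * u 2 1" "u 2 1 * S' = S' * u 2 1" "u 2 2 * S = S * u 2 2" "u 2 2 * S' = S' * u 2 2"
    using comm by auto
  have c': "u 1 1 * (S * x) = S * (u 1 1 * x)" "u 1 1 * (S' * x) = S' * (u 1 1 * x)"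
    "u 1 2 * (S * x) = S * (u 1 2 * x)" "u 2 1 * (S' * x) = S' * (u 2 1 * x)"
    "u 2 1 * (S * x) = S * (u 2 1 * x)" "u 1 2 * (S' * x) = S' * (u 1 2 * x)"
    "u 2 2 * (S * x) = S * (u 2 2 * x)" "u 2 2 * (S' * x) = S' * (u 2 2 * x)" for x
    using c by (metis mult.assoc)+
  have s: "f * (S * x) = S * x" "f * (S' * x) = S' * x" "S * (S' * x) = f * x" "S' * (S * x) = f * x" for x
    using S by (metis mult.assoc)+
  have e: "f * u i j = u i j" "u i j * f = u i j" if "i \<in> {1, 2}" "j \<in> {1, 2}" for i j
    using u that unfolding quantum_SL2_corner by blast+
  have e': "f * (u 1 2 * x) = u 1 2 * x" "f * (u 2 1 * x) = u 2 1 * x" for x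
    using e[of 1 2] e[of 2 1] by (metis insertCI mult.assoc)+
  have r: "u 1 1 * u 1 2 = q *\<^sub>R (u 1 2 * u 1 1)" "u 1 1 * u 2 1 = q *\<^sub>R (u 2 1 * u 1 1)"
     "u 1 2 * u 2 2 = q *\<^sub>R (u 2 2 * u 1 2)" "u 2 1 * u 2 2 = q *\<^sub>R (u 2 2 * u 2 1)"
     "u 2 1 * u 1 2 = u 1 2 * u 2 1"
     "u 1 1 * u 2 2 = q *\<^sub>R (u 1 2 * u 2 1) + f" "u 2 2 * u 1 1 = inverse q *\<^sub>R (u 1 2 * u 2 1) + f"
    using u unfolding quantum_SL2_corner by blast+
  show ?thesis
    unfolding quantum_SL2_corner
  proof (intro conjI ballI)
    fix i j :: nat assume "i \<in> {1, 2}" "j \<in> {1, 2}"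
    then have ij: "(i = 1 \<and> j = 1) \<or> (i = 1 \<and> j = 2) \<or> (i = 2 \<and> j = 1) \<or> (i = 2 \<and> j = 2)" by auto
    show "f * twist q S S' u i j = twist q S S' u i j" "twist q S S' u i j * f = twist q S S' u i j"
      using ij by (elim disjE conjE; simp add: e mult.assoc s)+
  next
    show "twist q S S' u 1 1 * twist q S S' u 1 2 = q *\<^sub>R (twist q S S' u 1 2 * twist q S S' u 1 1)"
      by (simp add: mult.assoc c' r(2))
    show "twist q S S' u 1 1 * twist q S S' u 2 1 = q *\<^sub>R (twist q S S' u 2 1 * twist q S S' u 1 1)"
      by (simp add: mult.assoc c' r(1))
    show "twist q S S' u 1 2 * twist q S S' u 2 2 = q *\<^sub>R (twist q S S' u 2 2 * twist q S S' u 1 2)"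
      by (simp add: mult.assoc c' r(4))
    show "twist q S S' u 2 1 * twist q S S' u 2 2 = q *\<^sub>R (twist q S S' u 2 2 * twist q S S' u 2 1)"
      by (simp add: mult.assoc c' r(3))
    show "twist q S S' u 2 1 * twist q S S' u 1 2 = twist q S S' u 1 2 * twist q S S' u 2 1"
      using q by (simp add: mult.assoc c' s e' r(5))
    show "twist q S S' u 1 1 * twist q S S' u 2 2 = q *\<^sub>R (twist q S S' u 1 2 * twist q S S' u 2 1) + f"
      using q by (simp add: mult.assoc c' s e' r(5,6))
    show "twist q S S' u 2 2 * twist q S S' u 1 1 = inverse q *\<^sub>R (twist q S S' u 1 2 * twist q S S' u 2 1) + f"
      using q by (simp add: mult.assoc c' s e' r(5,7))
  qed
qed

subsection \<open>Membership in the trace class\<close>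

definition decay :: "real \<Rightarrow> lattice \<Rightarrow> real" where
  "decay r p = r ^ (nat \<bar>fst p\<bar> + nat \<bar>snd p\<bar>)"

lemma geometric_int_summable:
  fixes r :: real
  assumes "0 \<le> r" "r < 1"
  shows "(\<lambda>n :: int. r ^ nat \<bar>n\<bar>) summable_on UNIV"
proof -
  have g: "(\<lambda>n :: nat. r ^ n) summable_on UNIV"
    by (rule summable_nonneg_imp_summable_on[OF summable_geometric]) (use assms in auto)
  have "(\<lambda>n :: int. r ^ nat \<bar>n\<bar>) summable_on range int" "(\<lambda>n :: int. r ^ nat \<bar>n\<bar>) summable_on range (\<lambda>n. - int n)"
    using g by (subst summable_on_reindex; auto simp: inj_on_def o_def)+
  then have "(\<lambda>n :: int. r ^ nat \<bar>n\<bar>) summable_on (range int \<union> range (\<lambda>n. - int n))"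
    by (rule summable_on_union)
  moreover have "range int \<union> range (\<lambda>n. - int n) = UNIV"
    by (auto simp: image_iff) (metis int_cases2)
  ultimately show ?thesis by simp
qed

lemma decay_summable:
  assumes "0 \<le> r" "r < 1"
  shows "decay r summable_on UNIV"
proof -
  define c where "c = (\<Sum>\<^sub>\<infinity>n :: int. r ^ nat \<bar>n\<bar>)"
  have g: "((\<lambda>n :: int. r ^ nat \<bar>n\<bar>) has_sum c) UNIV"
    unfolding c_def using geometric_int_summable[OF assms] by (rule has_sum_infsum)
  have "decay r summable_on (UNIV \<times> UNIV)"
  proof (rule summable_on_SigmaI)
    show "((\<lambda>m. decay r (n, m)) has_sum r ^ nat \<bar>n\<bar> * c) UNIV" for n
      using has_sum_cmult_right[OF g, of "r ^ nat \<bar>n\<bar>"] by (simp add: decay_def power_add)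
    show "(\<lambda>n :: int. r ^ nat \<bar>n\<bar> * c) summable_on UNIV"
      by (intro summable_on_cmult_left geometric_int_summable assms)
  qed (use assms in \<open>auto simp: decay_def\<close>)
  then show ?thesis by simp
qed

lemma trace_shift:
  assumes "0 \<le> r" "r < 1" "\<And>p. norm (a p) \<le> C * decay r p"
  shows "weighted_shift k a \<in> trace_ops"
proof (rule shift_span_base)
  have "(\<lambda>p. C * decay r p) summable_on UNIV"
    by (intro summable_on_cmult_right decay_summable assms)
  then have "(\<lambda>p. norm (a p)) summable_on UNIV"
    by (rule summable_on_comparison_test) (use assms(3) in auto)
  then show "a \<in> summable_weights" by (simp add: summable_weights_def)
qed

lemma bounded_shift:
  assumes "\<And>p. norm (a p) \<le> C"
  shows "weighted_shift k a \<in> bounded_ops"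
  using assms by (intro shift_span_base) (auto simp: bounded_weights_def)


subsection \<open>The quarter plane and the half plane\<close>

definition quadrant :: "lattice \<Rightarrow> bool" where "quadrant p \<longleftrightarrow> 0 \<le> fst p \<and> 0 \<le> snd p"
definition half_plane :: "lattice \<Rightarrow> bool" where "half_plane p \<longleftrightarrow> 0 \<le> fst p"

context
  fixes s :: real
  assumes s: "s \<noteq> 0" "\<bar>s\<bar> < 1"
begin

text \<open>
  On the quarter plane \<open>U\<close>, with parameter \<open>s\<close>, acts in the first coordinate and \<open>W\<close>, with parameter \<open>s\<^sup>2\<close>, in the
  second; they commute and represent the ball. Far up in the second coordinate the diagonal entries of \<open>W\<close>
  become invertible shifts and its off-diagonal entries disappear, so the boundary is represented on the half
  plane by \<open>V\<close>, which is \<open>U\<close> without the lower edge, and by the vertical shifts \<open>S\<close>.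
\<close>

abbreviation "U \<equiv> ladder quadrant s fst (1, 0)"
abbreviation "W \<equiv> ladder quadrant (s\<^sup>2) snd (0, 1)"
abbreviation "V \<equiv> ladder half_plane s fst (1, 0)"
abbreviation "e \<equiv> indicator_op quadrant"
abbreviation "f \<equiv> indicator_op half_plane"
abbreviation "S k \<equiv> weighted_shift (0, k) (\<lambda>p. of_bool (half_plane p))"

lemma SL2_U: "quantum_SL2 (corner e) s U"
  using s by (intro quantum_SL2_ladder) (auto simp: quadrant_def)

lemma SL2_W: "quantum_SL2 (corner e) (s\<^sup>2) W"
  using s by (intro quantum_SL2_ladder) (auto simp: quadrant_def)

lemma SL2_V: "quantum_SL2 (corner f) s V"
  using s by (intro quantum_SL2_ladder) (auto simp: half_plane_def)

lemma plane_units: "e * e = e" "f * f = f" "e * f = e" "f * e = e"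
  by (auto simp: weighted_shift_mult quadrant_def half_plane_def intro!: weighted_shift_cong)

lemma entries_cases: "i \<in> {1, 2} \<Longrightarrow> j \<in> {1, 2} \<Longrightarrow>
    (i = 1 \<and> j = 1) \<or> (i = 1 \<and> j = 2) \<or> (i = 2 \<and> j = 1) \<or> (i = 2 \<and> j = (2 :: nat))" for i j :: nat
  by auto

lemma UW_commute:
  assumes "i \<in> {1, 2}" "j \<in> {1, 2}" "k \<in> {1, 2}" "l \<in> {1, 2}"
  shows "U i j * W k l = W k l * U i j"
  using entries_cases[OF assms(1,2)] entries_cases[OF assms(3,4)]
  by (elim disjE conjE)
    (auto simp: ladder_simps weighted_shift_mult quadrant_def of_bool_def intro!: weighted_shift_cong)

lemma VS_commute: "i \<in> {1, 2} \<Longrightarrow> j \<in> {1, 2} \<Longrightarrow> V i j * S k = S k * V i j"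
  apply (drule (1) entries_cases)
  by (elim disjE conjE)
    (auto simp: ladder_simps weighted_shift_mult half_plane_def of_bool_def intro!: weighted_shift_cong)

lemma S_simps: "f * S k = S k" "S k * S (- k) = f" "S (- k) * S k = f"
  by (auto simp: weighted_shift_mult half_plane_def zero_prod_def intro!: weighted_shift_cong)

lemma power_le_one: "\<bar>s\<bar> ^ n \<le> 1" "\<bar>s ^ n\<bar> \<le> 1"
  using s by (auto simp: power_abs power_le_one)

lemma weights_bounded: "norm (of_bool b * complex_of_real (1 - t)) \<le> 2" "norm (of_bool b * complex_of_real t) \<le> 2"
  if "\<bar>t\<bar> \<le> 1"
proof -
  have "norm (complex_of_real (1 - t)) \<le> 2" "norm (complex_of_real t) \<le> 2"
    using that unfolding norm_of_real by linarith+
  then show "norm (of_bool b * complex_of_real (1 - t)) \<le> 2" "norm (of_bool b * complex_of_real t) \<le> 2"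
    by (cases b; simp)+
qed

lemma ladder_bounded:
  assumes "\<bar>t\<bar> \<le> 1" "i \<in> {1, 2}" "j \<in> {1, 2}"
  shows "ladder D t x k i j \<in> bounded_ops"
proof -
  have t: "\<bar>t ^ n\<bar> \<le> 1" "\<bar>- t * t ^ n\<bar> \<le> 1" for n
  proof -
    show "\<bar>t ^ n\<bar> \<le> 1" using assms(1) by (simp add: power_abs Power.power_le_one)
    then show "\<bar>- t * t ^ n\<bar> \<le> 1" using assms(1) mult_le_one[of "\<bar>t\<bar>" "\<bar>t ^ n\<bar>"] by (simp add: abs_mult)
  qed
  have "ladder D t x k 1 1 \<in> bounded_ops"
    unfolding ladder_simps by (rule bounded_shift[where C = 1]) simp
  moreover have "ladder D t x k 2 2 \<in> bounded_ops" "ladder D t x k 2 1 \<in> bounded_ops" "ladder D t x k 1 2 \<in> bounded_ops"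
    unfolding ladder_simps by (rule bounded_shift[OF weights_bounded(1)] bounded_shift[OF weights_bounded(2)], rule t)+
  ultimately show ?thesis using entries_cases[OF assms(2,3)] by auto
qed

lemma plane_bounded: "e \<in> bounded_ops" "f \<in> bounded_ops" "S k \<in> bounded_ops"
  by (rule bounded_shift[where C = 1], simp)+

lemma V_restrict:
  assumes "i \<in> {1, 2}" "j \<in> {1, 2}"
  shows "e * V i j - V i j * e = 0" "e * V i j * e = U i j"
proof -
  have "e * V i j = U i j" "V i j * e = U i j"
    using entries_cases[OF assms]
    by (elim disjE conjE; force simp: ladder_simps weighted_shift_mult half_plane_def quadrant_def of_bool_def
        intro!: weighted_shift_cong)+
  moreover have "U i j * e = U i j"
    using SL2_U assms unfolding quantum_SL2_corner by blast
  ultimately show "e * V i j - V i j * e = 0" "e * V i j * e = U i j" by simp_all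
qed

lemma decay_s: "0 \<le> \<bar>s\<bar>" "\<bar>s\<bar> < 1" using s by auto

text \<open>
  The commutator of the projection with a vertical shift is concentrated on the edge of the quarter plane, and
  there the factor \<open>s\<^sup>x\<close> makes it summable.
\<close>

lemma shift_boundary:
  assumes "k = 1 \<or> k = - 1"
  shows "e * (S k * V 2 1) - S k * V 2 1 * e \<in> trace_ops"
proof -
  have "e * (S k * V 2 1) - S k * V 2 1 * e = weighted_shift (0, k) (\<lambda>p.
      (of_bool (quadrant p) - of_bool (quadrant (p + (0, k)))) * of_real (s ^ nat (fst p)))"
    by (auto simp: ladder_simps weighted_shift_mult weighted_shift_diff quadrant_def half_plane_def of_bool_def
        intro!: weighted_shift_cong)
  moreover have "\<dots> \<in> trace_ops"
  proof (rule trace_shift[OF decay_s, where C = "1 / \<bar>s\<bar>"])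
    fix p :: lattice
    show "norm ((of_bool (quadrant p) - of_bool (quadrant (p + (0, k)))) * complex_of_real (s ^ nat (fst p)))
        \<le> 1 / \<bar>s\<bar> * decay \<bar>s\<bar> p"
    proof (cases "0 \<le> fst p \<and> (snd p = 0 \<or> snd p = - 1)")
      case True
      have "norm ((of_bool (quadrant p) - of_bool (quadrant (p + (0, k)))) * complex_of_real (s ^ nat (fst p)))
          \<le> \<bar>s\<bar> ^ nat (fst p)"
        by (auto simp: norm_mult norm_power of_bool_def)
      also have "\<dots> \<le> 1 / \<bar>s\<bar> * decay \<bar>s\<bar> p"
        using True s by (auto simp: decay_def power_add field_simps mult_left_le)
      finally show ?thesis .
    next
      case False
      then have "quadrant p = quadrant (p + (0, k))" using assms by (auto simp: quadrant_def)
      then show ?thesis using s by (simp add: decay_def)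
    qed
  qed
  ultimately show ?thesis by simp
qed

text \<open>
  The weights of \<open>W 1 1\<close> are exactly those of a shift and the weights of \<open>W 2 2\<close> tend to \<open>1\<close> geometrically; in the other
  direction the factor \<open>s\<^sup>x\<close> decays.
\<close>

lemma shift_limit: "W 1 1 * U 2 1 - e * (S 1 * V 2 1) * e \<in> trace_ops"
  "W 2 2 * U 2 1 - e * (S (- 1) * V 2 1) * e \<in> trace_ops"
proof -
  have "W 1 1 * U 2 1 - e * (S 1 * V 2 1) * e = weighted_shift (0, 1) (\<lambda>p. 0)"
    by (auto simp: ladder_simps weighted_shift_mult weighted_shift_diff quadrant_def half_plane_def of_bool_def
        intro!: weighted_shift_cong)
  moreover have "weighted_shift (0, 1) (\<lambda>p. 0) \<in> trace_ops"
    by (rule trace_shift[OF decay_s, where C = 0]) simp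
  ultimately show "W 1 1 * U 2 1 - e * (S 1 * V 2 1) * e \<in> trace_ops" by simp
  have "W 2 2 * U 2 1 - e * (S (- 1) * V 2 1) * e = weighted_shift (0, - 1) (\<lambda>p.
      - (of_bool (quadrant p \<and> snd p \<noteq> 0) * of_real ((s\<^sup>2) ^ (2 * nat (snd p)) * s ^ nat (fst p))))"
    by (auto simp: ladder_simps weighted_shift_mult weighted_shift_diff quadrant_def half_plane_def of_bool_def
        algebra_simps intro!: weighted_shift_cong)
  moreover have "\<dots> \<in> trace_ops"
  proof (rule trace_shift[OF decay_s, where C = 1])
    fix p :: lattice
    show "norm (- (of_bool (quadrant p \<and> snd p \<noteq> 0) * complex_of_real ((s\<^sup>2) ^ (2 * nat (snd p)) * s ^ nat (fst p))))
        \<le> 1 * decay \<bar>s\<bar> p"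
    proof (cases "quadrant p")
      case True
      have "\<bar>s\<bar> ^ (2 * (2 * nat (snd p)) + nat (fst p)) \<le> \<bar>s\<bar> ^ (nat (snd p) + nat (fst p))"
        using s by (intro power_decreasing) auto
      then show ?thesis
        using True by (simp add: norm_mult norm_power decay_def quadrant_def power_mult[symmetric] power_add mult.commute of_bool_def)
    qed (simp add: decay_def)
  qed
  ultimately show "W 2 2 * U 2 1 - e * (S (- 1) * V 2 1) * e \<in> trace_ops" by simp
qed

lemma U12: "U 1 2 = - s *\<^sub>R U 2 1" "V 1 2 = - s *\<^sub>R V 2 1" "W 1 2 = - (s\<^sup>2) *\<^sub>R W 2 1"
  by (auto simp: ladder_simps weighted_shift_scaleR intro!: weighted_shift_cong)

lemma WU_trace: "W 2 1 * U 2 1 \<in> trace_ops"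
proof -
  have "W 2 1 * U 2 1 = weighted_shift 0 (\<lambda>p. of_bool (quadrant p) * of_real ((s\<^sup>2) ^ nat (snd p) * s ^ nat (fst p)))"
    by (auto simp: ladder_simps weighted_shift_mult of_bool_def intro!: weighted_shift_cong)
  moreover have "\<dots> \<in> trace_ops"
  proof (rule trace_shift[OF decay_s, where C = 1])
    fix p :: lattice
    show "norm (of_bool (quadrant p) * complex_of_real ((s\<^sup>2) ^ nat (snd p) * s ^ nat (fst p))) \<le> 1 * decay \<bar>s\<bar> p"
    proof (cases "quadrant p")
      case True
      have "\<bar>s\<bar> ^ (2 * nat (snd p) + nat (fst p)) \<le> \<bar>s\<bar> ^ (nat (snd p) + nat (fst p))"
        using s by (intro power_decreasing) auto
      then show ?thesis
        using True by (simp add: norm_mult norm_power decay_def quadrant_def power_mult[symmetric] power_add mult.commute of_bool_def)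
    qed (simp add: decay_def)
  qed
  ultimately show ?thesis by simp
qed

text \<open>A nonzero multiple of a convergent sum of squares with a nonzero term at the origin.\<close>

lemma index_nonzero: "op_trace (W 1 2 * W 2 1 * (U 1 2 * U 2 1)) \<noteq> 0"
proof -
  define g where "g p = of_bool (quadrant p) * (s ^ nat (fst p) * (s\<^sup>2) ^ nat (snd p))\<^sup>2" for p :: lattice
  have g: "g summable_on UNIV"
  proof (rule summable_on_comparison_test[OF decay_summable[OF decay_s]])
    fix p :: lattice
    show "g p \<le> decay \<bar>s\<bar> p"
    proof (cases "quadrant p")
      case True
      have "\<bar>s\<bar> ^ (2 * nat (fst p) + 4 * nat (snd p)) \<le> \<bar>s\<bar> ^ (nat (fst p) + nat (snd p))"
        using s by (intro power_decreasing) auto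
      moreover have "(s ^ nat (fst p) * (s\<^sup>2) ^ nat (snd p))\<^sup>2 = \<bar>s\<bar> ^ (2 * nat (fst p) + 4 * nat (snd p))"
      proof -
        have "(s ^ nat (fst p) * (s\<^sup>2) ^ nat (snd p))\<^sup>2 = s ^ (2 * (nat (fst p) + 2 * nat (snd p)))"
          by (simp add: power_mult_distrib power_add power_mult[symmetric] mult.commute)
        also have "\<dots> = \<bar>s\<bar> ^ (2 * (nat (fst p) + 2 * nat (snd p)))" by (simp only: power_mult power2_abs)
        finally show ?thesis by (simp add: distrib_left)
      qed
      ultimately show ?thesis using True by (simp add: g_def decay_def quadrant_def)
    qed (simp add: g_def decay_def)
  qed (simp add: g_def)
  have pos: "infsum g UNIV \<noteq> 0"
  proof
    assume "infsum g UNIV = 0"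
    then have "g (0, 0) = 0"
      using g by (intro nonneg_infsum_le_0D[of g UNIV]) (auto simp: g_def)
    then show False by (simp add: g_def quadrant_def)
  qed
  have "W 1 2 * W 2 1 * (U 1 2 * U 2 1) = weighted_shift 0 (\<lambda>p. of_real (s ^ 3) * of_real (g p))"
    by (auto simp: ladder_simps weighted_shift_mult g_def of_bool_def power2_eq_square power3_eq_cube
        intro!: weighted_shift_cong)
  then have "op_trace (W 1 2 * W 2 1 * (U 1 2 * U 2 1)) = of_real (s ^ 3) * (\<Sum>\<^sub>\<infinity>p. complex_of_real (g p))"
    by (simp only: op_trace_weighted_shift if_True refl infsum_cmult_right')
  also have "(\<Sum>\<^sub>\<infinity>p. complex_of_real (g p)) = of_real (infsum g UNIV)"
    using has_sum_of_real[OF has_sum_infsum[OF g]] by (rule infsumI)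
  finally show ?thesis using pos s by simp
qed

text \<open>
  For \<open>q = s\<close> the representations \<open>U\<close>, \<open>W\<close> and the twisted \<open>V\<close> satisfy the hypotheses of the index obstruction; for
  \<open>q = s\<^sup>-\<^sup>1\<close> their flipped versions do.
\<close>

lemma no_cleaving_matrices:
  assumes \<delta>: "is_coaction_R q \<delta>" and q: "q = s \<or> q = inverse s" 
    and cleaving: "cleaving_matrices q \<delta> F G"
  shows False
proof -
  have q0: "q \<noteq> 0" using q s by auto
  have s2: "\<bar>s\<^sup>2\<bar> \<le> 1" "\<bar>s\<bar> \<le> 1" using s power_le_one(2)[of 2] by auto
  have q2: "(q - inverse q) * (q\<^sup>2 - inverse q ^ 2) \<noteq> 0"
  proof -
    have "q\<^sup>2 \<noteq> 1" using q s by (auto simp: power2_eq_1_iff field_simps abs_if split: if_splits)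
    moreover have "q ^ 4 \<noteq> 1"
    proof
      assume "q ^ 4 = 1"
      then have "(q\<^sup>2)\<^sup>2 = 1" by simp
      then show False using \<open>q\<^sup>2 \<noteq> 1\<close> using zero_le_power2[of q] by (simp only: power2_eq_1_iff) auto
    qed
    moreover have "q - inverse q = inverse q * (q\<^sup>2 - 1)"
      using q0 by (simp add: field_simps power2_eq_square)
    moreover have "q\<^sup>2 - inverse q ^ 2 = inverse (q\<^sup>2) * (q ^ 4 - 1)"
      using q0 by (simp add: right_diff_distrib power_inverse power_add[symmetric] field_simps)
    ultimately show ?thesis
      using q0 by simp
  qed
  have bounded: "U i j \<in> bounded_ops" "W i j \<in> bounded_ops" "V i j \<in> bounded_ops" if "i \<in> {1, 2}" "j \<in> {1, 2}" for i j
    using ladder_bounded[OF _ that] s2 by auto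
  have scaled: "r *\<^sub>R X \<in> bounded_ops" if "X \<in> bounded_ops" for r X
    using bounded_ops_cscale[OF that, of "of_real r"] by (simp add: cscale_of_real)
  have zero: "0 \<in> trace_ops" by (rule shift_span.zero)
  have twist_bounded: "twist q (S k) (S l) X i j \<in> bounded_ops"
    if "\<And>i j. i \<in> {1, 2} \<Longrightarrow> j \<in> {1, 2} \<Longrightarrow> X i j \<in> bounded_ops" "i \<in> {1, 2}" "j \<in> {1, 2}" for k l X i j
    using that unfolding twist_def by (auto intro!: scaled bounded_ops_mult plane_bounded)
  have boundary: "e * (r *\<^sub>R (S k * V 2 1)) - r *\<^sub>R (S k * V 2 1) * e \<in> trace_ops"
      "e * (r *\<^sub>R (S k * V 1 2)) - r *\<^sub>R (S k * V 1 2) * e \<in> trace_ops" if "k = 1 \<or> k = - 1" for r k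
  proof -
    have "e * (a *\<^sub>R X) - (a *\<^sub>R X) * e = a *\<^sub>R (e * X - X * e)" for a X by (simp add: algebra_simps)
    from this[of _ "S k * V 2 1"] have c: "e * (a *\<^sub>R (S k * V 2 1)) - a *\<^sub>R (S k * V 2 1) * e \<in> trace_ops" for a
      using trace_ops_scaleR[OF shift_boundary[OF that]] by simp
    show "e * (r *\<^sub>R (S k * V 2 1)) - r *\<^sub>R (S k * V 2 1) * e \<in> trace_ops" by (rule c)
    show "e * (r *\<^sub>R (S k * V 1 2)) - r *\<^sub>R (S k * V 1 2) * e \<in> trace_ops"
      using c[of "r * - s"] unfolding U12 by (simp add: algebra_simps)
  qed
  have limit: "r *\<^sub>R (W i i * U 2 1) - e * (r *\<^sub>R (S k * V 2 1)) * e \<in> trace_ops"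
    "r *\<^sub>R (W i i * U 1 2) - e * (r *\<^sub>R (S k * V 1 2)) * e \<in> trace_ops"
    if "i = 1 \<and> k = 1 \<or> i = 2 \<and> k = - 1" for r i k
  proof -
    have "W i i * U 2 1 - e * (S k * V 2 1) * e \<in> trace_ops" using that shift_limit by auto
    moreover have "a *\<^sub>R (W i i * U 2 1) - e * (a *\<^sub>R (S k * V 2 1)) * e = a *\<^sub>R (W i i * U 2 1 - e * (S k * V 2 1) * e)" for a
      by (simp add: algebra_simps)
    ultimately have c: "a *\<^sub>R (W i i * U 2 1) - e * (a *\<^sub>R (S k * V 2 1)) * e \<in> trace_ops" for a
      using trace_ops_scaleR by metis
    show "r *\<^sub>R (W i i * U 2 1) - e * (r *\<^sub>R (S k * V 2 1)) * e \<in> trace_ops" by (rule c)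
    show "r *\<^sub>R (W i i * U 1 2) - e * (r *\<^sub>R (S k * V 1 2)) * e \<in> trace_ops"
      using c[of "r * - s"] unfolding U12 by (simp add: algebra_simps)
  qed
  have vanish: "W 1 2 * U 1 2 \<in> trace_ops" "W 2 1 * U 2 1 \<in> trace_ops"
    using WU_trace trace_ops_scaleR[OF WU_trace, of "s ^ 3"] unfolding U12
    by (simp_all add: power2_eq_square power3_eq_cube mult.assoc)
  have S: "f * S k = S k" "S k * S (- k) = f" "S (- k) * S k = f" for k by (rule S_simps)+
  have flip_in: "flip X i j = X (if i = j then 3 - i else i) (if i = j then 3 - j else j)" for X i j
    by (simp add: flip_def)
  have flip_range: "(if i = j then 3 - i else i) \<in> {1, 2}" "(if i = j then 3 - j else j) \<in> {1, 2}"
    if "i \<in> {1, 2}" "j \<in> {1, 2}" for i j :: nat using that by auto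
  from q have "(q - inverse q) * (q\<^sup>2 - inverse q ^ 2) = 0 \<or> op_trace (W 1 2 * W 2 1 * (U 1 2 * U 2 1)) = 0"
  proof
    assume qs: "q = s"
    let ?h = "twist q (S 1) (S (- 1)) V"
    show ?thesis
    proof (rule index_vanishes[where u = U and w = W and h = ?h and e = e and f = f])
      show "q \<noteq> 0" "is_coaction_R q \<delta>" "cleaving_matrices q \<delta> F G" by fact+
      show "e * e = e" "f * f = f" "e * f = e" "f * e = e" by (rule plane_units)+
      show "quantum_SL2 (corner e) q U" "quantum_SL2 (corner e) (q\<^sup>2) W" unfolding qs by (rule SL2_U SL2_W)+
      show "quantum_SL2 (corner f) q ?h"
        using SL2_V VS_commute unfolding qs by (intro quantum_SL2_twist s S) auto
      show "U i j * W k l = W k l * U i j" if "i \<in> {1, 2}" "j \<in> {1, 2}" "k \<in> {1, 2}" "l \<in> {1, 2}" for i j k l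
        using that by (rule UW_commute)
      show "e \<in> bounded_ops" "f \<in> bounded_ops" by (rule plane_bounded)+
      show "U i j \<in> bounded_ops \<and> W i j \<in> bounded_ops \<and> ?h i j \<in> bounded_ops" if "i \<in> {1, 2}" "j \<in> {1, 2}" for i j
        using bounded twist_bounded that by simp
      show "e * ?h i j - ?h i j * e \<in> trace_ops" if "i \<in> {1, 2}" "j \<in> {1, 2}" for i j
        using entries_cases[OF that]
        by (elim disjE conjE) (simp_all only: twist_simps V_restrict(1)[of 1 1] V_restrict(1)[of 2 2] zero boundary simp_thms insert_iff)
      show "U 1 1 - e * ?h 1 1 * e \<in> trace_ops" "U 2 2 - e * ?h 2 2 * e \<in> trace_ops"
        using V_restrict(2)[of 1 1] V_restrict(2)[of 2 2] zero by simp_all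
      show "q *\<^sub>R (W 1 1 * U 2 1) - e * ?h 1 2 * e \<in> trace_ops"
        "inverse q *\<^sub>R (W 2 2 * U 1 2) - e * ?h 2 1 * e \<in> trace_ops"
        by (simp_all only: twist_simps limit simp_thms)
    qed (use vanish in auto)
  next
    assume qs: "q = inverse s"
    let ?h = "twist q (S (- 1)) (S 1) (flip V)"
    have qs2: "q\<^sup>2 = inverse (s\<^sup>2)" using qs by (simp add: power_inverse)
    have "(q - inverse q) * (q\<^sup>2 - inverse q ^ 2) = 0 \<or>
        op_trace (flip W 1 2 * flip W 2 1 * (flip U 1 2 * flip U 2 1)) = 0"
    proof (rule index_vanishes[where u = "flip U" and w = "flip W" and h = ?h and e = e and f = f])
      show "q \<noteq> 0" "is_coaction_R q \<delta>" "cleaving_matrices q \<delta> F G" by fact+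
      show "e * e = e" "f * f = f" "e * f = e" "f * e = e" by (rule plane_units)+
      show "quantum_SL2 (corner e) q (flip U)" "quantum_SL2 (corner e) (q\<^sup>2) (flip W)"
        unfolding qs2 unfolding qs using s SL2_U SL2_W by (auto intro: quantum_SL2_flip)
      have "quantum_SL2 (corner f) q (flip V)"
        unfolding qs using s SL2_V by (auto intro: quantum_SL2_flip)
      moreover have "flip V i j * S k = S k * flip V i j" if "i \<in> {1, 2}" "j \<in> {1, 2}" for i j k
        unfolding flip_in using flip_range[OF that] by (rule VS_commute)
      ultimately show "quantum_SL2 (corner f) q ?h"
        using S(2,3)[of 1] by (intro quantum_SL2_twist q0 S(1)) auto
      show "flip U i j * flip W k l = flip W k l * flip U i j"
        if "i \<in> {1, 2}" "j \<in> {1, 2}" "k \<in> {1, 2}" "l \<in> {1, 2}" for i j k l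
        unfolding flip_in using flip_range[OF that(1,2)] flip_range[OF that(3,4)] by (rule UW_commute)
      show "e \<in> bounded_ops" "f \<in> bounded_ops" by (rule plane_bounded)+
      have fb: "flip X i j \<in> bounded_ops"
        if "\<And>i j. i \<in> {1, 2} \<Longrightarrow> j \<in> {1, 2} \<Longrightarrow> X i j \<in> bounded_ops" "i \<in> {1, 2}" "j \<in> {1, 2}" for X i j
        unfolding flip_in using flip_range[OF that(2,3)] by (rule that(1))
      show "flip U i j \<in> bounded_ops \<and> flip W i j \<in> bounded_ops \<and> ?h i j \<in> bounded_ops"
        if "i \<in> {1, 2}" "j \<in> {1, 2}" for i j
        using bounded that by (intro conjI fb twist_bounded) auto
      show "e * ?h i j - ?h i j * e \<in> trace_ops" if "i \<in> {1, 2}" "j \<in> {1, 2}" for i j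
        using entries_cases[OF that]
        by (elim disjE conjE)
          (simp_all only: twist_simps flip_simps V_restrict(1)[of 1 1] V_restrict(1)[of 2 2] zero boundary simp_thms insert_iff)
      show "flip U 1 1 - e * ?h 1 1 * e \<in> trace_ops" "flip U 2 2 - e * ?h 2 2 * e \<in> trace_ops"
        using V_restrict(2)[of 1 1] V_restrict(2)[of 2 2] zero by simp_all
      show "q *\<^sub>R (flip W 1 1 * flip U 2 1) - e * ?h 1 2 * e \<in> trace_ops"
        "inverse q *\<^sub>R (flip W 2 2 * flip U 1 2) - e * ?h 2 1 * e \<in> trace_ops"
        by (simp_all only: twist_simps flip_simps limit simp_thms)
    qed (use vanish in auto)
    then show ?thesis by simp
  qed
  then show False using q2 index_nonzero by simp
qed

end

section \<open>The quantum Hopf fibration over the four-sphere\<close>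

theorem proposition9:
  fixes q :: real
    and \<delta>\<^sub>R :: "(nat \<times> nat) presented \<Rightarrow> ((nat \<times> nat) presented, su_generator presented) tensor"
  assumes "q \<noteq> 0"
    and "is_coaction_R q \<delta>\<^sub>R"
  shows "\<not> cleft_extension (A_SU q) (SU_comult q) (SU_counit q) (A_S4 q) (A_S7 q) \<delta>\<^sub>R"
proof
  assume "cleft_extension (A_SU q) (SU_comult q) (SU_counit q) (A_S4 q) (A_S7 q) \<delta>\<^sub>R"
  then obtain F G where cleaving: "cleaving_matrices q \<delta>\<^sub>R F G"
    using cleft_matrices[OF assms] by blast
  consider "\<bar>q\<bar> = 1" | "\<bar>q\<bar> < 1" | "\<bar>inverse q\<bar> < 1"
    using assms(1) one_less_inverse_iff[of "\<bar>inverse q\<bar>"] by fastforce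
  then show False
  proof cases
    case 1
    then have "q * q = 1" by (auto simp: abs_if split: if_splits)
    from no_cleaving_matrices_unit[OF this assms(2) cleaving] show False .
  next
    case 2
    show False
      by (rule no_cleaving_matrices[OF assms(1) 2 assms(2) _ cleaving]) simp_all
  next
    case 3
    show False
      by (rule no_cleaving_matrices[OF _ 3 assms(2) _ cleaving]) (use assms(1) in simp_all)
  qed
qed


end
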